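(* Let $\sigma\in\mathbb R_+$ with $\sigma\le s_4^2$, and let $\epsilon\in(0,1)$. For $t\in\mathbb R_+$ put $$\zeta_*(t)=\sqrt{2.032(\kappa-1)\Big(\frac{0.73\,\mathbf{Tr}(G)}{t}+\log(K)+\log(\epsilon^{-1})\Big)}+\sqrt{\frac{98.5\,\kappa\,\mathbf{Tr}(G)}{t}}$$ and $$B_*(t)=\begin{cases}\dfrac{n^{-1/2}\zeta_*(\max\{t,\sigma\})}{1-4\,n^{-1/2}\zeta_*(\max\{t,\sigma\})} & \text{if } \big[6+(\kappa-1)^{-1}\big]\zeta_*(\max\{t,\sigma\})\le\sqrt n,\\ +\infty&\text{otherwise.}\end{cases}$$ Then, with probability at least $1-2\epsilon$, for any $\theta\in\mathbb R^d\setminus\{0\}$, $$\left|\frac{\max\{N(\theta),\sigma\|\theta\|^2\}}{\max\{\widehat N(\theta),\sigma\|\theta\|^2\}}-1\right|\le B_*\big[\|\theta\|^{-2}N(\theta)\big],$$ where $\widehat N$ is the robust estimator defined in the context.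
   Context: $X\in\mathbb R^d$ is a random vector of law $\mathrm P$, and $X_1,\dots,X_n$ is an i.i.d. sample from $\mathrm P$; $N(\theta)=\mathbb E[\langle\theta,X\rangle^2]$, $G=\mathbb E[XX^\top]$, $\mathbf{Tr}(G)=\mathbb E[\|X\|^2]$. The quantities $$s_4=\mathbb E[\|X\|^4]^{1/4},\qquad \kappa=\sup_{\theta\in\mathbb R^d,\ \mathbb E[\langle\theta,X\rangle^2]>0}\frac{\mathbb E[\langle\theta,X\rangle^4]}{\mathbb E[\langle\theta,X\rangle^2]^2}$$ are assumed finite, and $\kappa>1$. Let $\psi:\mathbb R\to\mathbb R$ be the odd function with $\psi(t)=-\log(1-t+t^2/2)$ for $0\le t\le1$ and $\psi(t)=\log 2$ for $t\ge1$. For $\lambda>0$ let $r_\lambda(\theta)=\frac1n\sum_{i=1}^n\psi(\langle\theta,X_i\rangle^2-\lambda)$, $\widehat\alpha_\lambda(\theta)=\sup\{\alpha\in\mathbb R_+: r_\lambda(\alpha\theta)\le0\}\in(0,+\infty]$, and $\widetilde N_\lambda(\theta)=\lambda/\widehat\alpha_\lambda(\theta)^2$ (equal to $0$ if $\widehat\alpha_\lambda(\theta)=+\infty$). Let $c=\frac{15}{8\log(2)(\sqrt2-1)}\exp\big(\frac{1+2\sqrt2}{2}\big)$, $a=1/2$, $K=1+\big\lceil a^{-1}\log\big(\frac{n}{72(2+c)\kappa^{1/2}}\big)\big\rceil$, assumed $\ge1$, and $\Lambda=\{(\lambda_j,\beta_j):0\le j<K\}$ with $$\lambda_j=\sqrt{\frac{2}{n(\kappa-1)}\Big(\frac{2+3c}{4(2+c)\kappa^{1/2}\exp(-ja)}+\log(K/\epsilon)\Big)},\qquad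 \beta_j=\sqrt{2(2+c)\kappa^{1/2}s_4^4\,n\exp[-(j-1/2)a]}.$$ For $(\lambda,\beta)\in\Lambda$ put $$\xi=\frac{\kappa\lambda}{2},\quad \mu=\lambda(\kappa-1)+\frac{(2+c)\kappa^{1/2}s_4^2}{\beta},\quad \gamma=\frac\lambda2(\kappa-1)+\frac{(2+c)\kappa^{1/2}s_4^2}{\beta}+\frac{(2+3c)s_4^4}{2\beta^2\lambda}+\frac{\log(|\Lambda|/\epsilon)}{n\lambda},\quad \delta=\frac{\beta}{2n\lambda},$$ and, for $t\in\mathbb R_+$, $$B_{\lambda,\beta}(t)=\frac{\gamma+\lambda\delta/\max\{t,\sigma\}}{1-\mu-\gamma-2\lambda\delta/\max\{t,\sigma\}}\quad\text{if }\xi+\mu+\gamma+\frac{2\delta\lambda}{\max\{t,\sigma\}}<1,\qquad B_{\lambda,\beta}(t)=+\infty\text{ otherwise.}$$ For each $\theta\neq0$ let $(\widehat\lambda,\widehat\beta)\in\arg\min_{(\lambda,\beta)\in\Lambda}B_{\lambda,\beta}\big[\|\theta\|^{-2}\widetilde N_\lambda(\theta)\big]$ and define $\widehat N(\theta)=\widetilde N_{\widehat\lambda}(\theta)$. Conventions: $x/0=+\infty$ for $x>0$; an inequality with right-hand side $+\infty$ is void (considered true). "With probability at least $p$" means that the event contains a measurable event of probability at least $p$. *)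

theory Defs
  imports "HOL-Probability.Probability"
begin

section \<open>Moments of the law\<close>

definition quad_form :: "(real^'d) measure \<Rightarrow> real^'d \<Rightarrow> real" where
  "quad_form P \<theta> = (\<integral>x. (\<theta> \<bullet> x)^2 \<partial>P)"

definition gram :: "(real^'d) measure \<Rightarrow> real^'d^'d" where
  "gram P = (\<chi> i j. \<integral>x. x $ i * x $ j \<partial>P)"

definition s4 :: "(real^'d) measure \<Rightarrow> real" where
  "s4 P = root 4 (\<integral>x. norm x ^ 4 \<partial>P)"

text \<open>The supremum is taken in the extended reals, so that it is \<open>-\<infinity>\<close> over the empty set
  and \<open>\<infinity>\<close> if unbounded; the real number \<open>kappa P\<close> is \<open>0\<close> in both these cases.\<close>

definition kappa_ext :: "(real^'d) measure \<Rightarrow> ereal" where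
  "kappa_ext P =
     (SUP \<theta>\<in>{\<theta>. quad_form P \<theta> > 0}. ereal ((\<integral>x. (\<theta> \<bullet> x)^4 \<partial>P) / (\<integral>x. (\<theta> \<bullet> x)^2 \<partial>P)^2))"

definition kappa :: "(real^'d) measure \<Rightarrow> real" where
  "kappa P = real_of_ereal (kappa_ext P)"

section \<open>The estimator for a fixed parameter\<close>

definition psi_pos :: "real \<Rightarrow> real" where
  "psi_pos t = (if t \<le> 1 then - ln (1 - t + t^2 / 2) else ln 2)"

definition psi :: "real \<Rightarrow> real" where
  "psi t = (if 0 \<le> t then psi_pos t else - psi_pos (- t))"

text \<open>A sample is \<open>x :: nat \<Rightarrow> real^'d\<close>, of which only \<open>x 1, \<dots>, x n\<close> are used.\<close>

definition r_crit :: "nat \<Rightarrow> (nat \<Rightarrow> real^'d) \<Rightarrow> real \<Rightarrow> real^'d \<Rightarrow> real" where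
  "r_crit n x l \<theta> = (1 / real n) * (\<Sum>i=1..n. psi ((\<theta> \<bullet> x i)^2 - l))"

definition alpha_hat :: "nat \<Rightarrow> (nat \<Rightarrow> real^'d) \<Rightarrow> real \<Rightarrow> real^'d \<Rightarrow> ereal" where
  "alpha_hat n x l \<theta> = (SUP \<alpha>\<in>{\<alpha>. 0 \<le> \<alpha> \<and> r_crit n x l (\<alpha> *\<^sub>R \<theta>) \<le> 0}. ereal \<alpha>)"

definition N_tilde :: "nat \<Rightarrow> (nat \<Rightarrow> real^'d) \<Rightarrow> real \<Rightarrow> real^'d \<Rightarrow> real" where
  "N_tilde n x l \<theta> =
     (if alpha_hat n x l \<theta> = \<infinity> then 0 else l / (real_of_ereal (alpha_hat n x l \<theta>))^2)"

section \<open>The grid of parameters\<close>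

definition c_const :: real where
  "c_const = 15 / (8 * ln 2 * (sqrt 2 - 1)) * exp ((1 + 2 * sqrt 2) / 2)"

definition a_const :: real where
  "a_const = 1 / 2"

definition K_grid :: "(real^'d) measure \<Rightarrow> nat \<Rightarrow> int" where
  "K_grid P n = 1 + \<lceil>ln (real n / (72 * (2 + c_const) * sqrt (kappa P))) / a_const\<rceil>"

definition lambda_grid :: "(real^'d) measure \<Rightarrow> nat \<Rightarrow> real \<Rightarrow> nat \<Rightarrow> real" where
  "lambda_grid P n \<epsilon> j =
     sqrt (2 / (real n * (kappa P - 1)) *
       ((2 + 3 * c_const) / (4 * (2 + c_const) * sqrt (kappa P) * exp (- (real j * a_const)))
        + ln (real_of_int (K_grid P n) / \<epsilon>)))"

definition beta_grid :: "(real^'d) measure \<Rightarrow> nat \<Rightarrow> nat \<Rightarrow> real" where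
  "beta_grid P n j =
     sqrt (2 * (2 + c_const) * sqrt (kappa P) * s4 P ^ 4 * real n * exp (- ((real j - 1/2) * a_const)))"

definition Lambda_grid :: "(real^'d) measure \<Rightarrow> nat \<Rightarrow> real \<Rightarrow> (real \<times> real) set" where
  "Lambda_grid P n \<epsilon> = {(lambda_grid P n \<epsilon> j, beta_grid P n j) |j. int j < K_grid P n}"

section \<open>The bound used for selecting the parameter\<close>

definition xi_par :: "(real^'d) measure \<Rightarrow> real \<Rightarrow> real" where
  "xi_par P l = kappa P * l / 2"

definition mu_par :: "(real^'d) measure \<Rightarrow> real \<Rightarrow> real \<Rightarrow> real" where
  "mu_par P l b = l * (kappa P - 1) + (2 + c_const) * sqrt (kappa P) * (s4 P)^2 / b"

definition gamma_par :: "(real^'d) measure \<Rightarrow> nat \<Rightarrow> real \<Rightarrow> real \<Rightarrow> real \<Rightarrow> real" where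
  "gamma_par P n \<epsilon> l b =
     l / 2 * (kappa P - 1) + (2 + c_const) * sqrt (kappa P) * (s4 P)^2 / b
     + (2 + 3 * c_const) * s4 P ^ 4 / (2 * b^2 * l)
     + ln (real (card (Lambda_grid P n \<epsilon>)) / \<epsilon>) / (real n * l)"

definition delta_par :: "nat \<Rightarrow> real \<Rightarrow> real \<Rightarrow> real" where
  "delta_par n l b = b / (2 * real n * l)"

text \<open>By the convention \<open>x / 0 = \<infinity>\<close> for \<open>x > 0\<close>, the condition of the first case
  fails when \<open>max t \<sigma> = 0\<close>, whereas the real division of HOL would give \<open>x / 0 = 0\<close>:
  hence the conjunct \<open>0 < max t \<sigma>\<close>, here and in \<open>B_star\<close> below.\<close>

definition B_bound ::
  "(real^'d) measure \<Rightarrow> nat \<Rightarrow> real \<Rightarrow> real \<Rightarrow> real \<times> real \<Rightarrow> real \<Rightarrow> ereal" where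
  "B_bound P n \<epsilon> \<sigma> lb t =
     (let (l, b) = lb; m = max t \<sigma>; \<xi> = xi_par P l; \<mu> = mu_par P l b;
          \<gamma> = gamma_par P n \<epsilon> l b; \<delta> = delta_par n l b
      in if 0 < m \<and> \<xi> + \<mu> + \<gamma> + 2 * \<delta> * l / m < 1
         then ereal ((\<gamma> + l * \<delta> / m) / (1 - \<mu> - \<gamma> - 2 * l * \<delta> / m))
         else \<infinity>)"

text \<open>\<open>lb\<close> is a possible value of the selected parameter in direction \<open>\<theta>\<close>;
  minimizers need not be unique.\<close>

definition selectable :: "(real^'d) measure \<Rightarrow> nat \<Rightarrow> real \<Rightarrow> real \<Rightarrow> (nat \<Rightarrow> real^'d) \<Rightarrow> real^'d
    \<Rightarrow> real \<times> real \<Rightarrow> bool" where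
  "selectable P n \<epsilon> \<sigma> x \<theta> lb =
     is_arg_min (\<lambda>lb. B_bound P n \<epsilon> \<sigma> lb (N_tilde n x (fst lb) \<theta> / (norm \<theta>)^2))
       (\<lambda>lb. lb \<in> Lambda_grid P n \<epsilon>) lb"

section \<open>The final bound\<close>

definition zeta_star :: "(real^'d) measure \<Rightarrow> nat \<Rightarrow> real \<Rightarrow> real \<Rightarrow> real" where
  "zeta_star P n \<epsilon> t =
     sqrt (2.032 * (kappa P - 1) *
       (0.73 * trace (gram P) / t + ln (real_of_int (K_grid P n)) + ln (inverse \<epsilon>)))
     + sqrt (98.5 * kappa P * trace (gram P) / t)"

definition B_star :: "(real^'d) measure \<Rightarrow> nat \<Rightarrow> real \<Rightarrow> real \<Rightarrow> real \<Rightarrow> ereal" where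
  "B_star P n \<epsilon> \<sigma> t =
     (let m = max t \<sigma>; \<zeta> = zeta_star P n \<epsilon> m
      in if 0 < m \<and> (6 + inverse (kappa P - 1)) * \<zeta> \<le> sqrt (real n)
         then ereal ((\<zeta> / sqrt (real n)) / (1 - 4 * (\<zeta> / sqrt (real n))))
         else \<infinity>)"

end

theory Submission
  imports Defs
begin

text \<open>
  Why the result holds.  Write \<open>N(\<theta>)\<close> for \<open>quad_form P \<theta>\<close>.  If the criterion \<open>r_crit\<close> were its
  own expectation to first order, then \<open>r_crit n x l \<theta> / l\<close> would be \<open>u = N(\<theta>) / l - 1\<close>, and solving
  \<open>r_crit = 0\<close> along the ray of \<open>\<theta>\<close> would recover \<open>N(\<theta>)\<close> exactly.  The proof makes this quantitative,
  uniformly in \<open>\<theta>\<close>: on one event of probability at least \<open>1 - 2 \<epsilon>\<close> (\<open>r_linearized_event\<close>), for all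
  \<open>\<theta>\<close> and all grid parameters,
  \<open>\<bar>r_crit / l - u\<bar> \<le> \<xi> u\<^sup>2 + \<mu> u + \<gamma> + \<delta> \<parallel>\<theta>\<parallel>\<^sup>2\<close>.

  Uniformity in \<open>\<theta>\<close> comes from a PAC-Bayesian argument (\<open>pac_bayes\<close>): \<open>\<theta>\<close> is replaced by a Gaussian
  vector \<open>\<theta>'\<close> centred at \<open>\<theta>\<close> with covariance \<open>1/b\<close> times the identity, and the exponential moment of a
  sum over the sample is controlled once and for all under the centred Gaussian; moving the
  Gaussian to \<open>\<theta>\<close> costs the relative entropy \<open>b \<parallel>\<theta>\<parallel>\<^sup>2 / 2\<close>, which is where \<open>\<delta>\<close> comes from.

  For this to say something about \<open>\<theta>\<close> itself, the influence function at \<open>\<theta>\<close> must be dominated by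
  the Gaussian average of a logarithm whose argument has a computable expectation.  This is
  \<open>psi_le_expectation_ln_soft_arg\<close>, and it is the place where the constant \<open>c_const\<close> is needed.
  Averaging a function of \<open>t = \<langle>\<theta>', x\<rangle>\<^sup>2 - \<parallel>x\<parallel>\<^sup>2 / b - l\<close> loses at most a quarter of the variance
  of \<open>t\<close>, because \<open>\<psi>\<close> has a quadratic minorant with curvature \<open>1/4\<close> below \<open>min (ln (1 + t + t\<^sup>2/2)) (ln 4)\<close>
  (\<open>psi_quadratic_minorant\<close>).  Adding the nonnegative term \<open>D\<close> proportional to \<open>c_const\<close> inside
  the logarithm gains at least \<open>E ln (1 + D/4)\<close>.  As \<open>E D\<^sup>2 \<le> 2 (E D)\<^sup>2\<close>, this is at least a fixed
  multiple of \<open>E D\<close> until it reaches \<open>ln 4\<close> (\<open>expectation_ln_one_plus_ge\<close>), and \<open>c_const \<ge> 44\<close> makes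
  the gain exceed the loss.  A gain of \<open>ln 4\<close> always suffices since \<open>\<psi>\<close> takes values in \<open>[- ln 2, ln 2]\<close>.

  The rest is deterministic.  The locale \<open>criterion_inversion\<close> turns the linearized criterion into
  bounds for the zero of the criterion: the relative error of the estimate is at most the computable
  bound \<open>B_bound\<close> (\<open>relative_error_le\<close>), and if the theoretical quantities are small, \<open>B_bound\<close> evaluated
  at the estimate is at most \<open>z / (1 - 4 z)\<close> (\<open>bound_at_threshold_le\<close>).  Since the selected parameter
  minimizes \<open>B_bound\<close>, it only remains to exhibit one good grid parameter.  At the level \<open>\<tau>\<close> of the
  quadratic form, \<open>\<gamma> + \<delta> l / \<tau>\<close> is at most a sum of two terms of the form \<open>p x + q / x\<close>, one in \<open>x = l\<close> and
  one in \<open>x = b\<close>.  The grid is geometric, so it contains a point whose ratio to the optimum is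
  within a factor \<open>exp (1/8)\<close> for \<open>l\<close> and between \<open>1\<close> and \<open>exp (1/4)\<close> for \<open>b\<close>
  (\<open>grid_parameter_near_optimum\<close>), and the loss with respect to the optimum is a factor
  \<open>cosh (1/8)\<close> or \<open>cosh (1/4)\<close>.  These factors produce the constants \<open>2.032\<close> and \<open>98.5\<close> in
  \<open>zeta_star\<close> (\<open>grid_parameter_bounds\<close>).
\<close>

section \<open>The influence function\<close>

definition quad_log :: "real \<Rightarrow> real" where
  "quad_log t = ln (1 + t + t^2 / 2)"

lemma quad_arg_ge_half: "1 / 2 \<le> 1 + t + t^2 / (2::real)"
  using zero_le_power2[of "1 + t"] by (simp add: power2_eq_square field_simps)

lemma quad_arg_pos: "0 < 1 + t + t^2 / (2::real)"
  using quad_arg_ge_half[of t] by linarith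

lemma quad_log_ge: "- ln 2 \<le> quad_log t"
proof -
  have "ln (1/2) \<le> ln (1 + t + t^2 / 2)"
    using quad_arg_ge_half[of t] quad_arg_pos[of t] by (subst ln_le_cancel_iff) auto
  then show ?thesis by (simp add: quad_log_def ln_div)
qed

text \<open>With \<open>Y = 1 + t + t\<^sup>2/2\<close> the second derivative of \<open>ln Y\<close> is \<open>(1 - Y) / Y\<^sup>2 \<ge> - 1/4\<close>, so adding
  \<open>t\<^sup>2/8\<close> makes the function convex, hence above its tangents.\<close>

lemma quad_log_above_parabola:
  "quad_log a + (1 + a) / (1 + a + a^2/2) * (t - a) - (t - a)^2 / 8 \<le> quad_log t"
proof -
  let ?Y = "\<lambda>t::real. 1 + t + t^2 / 2"
  have d1: "((\<lambda>t. quad_log t + t^2 / 8) has_real_derivative ((1 + t) / ?Y t + t / 4)) (at t)" for t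
    unfolding quad_log_def using quad_arg_pos[of t]
    by (auto intro!: derivative_eq_intros simp: field_simps)
  have d2: "((\<lambda>t. (1 + t) / ?Y t + t / 4) has_real_derivative (?Y t - 2)^2 / (4 * (?Y t)^2)) (at t)" for t
  proof -
    have nz: "?Y t \<noteq> 0" using quad_arg_pos[of t] by simp
    have eq: "(?Y t - (1 + t) * (1 + t)) / (?Y t * ?Y t) + 1 / 4 = (?Y t - 2)^2 / (4 * (?Y t)^2)"
    proof -
      have sq: "(1 + t) * (1 + t) = 2 * ?Y t - 1" by (simp add: power2_eq_square algebra_simps)
      have "(y - (2 * y - 1)) / (y * y) + 1 / 4 = (y - 2)^2 / (4 * y^2)" if "y \<noteq> 0" for y :: real
        using that by (simp add: field_simps power2_eq_square)
      from this[OF nz] show ?thesis unfolding sq .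
    qed
    have "((\<lambda>t. (1 + t) / ?Y t + t / 4) has_real_derivative
       ((?Y t - (1 + t) * (1 + t)) / (?Y t * ?Y t) + 1 / 4)) (at t)"
      using nz by (auto intro!: derivative_eq_intros)
    then show ?thesis by (simp only: eq)
  qed
  have "((1 + a) / ?Y a + a / 4) * (t - a) \<le> (quad_log t + t^2 / 8) - (quad_log a + a^2 / 8)"
    by (rule f''_imp_f'[OF convex_UNIV d1 d2]) auto
  then have "(1 + a) / ?Y a * (t - a) + a / 4 * (t - a) \<le> quad_log t + t^2 / 8 - quad_log a - a^2 / 8"
    by (simp add: distrib_right)
  moreover have "a / 4 * (t - a) + a^2 / 8 - t^2 / 8 = - ((t - a)^2 / 8)"
    by (simp add: power2_eq_square field_simps)
  ultimately show ?thesis by linarith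
qed

lemma psi_minus: "psi (- t) = - psi t"
  by (auto simp: psi_def psi_pos_def)

lemma psi_pos_le_ln2: "psi_pos t \<le> ln 2"
proof -
  have "ln (1/2) \<le> ln (1 + (- t) + (- t)^2 / 2)"
    using quad_arg_ge_half[of "- t"] quad_arg_pos[of "-t"] by (subst ln_le_cancel_iff) auto
  then show ?thesis by (auto simp: psi_pos_def ln_div)
qed

lemma psi_pos_mono: "0 \<le> s \<Longrightarrow> s \<le> t \<Longrightarrow> psi_pos s \<le> psi_pos t"
proof (cases "t \<le> 1")
  case True
  assume st: "0 \<le> s" "s \<le> t"
  have "(1 - t)^2 \<le> (1 - s)^2" using st True by (intro power_mono) auto
  then have "1 - t + t^2 / 2 \<le> 1 - s + s^2 / 2" by (simp add: power2_eq_square algebra_simps)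
  then show ?thesis using st True quad_arg_pos[of "-t"] quad_arg_pos[of "-s"]
    by (simp add: psi_pos_def)
next
  case False
  then show ?thesis using psi_pos_le_ln2[of s] by (simp add: psi_pos_def)
qed

lemma psi_pos_nonneg: "0 \<le> t \<Longrightarrow> 0 \<le> psi_pos t"
  using psi_pos_mono[of 0 t] by (simp add: psi_pos_def)

lemma psi_mono: "s \<le> t \<Longrightarrow> psi s \<le> psi t"
  using psi_pos_mono[of s t] psi_pos_mono[of "-t" "-s"] psi_pos_nonneg[of t] psi_pos_nonneg[of "-s"]
  by (auto simp: psi_def)

lemma psi_le_ln2: "psi t \<le> ln 2"
  using psi_pos_le_ln2[of t] psi_pos_nonneg[of "-t"] by (auto simp: psi_def intro: order_trans[of _ 0])

lemma psi_neg: assumes "t < 0" shows "psi t < 0"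
proof (cases "t < -1")
  case True
  then show ?thesis using assms by (simp add: psi_def psi_pos_def)
next
  case False
  have "0 \<le> (- t) * (1 + t)" using False assms by (intro mult_nonneg_nonneg) auto
  then have "t^2 \<le> - t" by (simp add: power2_eq_square algebra_simps)
  then have "1 + t + t^2 / 2 < 1" using assms by simp
  then have "ln (1 + t + t^2/2) < 0" using quad_arg_pos[of t] by (simp add: ln_less_zero)
  then show ?thesis using False assms by (simp add: psi_def psi_pos_def)
qed

lemma continuous_psi: "continuous_on UNIV psi"
proof -
  have pos: "continuous_on UNIV psi_pos"
  proof -
    have "continuous_on ({..1} \<union> {1..}) (\<lambda>t::real. if t \<le> 1 then - ln (1 - t + t^2 / 2) else ln 2)"
    proof (rule continuous_on_If)
      show "continuous_on {..1} (\<lambda>t::real. - ln (1 - t + t^2 / 2))"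
        using quad_arg_pos[of "- t" for t]
        by (intro continuous_intros) (auto simp: less_imp_neq[symmetric] dest: sym)
    qed (auto simp: ln_div power2_eq_square)
    moreover have "{..1} \<union> {1..} = (UNIV::real set)" by auto
    ultimately show ?thesis by (simp add: psi_pos_def[abs_def])
  qed
  have "continuous_on ({0..} \<union> {..0}) (\<lambda>t. if 0 \<le> t then psi_pos t else - psi_pos (- t))"
  proof (rule continuous_on_If)
    show "continuous_on {..0} (\<lambda>t. - psi_pos (- t))"
      by (intro continuous_intros continuous_on_compose2[OF pos]) auto
  qed (use continuous_on_subset[OF pos] in \<open>auto simp: psi_pos_def\<close>)
  moreover have "{0..} \<union> {..0} = (UNIV::real set)" by auto
  ultimately show ?thesis by (simp add: psi_def[abs_def])
qed

text \<open>The maximum of a parabola with curvature \<open>1/4\<close>; it serves to keep the minorants of \<open>\<psi>\<close> below the cap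
  \<open>ln 4\<close>.\<close>

lemma slope_bound: "(s::real) * x - x^2 / 4 \<le> s^2"
  using zero_le_power2[of "s - x/2"] by (simp add: power2_eq_square algebra_simps)

lemma psi_neg_eq: "-1 \<le> t \<Longrightarrow> t \<le> 0 \<Longrightarrow> psi t = quad_log t"
  by (auto simp: psi_def psi_pos_def quad_log_def)

lemma ln_one_plus_quarter_ge: "0 \<le> y \<Longrightarrow> y \<le> 1 \<Longrightarrow> y / 8 \<le> ln (1 + y / (4::real))"
proof -
  assume y: "0 \<le> y" "y \<le> 1"
  have "y/4 - (y/4)^2 \<le> ln (1 + y/4)" using y by (intro ln_one_plus_pos_lower_bound) auto
  moreover have "y * y \<le> 1 * y" using y by (intro mult_right_mono) auto
  then have "y / 8 \<le> y/4 - (y/4)^2" using y by (simp add: power2_eq_square)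
  ultimately show ?thesis by linarith
qed

lemma ln_4: "ln (4::real) = 2 * ln 2"
  using ln_realpow[of "2::real" 2] by simp

text \<open>The gap comes from \<open>(1 - t + t\<^sup>2/2) (1 + t + t\<^sup>2/2) = 1 + t\<^sup>4/4\<close>.\<close>

lemma psi_le_quad_log_unit:
  assumes "0 \<le> t" "t \<le> 1"
  shows "psi t + t^4 / 8 \<le> quad_log t"
proof -
  have "(1 - t + t^2/2) * (1 + t + t^2/2) = 1 + t^4/4"
    by (simp add: field_simps power2_eq_square power4_eq_xxxx)
  then have "ln (1 - t + t^2/2) + ln (1 + t + t^2/2) = ln (1 + t^4/4)"
    using quad_arg_pos[of t] quad_arg_pos[of "-t"] by (simp flip: ln_mult_pos)
  moreover have "t^4 / 8 \<le> ln (1 + t^4/4)"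
    using assms by (intro ln_one_plus_quarter_ge) (auto simp: power_le_one)
  ultimately show ?thesis using assms by (simp add: psi_def psi_pos_def quad_log_def)
qed

lemma psi_le_self: "0 \<le> t \<Longrightarrow> psi t \<le> t"
proof (cases "t \<le> 1")
  assume t: "0 \<le> t"
  case True
  have "exp (- t) \<le> 1 - t + t^2 / 2"
  proof -
    have "1 + t + t^2/2 \<le> exp t" using exp_lower_Taylor_quadratic[of t] t by simp
    then have "exp (- t) \<le> 1 / (1 + t + t^2/2)" using quad_arg_pos[of t]
      by (simp add: exp_minus field_simps)
    also have "\<dots> \<le> 1 - t + t^2/2"
    proof -
      have "(1 - t + t^2/2) * (1 + t + t^2/2) = 1 + t^4/4"
        by (simp add: field_simps power2_eq_square power4_eq_xxxx)
      then show ?thesis using quad_arg_pos[of t] by (simp add: divide_le_eq)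
    qed
    finally show ?thesis .
  qed
  then have "- t \<le> ln (1 - t + t^2/2)" using quad_arg_pos[of "-t"] by (simp add: ln_ge_iff)
  then show ?thesis using True t by (simp add: psi_def psi_pos_def)
next
  case False
  then show ?thesis using ln_2_less_1 by (simp add: psi_def psi_pos_def)
qed

text \<open>Together with \<open>\<psi> \<le> ln 2\<close>, this is what the averaging argument uses of \<open>\<psi>\<close>.  The difficulty is the cap
  \<open>ln 4\<close>: a parabola of slope \<open>s\<close> and curvature \<open>1/4\<close> rises by \<open>s\<^sup>2\<close> above its value at \<open>a\<close>, so
  \<open>\<psi> a + s\<^sup>2\<close> must not exceed \<open>ln 4\<close>.  For \<open>a \<le> -1\<close> slope \<open>0\<close> will do, and for \<open>-1 \<le> a \<le> 0\<close> the
  slope of the tangent.  On \<open>[0, 1]\<close> the tangent of \<open>quad_log\<close> is nearly too steep, but there \<open>\<psi>\<close> lies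
  below \<open>quad_log\<close>, and this room, together with the excess of \<open>1/4\<close> over \<open>1/8\<close>, pays for
  lowering the slope by \<open>a\<^sup>2/4\<close>.  Beyond \<open>1\<close> the function \<open>\<psi>\<close> is constant and the parabola built at
  \<open>1\<close> is translated.\<close>

lemma psi_quadratic_minorant:
  "\<exists>s. \<forall>t. psi a + s * (t - a) - (t - a)^2 / 4 \<le> min (quad_log t) (ln 4)"
proof -
  consider "a \<le> -1" | "-1 \<le> a" "a \<le> 0" | "0 \<le> a" "a \<le> 1" | "1 \<le> a" by linarith
  then show ?thesis
  proof cases
    case 1
    then have "psi a \<le> - ln 2" using psi_mono[of a "-1"]
      by (simp add: psi_def psi_pos_def ln_div)
    have "psi a + 0 * (t - a) - (t - a)^2 / 4 \<le> min (quad_log t) (ln 4)" for t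
    proof -
      have "psi a + 0 * (t - a) - (t - a)^2 / 4 \<le> - ln 2"
        using \<open>psi a \<le> - ln 2\<close> zero_le_power2[of "t - a"] by linarith
      then show ?thesis using quad_log_ge[of t] ln2_ge_two_thirds ln_4 by linarith
    qed
    then show ?thesis by blast
  next
    case 2
    define s where "s = (1 + a) / (1 + a + a^2/2)"
    have s01: "0 \<le> s" "s \<le> 1" using 2 quad_arg_pos[of a] by (auto simp: s_def field_simps)
    have "psi a \<le> 0" using psi_mono[of a 0] 2 by (simp add: psi_def psi_pos_def)
    moreover have "s^2 \<le> 1" using s01 by (simp add: power_le_one)
    ultimately have "psi a + s * (t - a) - (t - a)^2 / 4 \<le> min (quad_log t) (ln 4)" for t
      using quad_log_above_parabola[of a t] slope_bound[of s "t - a"] psi_neg_eq[OF 2] ln2_ge_two_thirds ln_4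
      by (simp add: s_def[symmetric]) (use zero_le_power2[of "t - a"] in linarith)
    then show ?thesis by blast
  next
    case 3
    define s0 where "s0 = (1 + a) / (1 + a + a^2/2)"
    define s where "s = s0 - a^2 / 4"
    have a2: "0 \<le> a^2" "a^2 \<le> 1" using 3 by (auto simp: power_le_one)
    have Y: "1 + a + a^2/2 \<le> 5/2" using 3 a2 by linarith
    have s0: "s0 \<le> 1 - a^2/5"
    proof -
      have "s0 = 1 - (a^2/2) / (1 + a + a^2/2)" using quad_arg_pos[of a] by (simp add: s0_def field_simps)
      moreover have "(a^2/2) / (5/2) \<le> (a^2/2) / (1 + a + a^2/2)"
        using Y quad_arg_pos[of a] by (intro divide_left_mono) auto
      ultimately show ?thesis by simp
    qed
    have s_up: "s \<le> 1 - 9/20 * a^2" using s0 by (simp add: s_def)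
    have s_low: "0 \<le> s"
    proof -
      have "(1 + a) / (5/2) \<le> s0" unfolding s0_def using 3 Y quad_arg_pos[of a]
        by (intro divide_left_mono) auto
      moreover have "a^2 \<le> a" using 3 by (simp add: power2_eq_square mult_left_le_one_le)
      ultimately show ?thesis using 3 by (simp add: s_def)
    qed
    have s2: "s^2 \<le> (1 - 9/20 * a^2)^2" using s_up s_low by (intro power_mono) auto
    \<comment> \<open>Up to \<open>7/10\<close>, which is about \<open>ln 2\<close>, the bound \<open>\<psi> a \<le> a\<close> is the better one, afterwards \<open>\<psi> a \<le> ln 2\<close>.\<close>
    have cap: "psi a + s^2 \<le> ln 4"
    proof (cases "a \<le> 7/10")
      case True
      have "psi a \<le> a" using psi_le_self 3 by simp
      have "a^2 \<le> (7/10)^2" using True 3 by (intro power_mono) auto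
      then have "a^2 * a^2 \<le> (49/100) * a^2" using a2 by (intro mult_right_mono) (auto simp: power2_eq_square)
      moreover have "(1 - 9/20 * a^2)^2 = 1 - 9/10 * a^2 + 81/400 * (a^2 * a^2)"
        by (simp add: power2_eq_square algebra_simps)
      ultimately have "(1 - 9/20 * a^2)^2 \<le> 1 - 4/5 * a^2" using a2 by linarith
      moreover have "a - 4/5 * a^2 \<le> 5/16" 
        using zero_le_power2[of "a - 5/8"] by (simp add: power2_eq_square algebra_simps)
      ultimately show ?thesis using \<open>psi a \<le> a\<close> s2 ln2_ge_two_thirds ln_4 by linarith
    next
      case False
      have "(7/10)^2 \<le> a^2" using False by (intro power_mono) auto
      then have "(1 - 9/20 * a^2)^2 \<le> (1 - 9/20 * (49/100))^2" using a2
        by (intro power_mono) (auto simp: power2_eq_square)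
      also have "\<dots> \<le> 62/100" by (simp add: power2_eq_square)
      finally show ?thesis using psi_le_ln2[of a] s2 ln2_ge_two_thirds ln_4 by linarith
    qed
    have "psi a + s * (t - a) - (t - a)^2 / 4 \<le> min (quad_log t) (ln 4)" for t
    proof -
      have "0 \<le> ((t - a) + a^2)^2 / 8" by simp
      then have "- (a^2 / 4) * (t - a) \<le> (t - a)^2 / 8 + a^4 / 8"
        by (simp add: power2_eq_square power4_eq_xxxx field_simps)
      then have "psi a + s * (t - a) - (t - a)^2 / 4 \<le> quad_log t"
        using quad_log_above_parabola[of a t] psi_le_quad_log_unit[OF 3]
        unfolding s_def s0_def[symmetric] left_diff_distrib by linarith
      then show ?thesis using slope_bound[of s "t - a"] cap by simp
    qed
    then show ?thesis by blast
  next
    case 4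
    \<comment> \<open>The slope \<open>4/5\<close> is that of the tangent of \<open>quad_log\<close> at \<open>1\<close>.  The function \<open>g\<close> increases up to \<open>8/5\<close>, and
      \<open>13/5 = 1 + 8/5\<close> lies beyond the point where \<open>quad_log\<close> reaches the cap.\<close>
    define g where "g x = 4/5 * x - x^2 / 4" for x :: real
    have psia: "psi a = ln 2" using 4 by (auto simp: psi_def psi_pos_def ln_div)
    have ln25: "ln 2 \<le> quad_log 1" by (simp add: quad_log_def)
    have gle: "g x \<le> 16/25" for x
      using slope_bound[of "4/5" x] by (simp add: g_def power2_eq_square)
    have gmono: "g x \<le> g y" if "x \<le> y" "y \<le> 8/5" for x y
    proof -
      have "0 \<le> (y - x) * (4/5 - (x + y) / 4)" using that by (intro mult_nonneg_nonneg) auto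
      then show ?thesis by (simp add: g_def power2_eq_square field_simps)
    qed
    have "psi a + 4/5 * (t - a) - (t - a)^2 / 4 \<le> min (quad_log t) (ln 4)" for t
    proof -
      have cap: "ln 2 + g (t - a) \<le> ln 4" using gle[of "t - a"] ln2_ge_two_thirds ln_4 by simp
      have "ln 2 + g (t - a) \<le> quad_log t"
      proof (cases "t \<le> 13/5")
        case True
        have "g (t - a) \<le> g (t - 1)" using gmono[of "t - a" "t - 1"] 4 True by simp
        moreover have "ln 2 + g (t - 1) \<le> quad_log t"
        proof -
          have "quad_log 1 + 4/5 * (t - 1) - (t - 1)^2 / 8 \<le> quad_log t"
            using quad_log_above_parabola[of 1 t] by simp
          then show ?thesis using ln25 zero_le_power2[of "t - 1"] unfolding g_def by linarith
        qed
        ultimately show ?thesis by linarith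
      next
        case False
        have "ln 4 \<le> quad_log t"
        proof -
          have "(13/5)^2 \<le> t^2" using False by (intro power_mono) auto
          then have "4 \<le> 1 + t + t^2/2" using False by (simp add: power2_eq_square)
          then show ?thesis by (simp add: quad_log_def)
        qed
        then show ?thesis using cap by linarith
      qed
      then show ?thesis using cap psia by (simp add: g_def)
    qed
    then show ?thesis by blast
  qed
qed

section \<open>Numerical bounds on the constants\<close>

lemma ln_2_bounds: "69313 / 100000 \<le> ln (2::real)" "ln (2::real) \<le> 69316 / 100000"
proof -
  \<comment> \<open>Four terms of the series of \<open>2 artanh (1/3)\<close>.\<close>
  have "ln (2::real) \<in> {53056 / 76545.. 53056/76545 + 1 / 50000}"
    using ln_approx_bounds[of 2 4] by (simp add: eval_nat_numeral)
  then show "69313 / 100000 \<le> ln (2::real)" "ln (2::real) \<le> 69316 / 100000" by auto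
qed

lemma sqrt_2_bounds: "1414213 / 1000000 \<le> sqrt (2::real)" "sqrt (2::real) \<le> 1414214 / 1000000"
  by (rule real_le_rsqrt, simp add: power2_eq_square) (rule real_le_lsqrt, simp_all add: power2_eq_square)

lemma exp_upper_taylor:
  fixes x :: real
  assumes "0 \<le> x" "x \<le> 1/2"
  shows "exp x \<le> 1 + x + x^2/2 + x^3/6 + x^4/24 + x^5/120 + x^6/360"
proof -
  obtain t where t: "\<bar>t\<bar> \<le> \<bar>x\<bar>" "exp x = (\<Sum>m<6. x^m / fact m) + exp t / fact 6 * x^6"
    using Maclaurin_exp_le[of x 6] by blast
  have "exp t \<le> exp (1/2)" using t assms by simp
  also have "\<dots> \<le> 2" using exp_bound_half[of "1/2::real"] by simp
  finally have "exp t / fact 6 * x^6 \<le> 2 / fact 6 * x^6"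
    using assms by (intro mult_right_mono divide_right_mono) auto
  then show ?thesis using t(2) by (simp add: eval_nat_numeral fact_numeral)
qed

lemma exp_lower_taylor:
  fixes x :: real
  assumes "0 \<le> x" 
  shows "1 + x + x^2/2 + x^3/6 + x^4/24 + x^5/120 \<le> exp x"
proof -
  obtain t where t: "\<bar>t\<bar> \<le> \<bar>x\<bar>" "exp x = (\<Sum>m<6. x^m / fact m) + exp t / fact 6 * x^6"
    using Maclaurin_exp_le[of x 6] by blast
  have "0 \<le> exp t / fact 6 * x^6" using assms by auto
  then show ?thesis using t(2) by (simp add: eval_nat_numeral fact_numeral)
qed

text \<open>The value of the constant is about \<open>44.288\<close>.  The lower bound feeds the averaging lemma; the upper
  bound must be sharp to four digits, because \<open>98.5\<close> is almost the exact value of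
  \<open>(2 + c_const) (1 + cosh (1/2))\<close>.\<close>

lemma c_const_ge: "44 \<le> c_const"
proof -
  let ?x = "(1 + 2 * sqrt 2) / (2::real)"
  \<comment> \<open>The exponent, about \<open>1.91421\<close>, is divided by \<open>8\<close> to make the Taylor polynomial accurate.\<close>
  have "(6739/1000::real) \<le> (12699/10000) ^ 8" by (simp add: eval_nat_numeral)
  also have "\<dots> \<le> exp (23926 / 100000) ^ 8"
    using exp_lower_taylor[of "23926 / 100000"] by (intro power_mono) (auto simp: eval_nat_numeral)
  also have "\<dots> = exp (8 * (23926 / 100000))" by (subst exp_of_nat_mult[symmetric]) simp
  also have "\<dots> \<le> exp ?x" using sqrt_2_bounds by simp
  finally have e: "6739 / 1000 \<le> exp ?x" .
  have d: "8 * ln 2 * (sqrt 2 - 1) \<le> 8 * (69316/100000) * (1414214/1000000 - 1)"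
    using ln_2_bounds sqrt_2_bounds by (intro mult_mono) auto
  have pos: "0 < 8 * ln 2 * (sqrt 2 - 1)" using sqrt_2_bounds by simp
  have "44 * (8 * ln 2 * (sqrt 2 - 1)) \<le> 15 * exp ?x" using d e by simp
  then show ?thesis using pos by (simp add: c_const_def field_simps)
qed

lemma c_const_le: "c_const \<le> 44293 / 1000"
proof -
  let ?x = "(1 + 2 * sqrt 2) / (2::real)"
  have "exp ?x \<le> exp (8 * (2392768 / 10000000))" using sqrt_2_bounds by simp
  also have "\<dots> = exp (2392768 / 10000000) ^ 8" by (subst exp_of_nat_mult[symmetric]) simp
  also have "\<dots> \<le> (127034 / 100000) ^ 8"
    using exp_upper_taylor[of "2392768 / 10000000"] by (intro power_mono) (auto simp: eval_nat_numeral)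
  also have "\<dots> \<le> (67821/10000::real)" by (simp add: eval_nat_numeral)
  finally have e: "exp ?x \<le> 67821 / 10000" .
  have d: "8 * (69313/100000) * (1414213/1000000 - 1) \<le> 8 * ln 2 * (sqrt 2 - 1)"
    using ln_2_bounds sqrt_2_bounds by (intro mult_mono) auto
  have pos: "0 < 8 * ln 2 * (sqrt 2 - 1)" using sqrt_2_bounds by simp
  have "15 * exp ?x \<le> 44293 / 1000 * (8 * ln 2 * (sqrt 2 - 1))" using d e by simp
  then show ?thesis using pos by (simp add: c_const_def field_simps)
qed

section \<open>Averaging the influence function\<close>

text \<open>The parabola vanishes at \<open>0\<close> and has its maximum \<open>ln 16\<close> at \<open>30\<close>.  Up to \<open>15\<close> it lies below the chord of
  the concave function \<open>ln (1 + x)\<close> from \<open>0\<close> to \<open>15\<close>; afterwards it lies below \<open>ln 16\<close>.\<close>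

lemma ln_one_plus_ge_parabola:
  assumes "0 \<le> (x::real)"
  shows "ln 16 * (x / 15 - x^2 / 900) \<le> ln (1 + x)"
proof (cases "x \<le> 15")
  case True
  have "ln 16 * (x / 15 - x^2 / 900) \<le> (1 - x/15) * ln 1 + (x/15) * ln 16"
    by (simp add: algebra_simps)
  also have "\<dots> \<le> ln ((1 - x/15) *\<^sub>R 1 + (x/15) *\<^sub>R 16)"
    using assms True by (intro concave_onD[OF ln_concave]) auto
  also have "(1 - x/15) *\<^sub>R 1 + (x/15) *\<^sub>R 16 = 1 + x" by simp
  finally show ?thesis .
next
  case False
  have "x / 15 - x^2 / 900 \<le> 1"
    using zero_le_power2[of "x - 30"] by (simp add: power2_eq_square algebra_simps)
  then have "ln 16 * (x / 15 - x^2 / 900) \<le> ln 16" by (intro mult_left_le) auto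
  also have "\<dots> \<le> ln (1 + x)" using False by simp
  finally show ?thesis .
qed

lemma ln_16: "ln (16::real) = 4 * ln 2"
  using ln_realpow[of "2::real" 4] by simp

text \<open>A second moment argument: for a mean \<open>\<mu> \<le> 15\<close> integrate the parabola above.  For a larger mean,
  scale \<open>X\<close> down to mean \<open>15\<close> first, which only decreases \<open>ln (1 + X)\<close> and preserves the hypothesis on the
  second moment.\<close>

lemma (in prob_space) expectation_ln_one_plus_ge:
  fixes X :: "'a \<Rightarrow> real"
  assumes nonneg: "\<And>w. 0 \<le> X w"
    and int: "integrable M X" and int2: "integrable M (\<lambda>w. (X w)^2)"
    and second: "expectation (\<lambda>w. (X w)^2) \<le> 2 * (expectation X)^2"
  shows "min (expectation X * ln 16 / 30) (ln 4) \<le> expectation (\<lambda>w. ln (1 + X w))"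
    and "integrable M (\<lambda>w. ln (1 + X w))"
proof -
  have [measurable]: "X \<in> borel_measurable M" using int by auto
  show int_ln: "integrable M (\<lambda>w. ln (1 + X w))"
    using nonneg by (intro Bochner_Integration.integrable_bound[OF int])
      (auto intro!: ln_add_one_self_le_self simp: ln_ge_zero)
  define \<mu> where "\<mu> = expectation X"
  have \<mu>0: "0 \<le> \<mu>" unfolding \<mu>_def using nonneg by simp
  have scaled: "ln 16 * (\<rho> * \<mu> / 15) * (1 - \<rho> * \<mu> / 30) \<le> expectation (\<lambda>w. ln (1 + X w))"
    if \<rho>: "0 \<le> \<rho>" "\<rho> \<le> 1" for \<rho>
  proof -
    have "ln 16 * (\<rho> * \<mu> / 15) * (1 - \<rho> * \<mu> / 30)
        = ln 16 * (\<rho> * \<mu> / 15 - \<rho>^2 * (2 * \<mu>^2) / 900)"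
      by (simp add: power2_eq_square field_simps)
    also have "\<dots> \<le> ln 16 * (\<rho> * \<mu> / 15 - \<rho>^2 * expectation (\<lambda>w. (X w)^2) / 900)"
      using second by (intro mult_left_mono diff_left_mono divide_right_mono) (auto simp: \<mu>_def)
    also have "\<dots> = expectation (\<lambda>w. ln 16 * (\<rho> * X w / 15 - (\<rho> * X w)^2 / 900))"
      using int int2 by (simp add: \<mu>_def power_mult_distrib)
    also have "\<dots> \<le> expectation (\<lambda>w. ln (1 + X w))"
    proof (rule integral_mono)
      show "integrable M (\<lambda>w. ln 16 * (\<rho> * X w / 15 - (\<rho> * X w)^2 / 900))"
        using int int2 by (simp add: power_mult_distrib)
      fix w
      have "ln 16 * (\<rho> * X w / 15 - (\<rho> * X w)^2 / 900) \<le> ln (1 + \<rho> * X w)"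
        using \<rho> nonneg by (intro ln_one_plus_ge_parabola) auto
      also have "\<dots> \<le> ln (1 + X w)"
      proof -
        have "\<rho> * X w \<le> 1 * X w" using \<rho> nonneg by (intro mult_right_mono) auto
        moreover have "0 \<le> \<rho> * X w" using \<rho> nonneg by simp
        ultimately show ?thesis by simp
      qed
      finally show "ln 16 * (\<rho> * X w / 15 - (\<rho> * X w)^2 / 900) \<le> ln (1 + X w)" .
    qed (rule int_ln)
    finally show ?thesis .
  qed
  show "min (expectation X * ln 16 / 30) (ln 4) \<le> expectation (\<lambda>w. ln (1 + X w))"
  proof (cases "\<mu> \<le> 15")
    case True
    have "\<mu> * ln 16 / 30 = ln 16 * (\<mu> / 15) * (1/2)" by simp
    also have "\<dots> \<le> ln 16 * (\<mu> / 15) * (1 - \<mu> / 30)"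
      using True \<mu>0 by (intro mult_left_mono) auto
    finally show ?thesis using scaled[of 1] by (simp add: \<mu>_def)
  next
    case False
    then have "ln 4 \<le> expectation (\<lambda>w. ln (1 + X w))"
      using scaled[of "15 / \<mu>"] by (simp add: ln_16 ln_4)
    then show ?thesis by simp
  qed
qed

text \<open>Here \<open>z\<close> stands for \<open>\<langle>\<theta>', x\<rangle>\<close> with a random \<open>\<theta>'\<close>, \<open>v\<close> is the variance of \<open>z\<close>, and subtracting \<open>v\<close>
  makes \<open>z\<^sup>2 - v - l\<close> an unbiased version of \<open>\<langle>\<theta>, x\<rangle>\<^sup>2 - l\<close>.  The sign \<open>s\<close> treats upper and lower bounds
  for the criterion at once.\<close>

definition soft_arg :: "real \<Rightarrow> real \<Rightarrow> real \<Rightarrow> real \<Rightarrow> real" where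
  "soft_arg s l v z = 1 + s * (z^2 - v - l) + (z^2 - v - l)^2 / 2 + c_const * v * (z^2 + v / 2)"

lemma soft_arg_ge_half:
  assumes "s = 1 \<or> s = -1" "0 \<le> v"
  shows "1 / 2 \<le> soft_arg s l v z"
proof -
  have "0 \<le> c_const * v * (z^2 + v / 2)" using assms c_const_ge by (intro mult_nonneg_nonneg) auto
  moreover have "1 / 2 \<le> 1 + s * (z^2 - v - l) + (z^2 - v - l)^2 / 2"
    using quad_arg_ge_half[of "s * (z^2 - v - l)"] assms(1) by (auto simp: power_mult_distrib simp del: mult_minus1)
  ultimately show ?thesis unfolding soft_arg_def by linarith
qed

lemma abs_ln_le_plus_one: "1/2 \<le> y \<Longrightarrow> \<bar>ln y\<bar> \<le> y + (1::real)"
proof -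
  assume y: "1/2 \<le> y"
  have "ln y \<le> y - 1" using y by (intro ln_le_minus_one) auto
  moreover have "ln (1/2) \<le> ln y" using y by (subst ln_le_cancel_iff) auto
  ultimately show ?thesis using y ln_2_less_1 by (simp add: ln_div abs_if)
qed

text \<open>The hypotheses on the moments are those of a normal variable \<open>Z\<close> with mean \<open>m\<close> and variance \<open>v\<close>.
  The variance of \<open>Z\<^sup>2\<close> is \<open>4 m\<^sup>2 v + 2 v\<^sup>2\<close>, so the quadratic minorant of \<open>\<psi>\<close> loses \<open>m\<^sup>2 v + v\<^sup>2/2 \<le> S\<close>, where
  \<open>c_const * S\<close> is the mean of the correction \<open>D\<close>.  The gain from \<open>D\<close> is at least \<open>S\<close> or
  at least \<open>ln 4\<close>, and each is enough.\<close>

lemma (in prob_space) psi_le_expectation_ln_soft_arg: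
  fixes Z :: "'a \<Rightarrow> real"
  assumes s: "s = 1 \<or> s = -1" and v: "0 \<le> v"
    and Z: "Z \<in> borel_measurable M"
    and int2: "integrable M (\<lambda>w. (Z w)^2)" and int4: "integrable M (\<lambda>w. (Z w)^4)"
    and mom2: "expectation (\<lambda>w. (Z w)^2) = m^2 + v"
    and mom4: "expectation (\<lambda>w. (Z w)^4) = m^4 + 6 * m^2 * v + 3 * v^2"
  shows "integrable M (\<lambda>w. soft_arg s l v (Z w))"
    and "expectation (\<lambda>w. soft_arg s l v (Z w)) =
      1 + s * (m^2 - l) + (m^2 - l)^2 / 2 + (2 + c_const) * m^2 * v + (2 + 3 * c_const) / 2 * v^2"
    and "integrable M (\<lambda>w. ln (soft_arg s l v (Z w)))"
    and "psi (s * (m^2 - l)) \<le> expectation (\<lambda>w. ln (soft_arg s l v (Z w)))"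
proof -
  note [measurable] = Z
  have s2: "s * s = 1" using s by auto
  have quart: "(\<lambda>w. a + b * (Z w)^2 + d * (Z w)^4) \<in> borel_measurable M"
     "integrable M (\<lambda>w. a + b * (Z w)^2 + d * (Z w)^4)"
     "expectation (\<lambda>w. a + b * (Z w)^2 + d * (Z w)^4) = a + b * (m^2 + v) + d * (m^4 + 6 * m^2 * v + 3 * v^2)"
    for a b d using int2 int4 by (auto simp: mom2 mom4 prob_space)
  let ?t = "\<lambda>w. (Z w)^2 - v - l"
  let ?D = "\<lambda>w. c_const * v * ((Z w)^2 + v / 2)"
  have D0: "0 \<le> ?D w" for w using v c_const_ge by (intro mult_nonneg_nonneg) auto
  have arg_eq: "soft_arg s l v (Z w) = (1 - s * (v + l) + (v + l)^2 / 2 + c_const * v^2 / 2)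
      + (s - (v + l) + c_const * v) * (Z w)^2 + (1/2) * (Z w)^4" for w
    by (simp add: soft_arg_def power2_eq_square power4_eq_xxxx field_simps)
  show int_arg: "integrable M (\<lambda>w. soft_arg s l v (Z w))"
    unfolding arg_eq by (rule quart)
  show "expectation (\<lambda>w. soft_arg s l v (Z w)) =
      1 + s * (m^2 - l) + (m^2 - l)^2 / 2 + (2 + c_const) * m^2 * v + (2 + 3 * c_const) / 2 * v^2"
    unfolding arg_eq quart(3)
    by (simp add: power2_eq_square power4_eq_xxxx field_simps)
  have int_arg1: "integrable M (\<lambda>w. soft_arg s l v (Z w) + 1)" using int_arg by auto
  show int_ln: "integrable M (\<lambda>w. ln (soft_arg s l v (Z w)))"
  proof (rule Bochner_Integration.integrable_bound[OF int_arg1])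
    show "(\<lambda>w. ln (soft_arg s l v (Z w))) \<in> borel_measurable M"
      unfolding soft_arg_def by measurable
    show "AE w in M. norm (ln (soft_arg s l v (Z w))) \<le> norm (soft_arg s l v (Z w) + 1)"
      using abs_ln_le_plus_one[OF soft_arg_ge_half[OF s v]] soft_arg_ge_half[OF s v, of l]
      by (intro AE_I2) (smt (verit, best) real_norm_def)
  qed
  \<comment> \<open>Capping the first summand at \<open>4\<close> separates the two summands inside the logarithm.\<close>
  have split: "min (quad_log (s * ?t w)) (ln 4) + ln (1 + ?D w / 4) \<le> ln (soft_arg s l v (Z w))" for w
  proof -
    let ?Y = "1 + s * ?t w + (s * ?t w)^2 / 2"
    have Y: "0 < ?Y" by (rule quad_arg_pos)
    have arg: "soft_arg s l v (Z w) = ?Y + ?D w" using s by (auto simp: soft_arg_def power_mult_distrib simp del: mult_minus1)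
    have "min (quad_log (s * ?t w)) (ln 4) = ln (min ?Y 4)"
      using Y by (auto simp: quad_log_def min_def)
    also have "\<dots> + ln (1 + ?D w / 4) = ln (min ?Y 4 * (1 + ?D w / 4))"
      using Y D0[of w] by (intro ln_mult_pos[symmetric]) auto
    also have "\<dots> \<le> ln (?Y + ?D w)"
    proof -
      have "min ?Y 4 * (1 + ?D w / 4) = min ?Y 4 + min ?Y 4 * ?D w / 4" by (simp add: algebra_simps)
      also have "min ?Y 4 * ?D w \<le> 4 * ?D w" using D0 by (intro mult_right_mono) auto
      finally have "min ?Y 4 * (1 + ?D w / 4) \<le> ?Y + ?D w" by linarith
      moreover have "0 < min ?Y 4 * (1 + ?D w / 4)" using Y D0[of w] by (intro mult_pos_pos) auto
      ultimately show ?thesis by simp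
    qed
    finally show ?thesis by (simp add: arg)
  qed
  define S where "S = v * (m^2 + 3/2 * v)"
  define X where "X w = ?D w / 4" for w
  have X0: "0 \<le> X w" for w using D0 by (simp add: X_def)
  have X_eq: "X w = c_const * v^2 / 8 + (c_const * v / 4) * (Z w)^2 + 0 * (Z w)^4" for w
    by (simp add: X_def power2_eq_square field_simps)
  have intX: "integrable M X" and EX: "expectation X = c_const * S / 4"
    using quart(2)[of "c_const * v^2 / 8" "c_const * v / 4" 0] quart(3)[of "c_const * v^2 / 8" "c_const * v / 4" 0]
    unfolding X_eq[symmetric] by (auto simp: S_def power2_eq_square field_simps)
  let ?k = "(c_const * v / 4)^2"
  have X2_eq: "(X w)^2 = ?k * (v^2 / 4) + (?k * v) * (Z w)^2 + ?k * (Z w)^4" for w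
    by (simp add: X_def power2_eq_square power4_eq_xxxx field_simps)
  have intX2: "integrable M (\<lambda>w. (X w)^2)"
    and EX2: "expectation (\<lambda>w. (X w)^2) = ?k * (m^4 + 7 * m^2 * v + 17/4 * v^2)"
    unfolding X2_eq quart(3) by (rule quart(2)) (simp add: power2_eq_square field_simps)
  \<comment> \<open>The difference of the two sides is proportional to \<open>(m\<^sup>2 - v/2)\<^sup>2\<close>.\<close>
  have "expectation (\<lambda>w. (X w)^2) \<le> 2 * (expectation X)^2"
  proof -
    have "m^4 + 7 * m^2 * v + 17/4 * v^2 \<le> 2 * (m^2 + 3/2 * v)^2"
      using zero_le_power2[of "m^2 - v/2"] by (simp add: power2_eq_square power4_eq_xxxx field_simps)
    then have "?k * (m^4 + 7 * m^2 * v + 17/4 * v^2) \<le> ?k * (2 * (m^2 + 3/2 * v)^2)"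
      by (intro mult_left_mono) auto
    also have "\<dots> = 2 * (expectation X)^2" unfolding EX S_def by (simp add: power2_eq_square)
    finally show ?thesis unfolding EX2 .
  qed
  from expectation_ln_one_plus_ge[OF X0 intX intX2 this]
  have lnX: "min (c_const * S / 4 * ln 16 / 30) (ln 4) \<le> expectation (\<lambda>w. ln (1 + X w))"
    and int_lnX: "integrable M (\<lambda>w. ln (1 + X w))" by (auto simp: EX)
  have S0: "0 \<le> S" using v by (auto simp: S_def)
  have gain: "min S (ln 4) \<le> expectation (\<lambda>w. ln (1 + X w))"
  proof -
    have "30 \<le> c_const * ln 2"
      using mult_mono[of 44 c_const "69313/100000" "ln 2"] c_const_ge ln_2_bounds by simp
    then have "30 * S \<le> c_const * ln 2 * S" using S0 by (rule mult_right_mono)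
    then have "S \<le> c_const * S / 4 * ln 16 / 30" by (simp add: ln_16 mult_ac)
    then show ?thesis using lnX by linarith
  qed
  show "psi (s * (m^2 - l)) \<le> expectation (\<lambda>w. ln (soft_arg s l v (Z w)))"
  proof (cases "S \<le> ln 4")
    case True
    have SlnX: "S \<le> expectation (\<lambda>w. ln (1 + X w))" using True gain by linarith
    obtain r where r: "\<And>t. psi (s * (m^2 - l)) + r * (t - s * (m^2 - l)) - (t - s * (m^2 - l))^2 / 4
        \<le> min (quad_log t) (ln 4)"
      using psi_quadratic_minorant[of "s * (m^2 - l)"] by blast
    let ?p = "psi (s * (m^2 - l))"
    let ?q = "m^2 + v"
    define g where "g w = ?p + r * s * ((Z w)^2 - ?q) - ((Z w)^2 - ?q)^2 / 4" for w
    have g_le: "g w \<le> min (quad_log (s * ?t w)) (ln 4)" for w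
    proof -
      have "s * ?t w - s * (m^2 - l) = s * ((Z w)^2 - ?q)" by (simp add: algebra_simps)
      then show ?thesis using r[of "s * ?t w"] s2 by (simp add: g_def power_mult_distrib power2_eq_square[of s])
    qed
    have g_eq: "g w = (?p - r * s * ?q - ?q^2 / 4) + (r * s + ?q / 2) * (Z w)^2 + (- 1 / 4) * (Z w)^4" for w
      by (simp add: g_def power2_eq_square power4_eq_xxxx field_simps)
    have int_g: "integrable M g" unfolding g_eq[abs_def] by (rule quart)
    have "expectation g = ?p - (m^2 * v + v^2 / 2)"
      unfolding g_eq[abs_def] quart(3) by (simp add: power2_eq_square power4_eq_xxxx field_simps)
    moreover have "m^2 * v + v^2 / 2 \<le> S" unfolding S_def using v by (simp add: power2_eq_square field_simps)
    ultimately have "?p \<le> expectation g + expectation (\<lambda>w. ln (1 + X w))" using SlnX by linarith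
    also have "\<dots> = expectation (\<lambda>w. g w + ln (1 + X w))" using int_g int_lnX by simp
    also have "\<dots> \<le> expectation (\<lambda>w. ln (soft_arg s l v (Z w)))"
    proof (rule integral_mono)
      fix w
      show "g w + ln (1 + X w) \<le> ln (soft_arg s l v (Z w))"
        using g_le[of w] split[of w] unfolding X_def by linarith
    qed (use int_g int_lnX int_ln in auto)
    finally show ?thesis .
  next
    case False
    have "ln 4 \<le> expectation (\<lambda>w. ln (1 + X w))" using False gain by linarith
    then have "psi (s * (m^2 - l)) \<le> - ln 2 + expectation (\<lambda>w. ln (1 + X w))"
      using psi_le_ln2[of "s * (m^2 - l)"] ln_4 by linarith
    also have "\<dots> = expectation (\<lambda>w. - ln 2 + ln (1 + X w))" using int_lnX by (simp add: prob_space)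
    also have "\<dots> \<le> expectation (\<lambda>w. ln (soft_arg s l v (Z w)))"
    proof (rule integral_mono)
      fix w
      have "- ln 2 \<le> min (quad_log (s * ?t w)) (ln 4)"
        using quad_log_ge[of "s * ?t w"] ln_2_bounds ln_4 by simp
      then show "- ln 2 + ln (1 + X w) \<le> ln (soft_arg s l v (Z w))"
        using split[of w] unfolding X_def by linarith
    qed (use int_lnX int_ln in auto)
    finally show ?thesis .
  qed
qed

section \<open>Gaussian perturbations\<close>

text \<open>The normal law on \<open>\<real>\<^sup>d\<close> with mean \<open>\<theta>\<close> and covariance \<open>1/b\<close> times the identity, carried by the functions on
  the index type so that it is a product measure.\<close>

definition gauss :: "real^'d \<Rightarrow> real \<Rightarrow> ('d \<Rightarrow> real) measure" where
  "gauss \<theta> b = PiM UNIV (\<lambda>i. density lborel (normal_density (\<theta> $ i) (1 / sqrt b)))"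

definition lin :: "real^'d \<Rightarrow> ('d \<Rightarrow> real) \<Rightarrow> real" where
  "lin x w = (\<Sum>i\<in>UNIV. w i * x $ i)"

lemma sets_gauss [measurable_cong]: "sets (gauss \<theta> b) = sets (PiM UNIV (\<lambda>_. borel))"
  unfolding gauss_def by (rule sets_PiM_cong) auto

lemma space_gauss [simp]: "space (gauss \<theta> b) = UNIV"
  using sets_eq_imp_space_eq[OF sets_gauss[of \<theta> b]] by (simp add: space_PiM)

lemma prob_space_gauss: "0 < b \<Longrightarrow> prob_space (gauss \<theta> b)"
  unfolding gauss_def by (intro prob_space_PiM prob_space_normal_density) auto

lemma measurable_lin [measurable]: "lin x \<in> borel_measurable (gauss \<theta> b)"
  unfolding lin_def[abs_def] by measurable

lemma measurable_lin_pair [measurable]: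
  "(\<lambda>p. lin (snd p) (fst p)) \<in> borel_measurable (PiM UNIV (\<lambda>_. borel) \<Otimes>\<^sub>M borel)"
proof -
  have [measurable]: "(\<lambda>x::real^'d. x $ i) \<in> borel_measurable borel" for i
    by (intro borel_measurable_continuous_onI continuous_intros)
  show ?thesis unfolding lin_def by measurable
qed

lemma distr_gauss_component:
  assumes "0 < b"
  shows "distr (gauss \<theta> b) borel (\<lambda>w. w i) = density lborel (normal_density (\<theta> $ i) (1 / sqrt b))"
proof -
  let ?N = "\<lambda>i. density lborel (normal_density (\<theta> $ i) (1 / sqrt b))"
  have "distr (gauss \<theta> b) borel (\<lambda>w. w i) = distr (gauss \<theta> b) (?N i) (\<lambda>w. w i)"
    by (rule distr_cong) auto
  also have "\<dots> = ?N i"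
    unfolding gauss_def using assms by (intro distr_PiM_component prob_space_normal_density) auto
  finally show ?thesis .
qed

lemma indep_gauss_components:
  assumes "0 < b"
  shows "prob_space.indep_vars (gauss \<theta> b) (\<lambda>_. borel) (\<lambda>i w. w i) UNIV"
proof -
  interpret prob_space "gauss \<theta> b" by (rule prob_space_gauss[OF assms])
  have "distr (gauss \<theta> b) (PiM UNIV (\<lambda>_. borel)) (\<lambda>w. \<lambda>i\<in>UNIV. w i) = gauss \<theta> b"
    unfolding restrict_UNIV by (rule distr_id2) (rule sets_gauss[symmetric])
  also have "\<dots> = PiM UNIV (\<lambda>i. distr (gauss \<theta> b) borel (\<lambda>w. w i))"
    unfolding distr_gauss_component[OF assms] by (rule gauss_def)
  finally show ?thesis by (subst indep_vars_iff_distr_eq_PiM) auto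
qed

lemma distributed_gauss_lin:
  assumes b: "0 < b" and x: "x \<noteq> 0"
  shows "distributed (gauss \<theta> b) lborel (lin x) (normal_density (\<theta> \<bullet> x) (norm x / sqrt b))"
proof -
  interpret prob_space "gauss \<theta> b" by (rule prob_space_gauss[OF b])
  let ?I = "{i. x $ i \<noteq> 0}"
  have comp: "distributed (gauss \<theta> b) lborel (\<lambda>w. w i) (normal_density (\<theta> $ i) (1 / sqrt b))" for i
    unfolding distributed_def
  proof (intro conjI)
    have "distr (gauss \<theta> b) lborel (\<lambda>w. w i) = distr (gauss \<theta> b) borel (\<lambda>w. w i)"
      by (rule distr_cong) auto
    then show "distr (gauss \<theta> b) lborel (\<lambda>w. w i) = density lborel (normal_density (\<theta> $ i) (1 / sqrt b))"
      by (simp add: distr_gauss_component[OF b])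
  qed auto
  have scaled: "distributed (gauss \<theta> b) lborel (\<lambda>w. w i * x $ i)
      (normal_density (\<theta> $ i * x $ i) (\<bar>x $ i\<bar> * (1 / sqrt b)))" if "i \<in> ?I" for i
    using normal_density_affine[OF comp[of i], of "x $ i" 0] that b by (simp add: mult.commute)
  have "distributed (gauss \<theta> b) lborel (\<lambda>w. \<Sum>i\<in>?I. w i * x $ i)
     (normal_density (\<Sum>i\<in>?I. \<theta> $ i * x $ i) (sqrt (\<Sum>i\<in>?I. (\<bar>x $ i\<bar> * (1 / sqrt b))\<^sup>2)))"
  proof (rule sum_indep_normal)
    show "?I \<noteq> {}" using x by (auto simp: vec_eq_iff)
    have "indep_vars (\<lambda>_. borel) (\<lambda>i w. w i) ?I"
      by (rule indep_vars_subset[OF indep_gauss_components[OF b]]) auto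
    then show "indep_vars (\<lambda>i. borel) (\<lambda>i w. w i * x $ i) ?I"
      by (rule indep_vars_compose2[where Y = "\<lambda>i y. y * x $ i"]) auto
  qed (use scaled b in auto)
  moreover have "(\<lambda>w. \<Sum>i\<in>?I. w i * x $ i) = lin x"
    unfolding lin_def by (intro ext sum.mono_neutral_left) auto
  moreover have "(\<Sum>i\<in>?I. \<theta> $ i * x $ i) = \<theta> \<bullet> x"
    unfolding inner_vec_def inner_real_def by (intro sum.mono_neutral_left) auto
  moreover have "sqrt (\<Sum>i\<in>?I. (\<bar>x $ i\<bar> * (1 / sqrt b))\<^sup>2) = norm x / sqrt b"
  proof -
    have "(\<Sum>i\<in>?I. (\<bar>x $ i\<bar> * (1 / sqrt b))\<^sup>2) = (\<Sum>i\<in>UNIV. (\<bar>x $ i\<bar> * (1 / sqrt b))\<^sup>2)"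
      by (intro sum.mono_neutral_left) auto
    also have "\<dots> = (norm x)^2 / b"
      using b by (simp add: norm_eq_sqrt_inner inner_vec_def power_mult_distrib power_divide
         sum_divide_distrib power2_eq_square sum_nonneg)
    finally show ?thesis by (simp add: real_sqrt_divide)
  qed
  ultimately show ?thesis by simp
qed

lemma gauss_lin_moments:
  assumes b: "0 < b"
  defines "v \<equiv> \<lambda>x. (norm x)^2 / b"
  shows "integrable (gauss \<theta> b) (lin x)" "(\<integral>w. lin x w \<partial>gauss \<theta> b) = \<theta> \<bullet> x"
    and "integrable (gauss \<theta> b) (\<lambda>w. (lin x w)^2)"
      "(\<integral>w. (lin x w)^2 \<partial>gauss \<theta> b) = (\<theta> \<bullet> x)^2 + v x"
    and "integrable (gauss \<theta> b) (\<lambda>w. (lin x w)^4)"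
      "(\<integral>w. (lin x w)^4 \<partial>gauss \<theta> b) = (\<theta> \<bullet> x)^4 + 6 * (\<theta> \<bullet> x)^2 * v x + 3 * (v x)^2"
proof -
  interpret prob_space "gauss \<theta> b" by (rule prob_space_gauss[OF b])
  let ?m = "\<theta> \<bullet> x"
  let ?Z = "\<lambda>w. lin x w - ?m"
  have central: "integrable (gauss \<theta> b) (\<lambda>w. ?Z w ^ k)" 
      "expectation (\<lambda>w. ?Z w ^ 1) = 0" "expectation (\<lambda>w. ?Z w ^ 2) = v x"
      "expectation (\<lambda>w. ?Z w ^ 3) = 0" "expectation (\<lambda>w. ?Z w ^ 4) = 3 * (v x)^2" for k
  proof -
    show "integrable (gauss \<theta> b) (\<lambda>w. ?Z w ^ k)" 
    proof (cases "x = 0")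
      case False
      have s: "0 < norm x / sqrt b" using b False by simp
      note D = distributed_gauss_lin[OF b False, of \<theta>]
      show ?thesis
        using distributed_integrable[OF D, of "\<lambda>y. (y - ?m)^k"] integrable_normal_moment[OF s, of ?m k]
        by simp
    qed (simp add: lin_def)
    have "expectation (\<lambda>w. ?Z w ^ 1) = 0 \<and> expectation (\<lambda>w. ?Z w ^ 2) = v x \<and>
      expectation (\<lambda>w. ?Z w ^ 3) = 0 \<and> expectation (\<lambda>w. ?Z w ^ 4) = 3 * (v x)^2"
    proof (cases "x = 0")
      case True
      then show ?thesis by (simp add: lin_def v_def)
    next
      case False
      define r where "r = norm x / sqrt b"
      have r: "0 < r" using b False by (simp add: r_def)
      have v: "v x = r^2" using b by (simp add: v_def r_def power_divide)
      have E: "expectation (\<lambda>w. ?Z w ^ k) = (\<integral>y. normal_density ?m r y * (y - ?m)^k \<partial>lborel)" for k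
        using distributed_integral[OF distributed_gauss_lin[OF b False, of \<theta>], of "\<lambda>y. (y - ?m)^k"]
        by (simp add: r_def)
      have "expectation (\<lambda>w. ?Z w ^ 1) = 0"
        unfolding E using integral_normal_moment_odd[OF r, of ?m 0] by simp
      moreover have "expectation (\<lambda>w. ?Z w ^ 3) = 0"
        unfolding E using integral_normal_moment_odd[OF r, of ?m 1] by simp
      moreover have "expectation (\<lambda>w. ?Z w ^ 2) = v x"
        unfolding E v using integral_normal_moment_even[OF r, of ?m 1] by simp
      moreover have "expectation (\<lambda>w. ?Z w ^ 4) = 3 * (v x)^2"
        unfolding E v using integral_normal_moment_even[OF r, of ?m 2] r
        by (simp add: fact_numeral power_divide field_simps)
      ultimately show ?thesis by blast
    qed
    then show "expectation (\<lambda>w. ?Z w ^ 1) = 0" "expectation (\<lambda>w. ?Z w ^ 2) = v x"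
      "expectation (\<lambda>w. ?Z w ^ 3) = 0" "expectation (\<lambda>w. ?Z w ^ 4) = 3 * (v x)^2" by blast+
  qed
  have comb: "integrable (gauss \<theta> b) (\<lambda>w. a0 + a1 * ?Z w ^ 1 + a2 * ?Z w ^ 2 + a3 * ?Z w ^ 3 + a4 * ?Z w ^ 4)"
    "expectation (\<lambda>w. a0 + a1 * ?Z w ^ 1 + a2 * ?Z w ^ 2 + a3 * ?Z w ^ 3 + a4 * ?Z w ^ 4)
      = a0 + a2 * v x + a4 * (3 * (v x)^2)" for a0 a1 a2 a3 a4
  proof -
    note i = central(1)[of 1] central(1)[of 2] central(1)[of 3] central(1)[of 4]
    show "integrable (gauss \<theta> b) (\<lambda>w. a0 + a1 * ?Z w ^ 1 + a2 * ?Z w ^ 2 + a3 * ?Z w ^ 3 + a4 * ?Z w ^ 4)"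
      using i by (intro Bochner_Integration.integrable_add integrable_mult_right) auto
    have "expectation (\<lambda>w. a0 + a1 * ?Z w ^ 1 + a2 * ?Z w ^ 2 + a3 * ?Z w ^ 3 + a4 * ?Z w ^ 4)
      = a0 + a1 * expectation (\<lambda>w. ?Z w ^ 1) + a2 * expectation (\<lambda>w. ?Z w ^ 2)
        + a3 * expectation (\<lambda>w. ?Z w ^ 3) + a4 * expectation (\<lambda>w. ?Z w ^ 4)"
      using i by (simp add: prob_space[unfolded space_gauss] del: power_one_right)
    then show "expectation (\<lambda>w. a0 + a1 * ?Z w ^ 1 + a2 * ?Z w ^ 2 + a3 * ?Z w ^ 3 + a4 * ?Z w ^ 4)
      = a0 + a2 * v x + a4 * (3 * (v x)^2)" using central(2-5) by simp
  qed
  have e1: "lin x w = ?m + 1 * ?Z w ^ 1 + 0 * ?Z w ^ 2 + 0 * ?Z w ^ 3 + 0 * ?Z w ^ 4" for w by simp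
  have e2: "(lin x w)^2 = ?m^2 + (2 * ?m) * ?Z w ^ 1 + 1 * ?Z w ^ 2 + 0 * ?Z w ^ 3 + 0 * ?Z w ^ 4" for w
    by (simp add: power2_eq_square algebra_simps)
  have e4: "(lin x w)^4 = ?m^4 + (4 * ?m^3) * ?Z w ^ 1 + (6 * ?m^2) * ?Z w ^ 2 + (4 * ?m) * ?Z w ^ 3 + 1 * ?Z w ^ 4" for w
    by (simp add: eval_nat_numeral algebra_simps)
  show "integrable (gauss \<theta> b) (lin x)" "(\<integral>w. lin x w \<partial>gauss \<theta> b) = \<theta> \<bullet> x"
    using comb[of ?m 1 0 0 0] unfolding e1[symmetric] by auto
  show "integrable (gauss \<theta> b) (\<lambda>w. (lin x w)^2)"
      "(\<integral>w. (lin x w)^2 \<partial>gauss \<theta> b) = (\<theta> \<bullet> x)^2 + v x"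
    using comb[of "?m^2" "2 * ?m" 1 0 0] unfolding e2[symmetric] by auto
  show "integrable (gauss \<theta> b) (\<lambda>w. (lin x w)^4)"
      "(\<integral>w. (lin x w)^4 \<partial>gauss \<theta> b) = (\<theta> \<bullet> x)^4 + 6 * (\<theta> \<bullet> x)^2 * v x + 3 * (v x)^2"
    using comb[of "?m^4" "4 * ?m^3" "6 * ?m^2" "4 * ?m" 1] unfolding e4[symmetric] by auto
qed

text \<open>The density of a translated Gaussian.  It suffices to compare the two measures on boxes, where both factor
  over the coordinates.\<close>

lemma gauss_eq_density:
  fixes \<theta> :: "real^'d"
  assumes b: "0 < b"
  shows "gauss \<theta> b = density (gauss 0 b) (\<lambda>w. ennreal (exp (b * lin \<theta> w - b * (norm \<theta>)^2 / 2)))"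
proof -
  let ?N = "\<lambda>(\<theta>::real^'d) i. density lborel (normal_density (\<theta> $ i) (1 / sqrt b))"
  let ?r = "\<lambda>i y. ennreal (exp (b * (y * \<theta> $ i) - b * (\<theta> $ i)^2 / 2))"
  interpret N0: product_sigma_finite "?N 0"
    using b by (intro product_sigma_finite.intro prob_space_imp_sigma_finite prob_space_normal_density) auto
  interpret N1: product_sigma_finite "?N \<theta>"
    using b by (intro product_sigma_finite.intro prob_space_imp_sigma_finite prob_space_normal_density) auto
  have "density (gauss 0 b) (\<lambda>w. ennreal (exp (b * lin \<theta> w - b * (norm \<theta>)^2 / 2))) = PiM UNIV (?N \<theta>)"
  proof (rule N1.PiM_eqI)
    show "sets (density (gauss 0 b) (\<lambda>w. ennreal (exp (b * lin \<theta> w - b * (norm \<theta>)^2 / 2)))) = sets (PiM UNIV (?N \<theta>))"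
      using sets_gauss[of 0 b] sets_gauss[of \<theta> b] by (simp add: gauss_def)
    fix A :: "'d \<Rightarrow> real set" assume A: "\<And>i. i \<in> UNIV \<Longrightarrow> A i \<in> sets (?N \<theta> i)"
    then have A'[measurable]: "A i \<in> sets borel" for i by simp
    have PA: "Pi\<^sub>E UNIV A \<in> sets (gauss 0 b)"
      unfolding sets_gauss by (rule sets_PiM_I_finite) auto
    have prod: "ennreal (exp (b * lin \<theta> w - b * (norm \<theta>)^2 / 2)) * indicator (Pi\<^sub>E UNIV A) w
        = (\<Prod>i\<in>UNIV. ?r i (w i) * indicator (A i) (w i))" for w
    proof -
      have "b * lin \<theta> w - b * (norm \<theta>)^2 / 2 = (\<Sum>i\<in>UNIV. b * (w i * \<theta> $ i) - b * (\<theta> $ i)^2 / 2)"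
      proof -
        have "(norm \<theta>)^2 = (\<Sum>i\<in>UNIV. (\<theta> $ i)^2)"
          unfolding power2_norm_eq_inner inner_vec_def by (simp add: power2_eq_square)
        then show ?thesis
          by (simp add: lin_def sum_subtractf sum_distrib_left sum_divide_distrib)
      qed
      moreover have "indicator (Pi\<^sub>E UNIV A) w = (\<Prod>i\<in>UNIV. indicator (A i) (w i) :: ennreal)"
        by (auto simp: indicator_def PiE_iff prod_eq_1_iff intro!: prod_zero)
      ultimately show ?thesis by (simp add: exp_sum prod_ennreal[symmetric] prod.distrib)
    qed
    have one: "(\<integral>\<^sup>+y. ?r i y * indicator (A i) y \<partial>?N 0 i) = emeasure (?N \<theta> i) (A i)" for i
    proof -
      have dens: "normal_density 0 (1 / sqrt b) y * exp (b * (y * \<theta> $ i) - b * (\<theta> $ i)^2 / 2)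
          = normal_density (\<theta> $ i) (1 / sqrt b) y" for y
        using b by (simp add: normal_density_def power_divide exp_add[symmetric] power2_eq_square field_simps)
      have "(\<integral>\<^sup>+y. ?r i y * indicator (A i) y \<partial>?N 0 i)
          = (\<integral>\<^sup>+y. ennreal (normal_density 0 (1 / sqrt b) y) * (?r i y * indicator (A i) y) \<partial>lborel)"
        by (subst nn_integral_density) auto
      also have "\<dots> = (\<integral>\<^sup>+y. ennreal (normal_density (\<theta> $ i) (1 / sqrt b) y) * indicator (A i) y \<partial>lborel)"
        unfolding dens[symmetric] by (simp add: ennreal_mult mult.assoc)
      also have "\<dots> = emeasure (?N \<theta> i) (A i)" by (subst emeasure_density) auto
      finally show ?thesis .
    qed
    have "emeasure (density (gauss 0 b) (\<lambda>w. ennreal (exp (b * lin \<theta> w - b * (norm \<theta>)^2 / 2)))) (Pi\<^sub>E UNIV A)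
        = (\<integral>\<^sup>+w. (\<Prod>i\<in>UNIV. ?r i (w i) * indicator (A i) (w i)) \<partial>gauss 0 b)"
      using PA by (subst emeasure_density) (auto simp: prod)
    also have "\<dots> = (\<Prod>i\<in>UNIV. \<integral>\<^sup>+y. ?r i y * indicator (A i) y \<partial>?N 0 i)"
      unfolding gauss_def by (rule N0.product_nn_integral_prod) auto
    also have "\<dots> = (\<Prod>i\<in>UNIV. emeasure (?N \<theta> i) (A i))" by (simp only: one)
    finally show "emeasure (density (gauss 0 b) (\<lambda>w. ennreal (exp (b * lin \<theta> w - b * (norm \<theta>)^2 / 2)))) (Pi\<^sub>E UNIV A)
        = (\<Prod>i\<in>UNIV. emeasure (?N \<theta> i) (A i))" .
  qed simp
  then show ?thesis by (simp add: gauss_def)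
qed

text \<open>Jensen's inequality for \<open>exp\<close>, with the integrability of \<open>exp g\<close> deduced from the bound.\<close>

lemma (in prob_space) exp_expectation_le:
  fixes g :: "'a \<Rightarrow> real"
  assumes int: "integrable M g" and bound: "(\<integral>\<^sup>+w. ennreal (exp (g w)) \<partial>M) \<le> ennreal C"
  shows "exp (expectation g) \<le> C"
proof -
  have [measurable]: "g \<in> borel_measurable M" using int by auto
  have fin: "(\<integral>\<^sup>+w. ennreal (exp (g w)) \<partial>M) < \<infinity>" using bound le_less_trans by fastforce
  have inte: "integrable M (\<lambda>w. exp (g w))"
    using fin by (intro integrableI_nonneg) auto
  let ?a = "expectation g"
  have "exp ?a = expectation (\<lambda>w. exp ?a * (1 + (g w - ?a)))"
    using int by (simp add: prob_space)
  also have "\<dots> \<le> expectation (\<lambda>w. exp (g w))"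
  proof (rule integral_mono)
    fix w
    have "exp ?a * (1 + (g w - ?a)) \<le> exp ?a * exp (g w - ?a)"
      using exp_ge_add_one_self[of "g w - ?a"] by (intro mult_left_mono) auto
    then show "exp ?a * (1 + (g w - ?a)) \<le> exp (g w)" by (simp flip: exp_add)
  qed (use int inte in auto)
  finally have "exp ?a \<le> expectation (\<lambda>w. exp (g w))" .
  moreover have "ennreal (expectation (\<lambda>w. exp (g w))) \<le> ennreal C"
    using bound by (subst nn_integral_eq_integral[symmetric]) (use inte in auto)
  ultimately have "ennreal (exp ?a) \<le> ennreal C" by (meson ennreal_leI order_trans)
  then show ?thesis by (simp add: ennreal_le_iff2)
qed

text \<open>The Gaussian case of the Donsker-Varadhan inequality: \<open>b \<parallel>\<theta>\<parallel>\<^sup>2 / 2\<close> is the relative entropy of the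
  translated law with respect to the centred one.  The exponential moment is taken under the
  centred law for every \<open>\<theta>\<close>, which is what makes the estimates uniform in \<open>\<theta>\<close>.\<close>

lemma gauss_integral_le_log_exp_moment:
  assumes b: "0 < b" and h: "integrable (gauss \<theta> b) h"
    and bound: "(\<integral>\<^sup>+w. ennreal (exp (h w)) \<partial>gauss 0 b) \<le> ennreal C"
  shows "(\<integral>w. h w \<partial>gauss \<theta> b) \<le> b * (norm \<theta>)^2 / 2 + ln C"
proof -
  interpret prob_space "gauss \<theta> b" by (rule prob_space_gauss[OF b])
  let ?l = "\<lambda>w. b * lin \<theta> w - b * (norm \<theta>)^2 / 2"
  have hm: "h \<in> borel_measurable (gauss \<theta> b)" using h by auto
  have [measurable]: "h \<in> borel_measurable (gauss 0 b)" 
    using hm measurable_cong_sets[OF sets_gauss[of \<theta> b] refl] measurable_cong_sets[OF sets_gauss[of 0 b] refl] by blast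
  have "(\<integral>\<^sup>+w. ennreal (exp (h w - ?l w)) \<partial>gauss \<theta> b)
      = (\<integral>\<^sup>+w. ennreal (exp (?l w)) * ennreal (exp (h w - ?l w)) \<partial>gauss 0 b)"
    by (subst gauss_eq_density[OF b], subst nn_integral_density) auto
  also have "\<dots> = (\<integral>\<^sup>+w. ennreal (exp (h w)) \<partial>gauss 0 b)"
    by (intro nn_integral_cong) (simp flip: ennreal_mult exp_add)
  finally have "(\<integral>\<^sup>+w. ennreal (exp (h w - ?l w)) \<partial>gauss \<theta> b) \<le> ennreal C" using bound by simp
  moreover have int_l: "integrable (gauss \<theta> b) ?l" using gauss_lin_moments(1)[OF b, of \<theta> \<theta>]
    by (intro Bochner_Integration.integrable_diff integrable_mult_right) auto
  ultimately have "exp (expectation (\<lambda>w. h w - ?l w)) \<le> C"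
    using h by (intro exp_expectation_le) auto
  moreover have "expectation (\<lambda>w. h w - ?l w) = expectation h - b * (norm \<theta>)^2 / 2"
    using h int_l gauss_lin_moments(1,2)[OF b, of \<theta> \<theta>]
    by (simp add: prob_space[unfolded space_gauss] power2_norm_eq_inner)
  ultimately have e: "exp (expectation h - b * (norm \<theta>)^2 / 2) \<le> C" by simp
  then have "0 < C" using exp_gt_zero less_le_trans by blast
  then show ?thesis using e by (simp add: ln_ge_iff[symmetric])
qed

section \<open>The PAC-Bayesian inequality\<close>

locale heavy_tailed_law = prob_space P for P :: "(real^'d) measure" +
  assumes sets_law [measurable_cong]: "sets P = sets borel"
    and integrable_norm_pow4: "integrable P (\<lambda>x. norm x ^ 4)"
begin

lemma integrable_of_le_norm_pow4:
  fixes f :: "real^'d \<Rightarrow> real"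
  assumes f: "f \<in> borel_measurable borel" and bound: "\<And>x. \<bar>f x\<bar> \<le> a + c * norm x ^ 4"
  shows "integrable P f"
proof (rule Bochner_Integration.integrable_bound)
  show "integrable P (\<lambda>x. a + c * norm x ^ 4)" using integrable_norm_pow4 by auto
  show "f \<in> borel_measurable P" using f measurable_cong_sets[OF sets_law refl] by blast
  show "AE x in P. norm (f x) \<le> norm (a + c * norm x ^ 4)"
    using bound by (intro AE_I2) (smt (verit) real_norm_def)
qed

lemma sq_le_one_plus_pow4: "(y::real)^2 \<le> 1 + y^4"
  using zero_le_power2[of "y^2 - 1/2"] by (simp add: power2_eq_square power4_eq_xxxx algebra_simps)

lemma integrable_norm_sq: "integrable P (\<lambda>x. (norm x)^2)"
  by (rule integrable_of_le_norm_pow4[of _ 1 1]) (auto intro: sq_le_one_plus_pow4)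

lemma inner_sq_le: "(\<theta> \<bullet> x)^2 \<le> (norm \<theta>)^2 * (norm (x::real^'d))^2"
  using Cauchy_Schwarz_ineq[of \<theta> x] by (simp add: power2_norm_eq_inner)

lemma integrable_inner_sq: "integrable P (\<lambda>x. (\<theta> \<bullet> x)^2)"
proof (rule integrable_of_le_norm_pow4)
  fix x
  have "\<bar>(\<theta> \<bullet> x)^2\<bar> \<le> (norm \<theta>)^2 * (norm x)^2" using inner_sq_le by simp
  also have "\<dots> \<le> (norm \<theta>)^2 * (1 + norm x ^ 4)" by (intro mult_left_mono sq_le_one_plus_pow4) auto
  finally show "\<bar>(\<theta> \<bullet> x)^2\<bar> \<le> (norm \<theta>)^2 + (norm \<theta>)^2 * norm x ^ 4" by (simp add: algebra_simps)
qed auto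

lemma integrable_inner_sq_norm_sq: "integrable P (\<lambda>x. (\<theta> \<bullet> x)^2 * (norm x)^2)"
proof (rule integrable_of_le_norm_pow4)
  fix x
  have "\<bar>(\<theta> \<bullet> x)^2 * (norm x)^2\<bar> \<le> ((norm \<theta>)^2 * (norm x)^2) * (norm x)^2"
    using inner_sq_le by (simp add: mult_right_mono)
  then show "\<bar>(\<theta> \<bullet> x)^2 * (norm x)^2\<bar> \<le> 0 + (norm \<theta>)^2 * norm x ^ 4"
    by (simp add: power2_eq_square power4_eq_xxxx mult_ac)
qed auto

lemma integrable_inner_pow4: "integrable P (\<lambda>x. (\<theta> \<bullet> x)^4)"
proof (rule integrable_of_le_norm_pow4)
  fix x
  have "((\<theta> \<bullet> x)^2)^2 \<le> ((norm \<theta>)^2 * (norm x)^2)^2" using inner_sq_le by (intro power_mono) auto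
  then show "\<bar>(\<theta> \<bullet> x)^4\<bar> \<le> 0 + norm \<theta> ^ 4 * norm x ^ 4"
    by (simp add: power_mult_distrib flip: power_mult)
qed auto

abbreviation arg :: "real \<Rightarrow> real \<Rightarrow> real \<Rightarrow> real^'d \<Rightarrow> ('d \<Rightarrow> real) \<Rightarrow> real" where
  "arg s l b x w \<equiv> soft_arg s l ((norm x)^2 / b) (lin x w)"

text \<open>The Gaussian mean of \<open>arg\<close>, see \<open>arg_gauss\<close> below.\<close>

definition arg_mean :: "real \<Rightarrow> real \<Rightarrow> real \<Rightarrow> real^'d \<Rightarrow> real^'d \<Rightarrow> real" where
  "arg_mean s l b \<theta> x = 1 + s * ((\<theta> \<bullet> x)^2 - l) + ((\<theta> \<bullet> x)^2 - l)^2 / 2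
     + (2 + c_const) * (\<theta> \<bullet> x)^2 * ((norm x)^2 / b) + (2 + 3 * c_const) / 2 * ((norm x)^2 / b)^2"

lemma lin_eq_inner: "lin x w = (\<chi> i. w i) \<bullet> x"
  by (simp add: lin_def inner_vec_def)

lemma integrable_arg: "integrable P (\<lambda>x. arg s l b x w)"
proof -
  let ?t = "(\<chi> i. w i) :: real^'d"
  have "arg s l b x w = (1 - s * l + l^2 / 2) + (s - l) * (?t \<bullet> x)^2 + (l - s) / b * (norm x)^2
      + 1/2 * (?t \<bullet> x)^4 + (c_const - 1) / b * ((?t \<bullet> x)^2 * (norm x)^2)
      + (1 + c_const) / (2 * b^2) * norm x ^ 4" for x
    unfolding soft_arg_def lin_eq_inner
    by (cases "b = 0") (simp_all add: power2_eq_square power4_eq_xxxx field_simps)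
  then show ?thesis
    using integrable_inner_sq integrable_norm_sq integrable_inner_pow4 integrable_inner_sq_norm_sq integrable_norm_pow4
    by simp
qed

lemma integrable_arg_mean: "integrable P (arg_mean s l b \<theta>)"
proof -
  have "arg_mean s l b \<theta> x = (1 - s * l + l^2 / 2) + (s - l) * (\<theta> \<bullet> x)^2
      + 1/2 * (\<theta> \<bullet> x)^4 + (2 + c_const) / b * ((\<theta> \<bullet> x)^2 * (norm x)^2)
      + (2 + 3 * c_const) / (2 * b^2) * norm x ^ 4" for x
    unfolding arg_mean_def
    by (cases "b = 0") (simp_all add: power2_eq_square power4_eq_xxxx field_simps)
  then have "arg_mean s l b \<theta> = (\<lambda>x. (1 - s * l + l^2 / 2) + (s - l) * (\<theta> \<bullet> x)^2
      + 1/2 * (\<theta> \<bullet> x)^4 + (2 + c_const) / b * ((\<theta> \<bullet> x)^2 * (norm x)^2)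
      + (2 + 3 * c_const) / (2 * b^2) * norm x ^ 4)" by blast
  then show ?thesis
    using integrable_inner_sq integrable_norm_sq integrable_inner_pow4 integrable_inner_sq_norm_sq integrable_norm_pow4
    by simp
qed

lemma arg_gauss:
  assumes s: "s = 1 \<or> s = -1" and b: "0 < b"
  shows "integrable (gauss \<theta> b) (arg s l b x)"
    and "(\<integral>w. arg s l b x w \<partial>gauss \<theta> b) = arg_mean s l b \<theta> x"
    and "integrable (gauss \<theta> b) (\<lambda>w. ln (arg s l b x w))"
    and "psi (s * ((\<theta> \<bullet> x)^2 - l)) \<le> (\<integral>w. ln (arg s l b x w) \<partial>gauss \<theta> b)"
proof -
  interpret G: prob_space "gauss \<theta> b" by (rule prob_space_gauss[OF b])
  have v: "0 \<le> (norm x)^2 / b" using b by simp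
  note * = G.psi_le_expectation_ln_soft_arg[OF s v measurable_lin gauss_lin_moments(3,5)[OF b] gauss_lin_moments(4,6)[OF b]]
  show "integrable (gauss \<theta> b) (arg s l b x)"
    "(\<integral>w. arg s l b x w \<partial>gauss \<theta> b) = arg_mean s l b \<theta> x"
    "integrable (gauss \<theta> b) (\<lambda>w. ln (arg s l b x w))"
    "psi (s * ((\<theta> \<bullet> x)^2 - l)) \<le> (\<integral>w. ln (arg s l b x w) \<partial>gauss \<theta> b)"
    using * by (auto simp: arg_mean_def)
qed

lemma arg_ge_half: "s = 1 \<or> s = -1 \<Longrightarrow> 0 < b \<Longrightarrow> 1/2 \<le> arg s l b x w"
  by (rule soft_arg_ge_half) auto

lemma measurable_arg_pair [measurable]:
  "(\<lambda>p. arg s l b (snd p) (fst p)) \<in> borel_measurable (PiM UNIV (\<lambda>_. borel) \<Otimes>\<^sub>M borel)"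
  unfolding soft_arg_def by measurable

lemma arg_fubini:
  assumes s: "s = 1 \<or> s = -1" and b: "0 < b"
  shows "integrable (gauss \<theta> b) (\<lambda>w. \<integral>x. arg s l b x w \<partial>P)"
    and "(\<integral>w. (\<integral>x. arg s l b x w \<partial>P) \<partial>gauss \<theta> b) = (\<integral>x. arg_mean s l b \<theta> x \<partial>P)"
proof -
  interpret G: prob_space "gauss \<theta> b" by (rule prob_space_gauss[OF b])
  interpret pair_sigma_finite P "gauss \<theta> b" ..
  have abs_arg: "norm (arg s l b x w) = arg s l b x w" for x w
    using arg_ge_half[OF s b, of l x w] by simp
  have joint: "integrable (P \<Otimes>\<^sub>M gauss \<theta> b) (\<lambda>(x, w). arg s l b x w)"
  proof (rule Fubini_integrable)
    have "(\<lambda>p. (snd p, fst p)) \<in> measurable (P \<Otimes>\<^sub>M gauss \<theta> b) (PiM UNIV (\<lambda>_. borel) \<Otimes>\<^sub>M borel)"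
      by measurable
    from measurable_compose[OF this measurable_arg_pair]
    show "(\<lambda>(x, w). arg s l b x w) \<in> borel_measurable (P \<Otimes>\<^sub>M gauss \<theta> b)"
      by (simp add: split_beta')
    show "integrable P (\<lambda>x. \<integral>w. norm (case (x, w) of (x, w) \<Rightarrow> arg s l b x w) \<partial>gauss \<theta> b)"
      unfolding prod.case abs_arg arg_gauss(2)[OF s b] by (rule integrable_arg_mean)
    show "AE x in P. integrable (gauss \<theta> b) (\<lambda>w. case (x, w) of (x, w) \<Rightarrow> arg s l b x w)"
      using arg_gauss(1)[OF s b] by simp
  qed
  from integrable_snd[OF joint] show "integrable (gauss \<theta> b) (\<lambda>w. \<integral>x. arg s l b x w \<partial>P)" .
  from Fubini_integral[OF joint]
  show "(\<integral>w. (\<integral>x. arg s l b x w \<partial>P) \<partial>gauss \<theta> b) = (\<integral>x. arg_mean s l b \<theta> x \<partial>P)"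
    by (simp add: arg_gauss(2)[OF s b])
qed

end

locale iid_sample = heavy_tailed_law P for P :: "(real^'d) measure" +
  fixes M :: "'w measure" and X :: "nat \<Rightarrow> 'w \<Rightarrow> real^'d" and n :: nat
  assumes prob_M: "prob_space M" and n_pos: "1 \<le> n"
    and indep: "prob_space.indep_vars M (\<lambda>_. borel) X {1..n}"
    and law: "\<And>i. i \<in> {1..n} \<Longrightarrow> distr M borel (X i) = P"
begin

sublocale M: prob_space M by (rule prob_M)

lemma measurable_sample: "i \<in> {1..n} \<Longrightarrow> X i \<in> borel_measurable M"
  using indep unfolding M.indep_vars_def by auto

text \<open>For each fixed \<open>w\<close>, independence bounds the exponential moment of
  \<open>h = (\<Sum>i. ln (arg (X i) w)) - n (q w - 1)\<close> by \<open>(q w)\<^sup>n exp (- n (q w - 1)) \<le> 1\<close>.  Integrating over \<open>w\<close> under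
  the centred Gaussian and applying Markov's inequality gives an event that does not depend on \<open>\<theta>\<close>; on it
  the entropy inequality applies to all \<open>\<theta>\<close> simultaneously.\<close>

lemma pac_bayes:
  assumes s: "s = 1 \<or> s = -1" and b: "0 < b" and p: "0 < p"
  shows "\<exists>A\<in>sets M. 1 - p \<le> measure M A \<and> (\<forall>\<omega>\<in>A. \<forall>\<theta>.
    (\<Sum>i=1..n. psi (s * ((\<theta> \<bullet> X i \<omega>)^2 - l)))
      \<le> real n * ((\<integral>x. arg_mean s l b \<theta> x \<partial>P) - 1) + b * (norm \<theta>)^2 / 2 + ln (1 / p))"
proof -
  let ?G = "gauss (0::real^'d) b"
  interpret G: prob_space ?G by (rule prob_space_gauss[OF b])
  define q where "q w = (\<integral>x. arg s l b x w \<partial>P)" for w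
  define h where "h \<omega> w = (\<Sum>i=1..n. ln (arg s l b (X i \<omega>) w)) - real n * (q w - 1)" for \<omega> w
  have arg_pos: "0 < arg s l b x w" for x w using arg_ge_half[OF s b, of l x w] by linarith
  have q0: "0 \<le> q w" for w unfolding q_def using arg_pos less_imp_le by (intro integral_nonneg_AE AE_I2) blast
  have q_meas [measurable]: "q \<in> borel_measurable (PiM UNIV (\<lambda>_. borel))"
  proof -
    have "(\<lambda>w. \<integral>x. arg s l b x w \<partial>P) \<in> borel_measurable (gauss 0 b)"
      using arg_fubini(1)[OF s b] by (rule borel_measurable_integrable)
    then show ?thesis unfolding q_def[abs_def] using measurable_cong_sets[OF sets_gauss refl] by blast
  qed
  note measurable_sample[measurable]
  have arg_meas [measurable]:
    "(\<lambda>p. arg s l b (X i (fst p)) (snd p)) \<in> borel_measurable (M \<Otimes>\<^sub>M PiM UNIV (\<lambda>_. borel))"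
    if "i \<in> {1..n}" for i
  proof -
    have [measurable]: "X i \<in> borel_measurable M" using that by (rule measurable_sample)
    have "(\<lambda>p. (snd p, X i (fst p))) \<in> measurable (M \<Otimes>\<^sub>M PiM UNIV (\<lambda>_. borel)) (PiM UNIV (\<lambda>_. borel) \<Otimes>\<^sub>M borel)"
      by measurable
    from measurable_compose[OF this measurable_arg_pair] show ?thesis by simp
  qed
  have h_meas: "(\<lambda>p. h (fst p) (snd p)) \<in> borel_measurable (M \<Otimes>\<^sub>M PiM UNIV (\<lambda>_. borel))"
    unfolding h_def by (intro borel_measurable_diff borel_measurable_sum borel_measurable_times
      borel_measurable_const borel_measurable_ln arg_meas) (auto intro!: measurable_compose[OF measurable_snd q_meas])
  have hG_meas [measurable]: "(\<lambda>(\<omega>, w). ennreal (exp (h \<omega> w))) \<in> borel_measurable (M \<Otimes>\<^sub>M ?G)"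
  proof -
    have "(\<lambda>p. ennreal (exp (h (fst p) (snd p)))) \<in> borel_measurable (M \<Otimes>\<^sub>M PiM UNIV (\<lambda>_. borel))"
      using h_meas by measurable
    moreover have "sets (M \<Otimes>\<^sub>M ?G) = sets (M \<Otimes>\<^sub>M PiM UNIV (\<lambda>_. borel))"
      by (intro sets_pair_measure_cong sets_gauss refl)
    ultimately show ?thesis unfolding split_beta' using measurable_cong_sets by blast
  qed
  define W where "W \<omega> = (\<integral>\<^sup>+w. ennreal (exp (h \<omega> w)) \<partial>?G)" for \<omega>
  have W_meas [measurable]: "W \<in> borel_measurable M"
    unfolding W_def[abs_def] using G.borel_measurable_nn_integral[OF hG_meas] by simp
  have exp_h: "ennreal (exp (h \<omega> w)) =
      (\<Prod>i=1..n. ennreal (arg s l b (X i \<omega>) w)) * ennreal (exp (- real n * (q w - 1)))" for \<omega> w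
  proof -
    have "exp (h \<omega> w) = (\<Prod>i=1..n. arg s l b (X i \<omega>) w) * exp (- real n * (q w - 1))"
      unfolding h_def diff_conv_add_uminus exp_add using arg_pos by (simp add: exp_sum)
    then show ?thesis using arg_pos less_imp_le by (subst prod_ennreal) (auto simp: ennreal_mult'' prod_nonneg)
  qed
  have sample_moment: "(\<integral>\<^sup>+\<omega>. ennreal (exp (h \<omega> w)) \<partial>M) \<le> 1" for w
  proof -
    have arg_w [measurable]: "(\<lambda>x. arg s l b x w) \<in> borel_measurable borel"
      using measurable_compose[OF measurable_Pair1'[of w "PiM UNIV (\<lambda>_. borel)"] measurable_arg_pair, of s l b]
      by (simp add: space_PiM)
    have "(\<integral>\<^sup>+\<omega>. ennreal (exp (h \<omega> w)) \<partial>M)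
       = (\<integral>\<^sup>+\<omega>. (\<Prod>i=1..n. ennreal (arg s l b (X i \<omega>) w)) \<partial>M) * ennreal (exp (- real n * (q w - 1)))"
      unfolding exp_h by (rule nn_integral_multc) measurable
    also have "(\<integral>\<^sup>+\<omega>. (\<Prod>i=1..n. ennreal (arg s l b (X i \<omega>) w)) \<partial>M)
       = (\<Prod>i=1..n. \<integral>\<^sup>+\<omega>. ennreal (arg s l b (X i \<omega>) w) \<partial>M)"
      by (intro M.indep_vars_nn_integral M.indep_vars_compose2[OF indep]) auto
    also have "\<dots> = (\<Prod>i=1..n. ennreal (q w))"
    proof (rule prod.cong)
      fix i assume i: "i \<in> {1..n}"
      then have [measurable]: "X i \<in> borel_measurable M" by (rule measurable_sample)
      have "(\<integral>\<^sup>+\<omega>. ennreal (arg s l b (X i \<omega>) w) \<partial>M) = (\<integral>\<^sup>+x. ennreal (arg s l b x w) \<partial>distr M borel (X i))"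
        by (subst nn_integral_distr) auto
      also have "\<dots> = ennreal (q w)"
        unfolding law[OF i] q_def using integrable_arg arg_pos less_imp_le
        by (intro nn_integral_eq_integral AE_I2) blast+
      finally show "(\<integral>\<^sup>+\<omega>. ennreal (arg s l b (X i \<omega>) w) \<partial>M) = ennreal (q w)" .
    qed simp
    also have "\<dots> * ennreal (exp (- real n * (q w - 1))) = ennreal (q w ^ n * exp (- real n * (q w - 1)))"
      using q0[of w] by (simp add: ennreal_power ennreal_mult)
    also have "\<dots> \<le> ennreal 1"
    proof (rule ennreal_leI)
      have "q w \<le> exp (q w - 1)" using exp_ge_add_one_self[of "q w - 1"] by simp
      then have "q w ^ n \<le> exp (q w - 1) ^ n" using q0 by (intro power_mono) auto
      also have "\<dots> = exp (real n * (q w - 1))" by (simp add: exp_of_nat_mult)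
      finally have "q w ^ n * exp (- real n * (q w - 1)) \<le> exp (real n * (q w - 1)) * exp (- real n * (q w - 1))"
        by (intro mult_right_mono) auto
      also have "\<dots> = 1" by (simp flip: exp_add)
      finally show "q w ^ n * exp (- real n * (q w - 1)) \<le> 1" .
    qed
    finally show ?thesis by simp
  qed
  interpret MG: pair_sigma_finite M ?G ..
  have "(\<integral>\<^sup>+\<omega>. W \<omega> \<partial>M) = (\<integral>\<^sup>+w. (\<integral>\<^sup>+\<omega>. ennreal (exp (h \<omega> w)) \<partial>M) \<partial>?G)"
    unfolding W_def using MG.Fubini'[OF hG_meas] by simp
  also have "\<dots> \<le> (\<integral>\<^sup>+w. 1 \<partial>?G)" by (intro nn_integral_mono sample_moment)
  also have "\<dots> = 1" using G.emeasure_space_1 by simp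
  finally have EW: "(\<integral>\<^sup>+\<omega>. W \<omega> \<partial>M) \<le> 1" .
  define B where "B = {\<omega>\<in>space M. 1 \<le> ennreal p * W \<omega>}"
  have B[measurable]: "B \<in> sets M" unfolding B_def by measurable
  have "emeasure M B \<le> ennreal p * (\<integral>\<^sup>+\<omega>. W \<omega> * indicator (space M) \<omega> \<partial>M)"
    unfolding B_def by (rule nn_integral_Markov_inequality) auto
  also have "(\<integral>\<^sup>+\<omega>. W \<omega> * indicator (space M) \<omega> \<partial>M) = (\<integral>\<^sup>+\<omega>. W \<omega> \<partial>M)"
    by (intro nn_integral_cong) auto
  also have "ennreal p * \<dots> \<le> ennreal p * 1" using EW by (intro mult_left_mono) auto
  finally have "M.prob B \<le> p" using p by (simp add: M.emeasure_eq_measure)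
  then have prob: "1 - p \<le> measure M (space M - B)" using B by (simp add: M.prob_compl)
  have "(\<Sum>i=1..n. psi (s * ((\<theta> \<bullet> X i \<omega>)^2 - l)))
      \<le> real n * ((\<integral>x. arg_mean s l b \<theta> x \<partial>P) - 1) + b * (norm \<theta>)^2 / 2 + ln (1 / p)"
    if \<omega>: "\<omega> \<in> space M - B" for \<omega> \<theta>
  proof -
    interpret T: prob_space "gauss \<theta> b" by (rule prob_space_gauss[OF b])
    have "ennreal p * W \<omega> \<le> 1" using \<omega> by (auto simp: B_def not_le)
    then have "ennreal (1/p) * (ennreal p * W \<omega>) \<le> ennreal (1/p) * 1" by (intro mult_left_mono) auto
    then have Wp: "W \<omega> \<le> ennreal (1/p)"
      using p by (simp add: mult.assoc[symmetric] flip: ennreal_mult)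
    have int_q: "integrable (gauss \<theta> b) q" "(\<integral>w. q w \<partial>gauss \<theta> b) = (\<integral>x. arg_mean s l b \<theta> x \<partial>P)"
      unfolding q_def[abs_def] using arg_fubini[OF s b] by auto
    have int_sum: "integrable (gauss \<theta> b) (\<lambda>w. \<Sum>i=1..n. ln (arg s l b (X i \<omega>) w))"
      by (intro Bochner_Integration.integrable_sum arg_gauss(3)[OF s b])
    have int_h: "integrable (gauss \<theta> b) (h \<omega>)"
      unfolding h_def using int_q int_sum by auto
    have "(\<integral>w. h \<omega> w \<partial>gauss \<theta> b) \<le> b * (norm \<theta>)^2 / 2 + ln (1 / p)"
      using Wp unfolding W_def by (rule gauss_integral_le_log_exp_moment[OF b int_h])
    moreover have "(\<integral>w. h \<omega> w \<partial>gauss \<theta> b) = (\<Sum>i=1..n. \<integral>w. ln (arg s l b (X i \<omega>) w) \<partial>gauss \<theta> b)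
        - real n * ((\<integral>x. arg_mean s l b \<theta> x \<partial>P) - 1)"
      unfolding h_def using int_q int_sum arg_gauss(3)[OF s b]
      by (simp add: T.prob_space[unfolded space_gauss])
    moreover have "(\<Sum>i=1..n. psi (s * ((\<theta> \<bullet> X i \<omega>)^2 - l)))
        \<le> (\<Sum>i=1..n. \<integral>w. ln (arg s l b (X i \<omega>) w) \<partial>gauss \<theta> b)"
      by (intro sum_mono arg_gauss(4)[OF s b])
    ultimately show ?thesis by linarith
  qed
  with prob B show ?thesis by (intro bexI[of _ "space M - B"]) auto
qed

end

section \<open>Moments of a law with bounded kurtosis\<close>

lemma integral_mult_sq_le:
  fixes f g :: "'a \<Rightarrow> real"
  assumes f: "integrable M (\<lambda>x. (f x)^2)" and g: "integrable M (\<lambda>x. (g x)^2)"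
    and fg: "integrable M (\<lambda>x. f x * g x)"
  shows "(\<integral>x. f x * g x \<partial>M)^2 \<le> (\<integral>x. (f x)^2 \<partial>M) * (\<integral>x. (g x)^2 \<partial>M)"
proof -
  define A B C where "A = (\<integral>x. (f x)^2 \<partial>M)" and "B = (\<integral>x. (g x)^2 \<partial>M)" and "C = (\<integral>x. f x * g x \<partial>M)"
  have quad: "0 \<le> t^2 * A + 2 * t * C + B" for t
  proof -
    have "0 \<le> (\<integral>x. (t * f x + g x)^2 \<partial>M)" by simp
    also have "\<dots> = (\<integral>x. t^2 * (f x)^2 + 2 * t * (f x * g x) + (g x)^2 \<partial>M)"
      by (intro Bochner_Integration.integral_cong) (auto simp: power2_eq_square algebra_simps)
    also have "\<dots> = t^2 * A + 2 * t * C + B" using assms by (simp add: A_def B_def C_def)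
    finally show ?thesis .
  qed
  have "0 \<le> A" by (simp add: A_def)
  have "C^2 \<le> A * B"
  proof (cases "A = 0")
    case True
    have "C = 0"
    proof (rule ccontr)
      assume "C \<noteq> 0"
      then show False using quad[of "- (B + 1) / (2 * C)"] True by (simp add: field_simps)
    qed
    then show ?thesis using True by simp
  next
    case False
    then show ?thesis using quad[of "- C / A"] \<open>0 \<le> A\<close>
      by (simp add: power2_eq_square field_simps)
  qed
  then show ?thesis by (simp add: A_def B_def C_def)
qed

locale bounded_kurtosis_law = heavy_tailed_law +
  assumes kappa_ext_finite: "kappa_ext P < \<infinity>"
    and kappa_gt_1: "1 < kappa P"
begin

lemma quad_form_nonneg: "0 \<le> quad_form P \<theta>"
  by (simp add: quad_form_def)

lemma quad_form_scaleR: "quad_form P (a *\<^sub>R \<theta>) = a^2 * quad_form P \<theta>"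
  by (simp add: quad_form_def power_mult_distrib)

lemma s4_pow4: "s4 P ^ 4 = (\<integral>x. norm x ^ 4 \<partial>P)"
  unfolding s4_def by (rule real_root_pow_pos2) auto

lemma s4_nonneg: "0 \<le> s4 P"
  by (simp add: s4_def)

text \<open>For \<open>N(\<theta>) = 0\<close>, a case that the supremum leaves out, \<open>\<langle>\<theta>, x\<rangle>\<close> vanishes almost surely.\<close>

lemma fourth_moment_le: "(\<integral>x. (\<theta> \<bullet> x)^4 \<partial>P) \<le> kappa P * (quad_form P \<theta>)^2"
proof (cases "quad_form P \<theta> = 0")
  case True
  then have "AE x in P. (\<theta> \<bullet> x)^2 = 0"
    unfolding quad_form_def using integrable_inner_sq by (subst (asm) integral_nonneg_eq_0_iff_AE) auto
  then have "AE x in P. (\<theta> \<bullet> x)^4 = 0" by eventually_elim simp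
  then have "(\<integral>x. (\<theta> \<bullet> x)^4 \<partial>P) = 0" by (rule integral_eq_zero_AE)
  then show ?thesis using True by simp
next
  case False
  then have pos: "0 < quad_form P \<theta>" using quad_form_nonneg[of \<theta>] by simp
  have "kappa_ext P = ereal (kappa P)"
    using kappa_gt_1 kappa_ext_finite by (cases "kappa_ext P") (auto simp: kappa_def)
  moreover have "ereal ((\<integral>x. (\<theta> \<bullet> x)^4 \<partial>P) / (quad_form P \<theta>)^2) \<le> kappa_ext P"
    unfolding kappa_ext_def quad_form_def using pos by (intro SUP_upper2[of \<theta>]) (auto simp: quad_form_def)
  ultimately show ?thesis using pos by (simp add: field_simps)
qed

lemma mixed_moment_le:
  "(\<integral>x. (\<theta> \<bullet> x)^2 * (norm x)^2 \<partial>P) \<le> sqrt (kappa P) * quad_form P \<theta> * (s4 P)^2"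
proof (rule power2_le_imp_le)
  have "(\<integral>x. (\<theta> \<bullet> x)^2 * (norm x)^2 \<partial>P)^2 \<le> (\<integral>x. (\<theta> \<bullet> x)^4 \<partial>P) * (\<integral>x. norm x ^ 4 \<partial>P)"
    using integral_mult_sq_le[of P "\<lambda>x. (\<theta> \<bullet> x)^2" "\<lambda>x. (norm x)^2"]
      integrable_inner_pow4 integrable_norm_pow4 integrable_inner_sq_norm_sq by simp
  also have "\<dots> \<le> (kappa P * (quad_form P \<theta>)^2) * s4 P ^ 4"
    unfolding s4_pow4 using fourth_moment_le by (intro mult_right_mono) auto
  also have "\<dots> = (sqrt (kappa P) * quad_form P \<theta> * (s4 P)^2)^2"
    using kappa_gt_1 by (simp add: power_mult_distrib)
  finally show "(\<integral>x. (\<theta> \<bullet> x)^2 * (norm x)^2 \<partial>P)^2 \<le> (sqrt (kappa P) * quad_form P \<theta> * (s4 P)^2)^2" .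
  show "0 \<le> sqrt (kappa P) * quad_form P \<theta> * (s4 P)^2"
    using kappa_gt_1 quad_form_nonneg by simp
qed

lemma quad_form_le: "quad_form P \<theta> \<le> (s4 P)^2 * (norm \<theta>)^2"
proof -
  have "(\<integral>x. (norm x)^2 \<partial>P) \<le> (s4 P)^2"
  proof (rule power2_le_imp_le)
    show "(\<integral>x. (norm x)^2 \<partial>P)^2 \<le> ((s4 P)^2)^2"
      using integral_mult_sq_le[of P "\<lambda>x. (norm x)^2" "\<lambda>x. 1"] integrable_norm_sq integrable_norm_pow4
      by (simp add: s4_pow4 prob_space flip: power_mult)
  qed simp
  moreover have "quad_form P \<theta> \<le> (\<integral>x. (norm \<theta>)^2 * (norm x)^2 \<partial>P)"
    unfolding quad_form_def using integrable_inner_sq integrable_norm_sq inner_sq_le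
    by (intro integral_mono) auto
  ultimately show ?thesis
    using mult_left_mono[of "\<integral>x. (norm x)^2 \<partial>P" "(s4 P)^2" "(norm \<theta>)^2"] by (simp add: mult.commute)
qed

lemma s4_pos: "0 < s4 P"
proof (rule ccontr)
  assume "\<not> 0 < s4 P"
  then have "s4 P = 0" using s4_nonneg by simp
  then have "quad_form P \<theta> = 0" for \<theta> using quad_form_le[of \<theta>] quad_form_nonneg[of \<theta>] by simp
  then have "kappa_ext P = -\<infinity>" by (simp add: kappa_ext_def bot_ereal_def)
  then show False using kappa_gt_1 by (simp add: kappa_def)
qed

text \<open>Summing the mixed moments over the coordinate axes gives \<open>s4\<^sup>4 \<le> sqrt \<kappa> * trace * s4\<^sup>2\<close>.\<close>

lemma s4_sq_le_trace: "(s4 P)^2 \<le> sqrt (kappa P) * trace (gram P)"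
proof -
  have comp: "x $ i = axis i 1 \<bullet> x" for x :: "real^'a" and i by (simp add: inner_axis')
  have tr: "trace (gram P) = (\<Sum>i\<in>UNIV. quad_form P (axis i 1))"
    by (simp add: trace_def gram_def quad_form_def power2_eq_square comp[symmetric])
  have "s4 P ^ 4 = (\<integral>x. (\<Sum>i\<in>UNIV. (axis i 1 \<bullet> x)^2 * (norm x)^2) \<partial>P)"
    unfolding s4_pow4
  proof (intro Bochner_Integration.integral_cong refl)
    fix x :: "real^'a"
    have nx: "(norm x)^2 = (\<Sum>i\<in>UNIV. (axis i 1 \<bullet> x)^2)"
      unfolding power2_norm_eq_inner comp[symmetric] by (simp add: inner_vec_def power2_eq_square)
    have "norm x ^ 4 = (norm x)^2 * (norm x)^2" by (simp add: power2_eq_square power4_eq_xxxx)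
    also have "\<dots> = (\<Sum>i\<in>UNIV. (axis i 1 \<bullet> x)^2) * (norm x)^2" by (simp only: nx)
    finally show "norm x ^ 4 = (\<Sum>i\<in>UNIV. (axis i 1 \<bullet> x)^2 * (norm x)^2)"
      by (simp only: sum_distrib_right)
  qed
  also have "\<dots> = (\<Sum>i\<in>UNIV. \<integral>x. (axis i 1 \<bullet> x)^2 * (norm x)^2 \<partial>P)"
    by (intro Bochner_Integration.integral_sum integrable_inner_sq_norm_sq)
  also have "\<dots> \<le> (\<Sum>i\<in>UNIV. sqrt (kappa P) * quad_form P (axis i 1) * (s4 P)^2)"
    by (intro sum_mono mixed_moment_le)
  also have "\<dots> = sqrt (kappa P) * trace (gram P) * (s4 P)^2"
    by (simp add: tr sum_distrib_left sum_distrib_right)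
  finally have "(s4 P)^2 * (s4 P)^2 \<le> sqrt (kappa P) * trace (gram P) * (s4 P)^2"
    by (simp flip: power_add)
  then show ?thesis using s4_pos by (intro mult_right_le_imp_le[of "(s4 P)^2" "(s4 P)^2"]) auto
qed

text \<open>Expanding the square reduces this to the fourth moment and to the mixed moment.\<close>

lemma integral_arg_mean_le:
  assumes b: "0 < b"
  shows "(\<integral>x. arg_mean s l b \<theta> x \<partial>P) - 1 \<le> s * (quad_form P \<theta> - l)
    + (kappa P * (quad_form P \<theta>)^2 - 2 * l * quad_form P \<theta> + l^2) / 2
    + (2 + c_const) * sqrt (kappa P) * (s4 P)^2 * quad_form P \<theta> / b
    + (2 + 3 * c_const) * s4 P ^ 4 / (2 * b^2)"
proof -
  let ?N = "quad_form P \<theta>"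
  have eq: "arg_mean s l b \<theta> = (\<lambda>x. (1 - s * l + l^2 / 2) + (s - l) * (\<theta> \<bullet> x)^2
      + 1/2 * (\<theta> \<bullet> x)^4 + (2 + c_const) / b * ((\<theta> \<bullet> x)^2 * (norm x)^2)
      + (2 + 3 * c_const) / (2 * b^2) * norm x ^ 4)"
    using b unfolding arg_mean_def by (intro ext) (simp add: power2_eq_square power4_eq_xxxx field_simps)
  define I4 where "I4 = (\<integral>x. (\<theta> \<bullet> x)^4 \<partial>P)"
  define I2 where "I2 = (2 + c_const) / b * (\<integral>x. (\<theta> \<bullet> x)^2 * (norm x)^2 \<partial>P)"
  define C2 where "C2 = (2 + c_const) * sqrt (kappa P) * (s4 P)^2 * ?N / b"
  define C4 where "C4 = (2 + 3 * c_const) * s4 P ^ 4 / (2 * b^2)"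
  have "(\<integral>x. arg_mean s l b \<theta> x \<partial>P) = (1 - s * l + l^2 / 2) + (s - l) * ?N + 1/2 * I4 + I2 + C4"
    unfolding eq C4_def I4_def I2_def s4_pow4 quad_form_def
    using integrable_inner_sq integrable_norm_sq integrable_inner_pow4 integrable_inner_sq_norm_sq integrable_norm_pow4
    by (simp add: prob_space)
  also have "\<dots> = 1 + s * (?N - l) + (I4 - 2 * l * ?N + l^2) / 2 + I2 + C4"
    by (simp add: algebra_simps add_divide_distrib diff_divide_distrib)
  finally have "(\<integral>x. arg_mean s l b \<theta> x \<partial>P) - 1
      = s * (?N - l) + (I4 - 2 * l * ?N + l^2) / 2 + I2 + C4" by simp
  also have "\<dots> \<le> s * (?N - l) + (kappa P * ?N^2 - 2 * l * ?N + l^2) / 2 + C2 + C4"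
  proof -
    have "I4 \<le> kappa P * ?N^2" unfolding I4_def by (rule fourth_moment_le)
    moreover have "I2 \<le> (2 + c_const) / b * (sqrt (kappa P) * ?N * (s4 P)^2)"
      unfolding I2_def using b c_const_ge mixed_moment_le by (intro mult_left_mono) auto
    then have "I2 \<le> C2" by (simp add: C2_def mult_ac)
    ultimately show ?thesis by (intro add_mono divide_right_mono diff_right_mono) auto
  qed
  finally show ?thesis unfolding C2_def C4_def .
qed

end

lemma sum_psi_eq_r_crit:
  "1 \<le> n \<Longrightarrow> (\<Sum>i=1..n. psi ((\<theta> \<bullet> x i)^2 - l)) = real n * r_crit n x l \<theta>"
  by (simp add: r_crit_def)

section \<open>The event on which the criterion is almost linear\<close>

definition r_linearized :: "(real^'d) measure \<Rightarrow> nat \<Rightarrow> real \<Rightarrow> (nat \<Rightarrow> real^'d) \<Rightarrow> real \<Rightarrow> real \<Rightarrow> bool" where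
  "r_linearized P n \<epsilon> x l b \<longleftrightarrow> (\<forall>\<theta>. let u = quad_form P \<theta> / l - 1 in
     \<bar>r_crit n x l \<theta> / l - u\<bar>
       \<le> xi_par P l * u^2 + mu_par P l b * u + gamma_par P n \<epsilon> l b + delta_par n l b * (norm \<theta>)^2)"

lemma finite_Lambda_grid: "finite (Lambda_grid P n \<epsilon>)"
proof -
  have "Lambda_grid P n \<epsilon> \<subseteq> (\<lambda>j. (lambda_grid P n \<epsilon> j, beta_grid P n j)) ` {..< nat (K_grid P n)}"
    by (auto simp: Lambda_grid_def)
  then show ?thesis by (rule finite_subset) simp
qed

lemma card_Lambda_grid_le: "card (Lambda_grid P n \<epsilon>) \<le> nat (K_grid P n)"
proof -
  have "Lambda_grid P n \<epsilon> \<subseteq> (\<lambda>j. (lambda_grid P n \<epsilon> j, beta_grid P n j)) ` {..< nat (K_grid P n)}"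
    by (auto simp: Lambda_grid_def)
  then have "card (Lambda_grid P n \<epsilon>) \<le> card ((\<lambda>j. (lambda_grid P n \<epsilon> j, beta_grid P n j)) ` {..< nat (K_grid P n)})"
    by (intro card_mono) auto
  also have "\<dots> \<le> nat (K_grid P n)" using card_image_le[of "{..< nat (K_grid P n)}"] by fastforce
  finally show ?thesis .
qed

locale sample_setting = iid_sample P M X n + bounded_kurtosis_law P
  for P :: "(real^'d) measure" and M :: "'w measure" and X n +
  fixes \<epsilon> :: real
  assumes K_ge_1: "1 \<le> K_grid P n" and eps: "0 < \<epsilon>" "\<epsilon> < 1"
begin

lemma lambda_grid_pos: "0 < lambda_grid P n \<epsilon> j"
proof -
  have "0 < (2 + 3 * c_const) / (4 * (2 + c_const) * sqrt (kappa P) * exp (- (real j * a_const)))"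
    using c_const_ge kappa_gt_1 by (intro divide_pos_pos mult_pos_pos) auto
  moreover have "0 \<le> ln (real_of_int (K_grid P n) / \<epsilon>)"
    using K_ge_1 eps by (intro ln_ge_zero) (simp add: field_simps)
  ultimately show ?thesis unfolding lambda_grid_def
    using n_pos kappa_gt_1 by (intro real_sqrt_gt_zero mult_pos_pos) auto
qed

lemma beta_grid_pos: "0 < beta_grid P n j"
  unfolding beta_grid_def using n_pos kappa_gt_1 c_const_ge s4_pos
  by (intro real_sqrt_gt_zero mult_pos_pos) auto

lemma Lambda_grid_pos: "(l, b) \<in> Lambda_grid P n \<epsilon> \<Longrightarrow> 0 < l" "(l, b) \<in> Lambda_grid P n \<epsilon> \<Longrightarrow> 0 < b"
  using lambda_grid_pos beta_grid_pos by (auto simp: Lambda_grid_def)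

lemma card_Lambda_grid_pos: "0 < card (Lambda_grid P n \<epsilon>)"
proof -
  have "(lambda_grid P n \<epsilon> 0, beta_grid P n 0) \<in> Lambda_grid P n \<epsilon>"
    using K_ge_1 by (auto simp: Lambda_grid_def intro!: exI[of _ 0])
  then show ?thesis using finite_Lambda_grid by (metis card_gt_0_iff empty_iff)
qed

text \<open>Substituting \<open>N(\<theta>) = l (1 + u)\<close> in the PAC-Bayesian bound and dividing by \<open>n l\<close>, the coefficients of
  \<open>u\<^sup>2\<close>, \<open>u\<close>, \<open>1\<close> and \<open>\<parallel>\<theta>\<parallel>\<^sup>2\<close> are exactly \<open>\<xi>\<close>, \<open>s + \<mu>\<close>, \<open>\<gamma>\<close> and \<open>\<delta>\<close>.\<close>

lemma signed_r_crit_bound: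
  assumes l: "0 < l" and b: "0 < b" and s: "s = 1 \<or> s = -1"
    and bound: "(\<Sum>i=1..n. psi (s * ((\<theta> \<bullet> x i)^2 - l)))
      \<le> real n * ((\<integral>x. arg_mean s l b \<theta> x \<partial>P) - 1) + b * (norm \<theta>)^2 / 2
         + ln (1 / (\<epsilon> / card (Lambda_grid P n \<epsilon>)))"
  defines "u \<equiv> quad_form P \<theta> / l - 1"
  shows "s * (r_crit n x l \<theta> / l - u)
       \<le> xi_par P l * u^2 + mu_par P l b * u + gamma_par P n \<epsilon> l b + delta_par n l b * (norm \<theta>)^2"
proof -
  let ?L = "ln (real (card (Lambda_grid P n \<epsilon>)) / \<epsilon>)"
  let ?N = "quad_form P \<theta>"
  have n: "0 < real n" using n_pos by simp
  have "(\<Sum>i=1..n. psi (s * ((\<theta> \<bullet> x i)^2 - l))) = s * (real n * r_crit n x l \<theta>)"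
  proof -
    have psi_s: "psi (s * t) = s * psi t" for t using s psi_minus by auto
    show ?thesis unfolding psi_s sum_distrib_left[symmetric] sum_psi_eq_r_crit[OF n_pos] ..
  qed
  then have "s * (real n * r_crit n x l \<theta>) \<le> real n * ((\<integral>x. arg_mean s l b \<theta> x \<partial>P) - 1) + b * (norm \<theta>)^2 / 2 + ?L"
    using bound by simp
  then have "real n * (s * r_crit n x l \<theta>)
      \<le> real n * (((\<integral>x. arg_mean s l b \<theta> x \<partial>P) - 1) + b * (norm \<theta>)^2 / (2 * real n) + ?L / real n)"
    using n by (simp add: algebra_simps)
  then have "s * r_crit n x l \<theta> \<le> ((\<integral>x. arg_mean s l b \<theta> x \<partial>P) - 1) + b * (norm \<theta>)^2 / (2 * real n) + ?L / real n"
    using n by (rule mult_left_le_imp_le)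
  also have "\<dots> \<le> (s * (?N - l) + (kappa P * ?N^2 - 2 * l * ?N + l^2) / 2
    + (2 + c_const) * sqrt (kappa P) * (s4 P)^2 * ?N / b
    + (2 + 3 * c_const) * s4 P ^ 4 / (2 * b^2)) + b * (norm \<theta>)^2 / (2 * real n) + ?L / real n"
    using integral_arg_mean_le[OF b, of s l \<theta>] by simp
  finally have "s * r_crit n x l \<theta> / l \<le> (s * (?N - l) + (kappa P * ?N^2 - 2 * l * ?N + l^2) / 2
    + (2 + c_const) * sqrt (kappa P) * (s4 P)^2 * ?N / b
    + (2 + 3 * c_const) * s4 P ^ 4 / (2 * b^2) + b * (norm \<theta>)^2 / (2 * real n) + ?L / real n) / l"
    using l by (intro divide_right_mono) auto
  also have "\<dots> = s * u + xi_par P l * u^2 + mu_par P l b * u + gamma_par P n \<epsilon> l b + delta_par n l b * (norm \<theta>)^2"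
  proof -
    have N: "?N = l * (1 + u)" using l by (simp add: u_def)
    have q: "kappa P * ?N^2 - 2 * l * ?N + l^2
        = l * (kappa P * l * u^2 + 2 * (l * (kappa P - 1)) * u + l * (kappa P - 1))"
      unfolding N by (simp add: power2_eq_square algebra_simps)
    define e where "e = (2 + c_const) * sqrt (kappa P) * (s4 P)^2 / b"
    have e: "(2 + c_const) * sqrt (kappa P) * (s4 P)^2 * ?N / b = l * (e * (1 + u))"
      unfolding N e_def by simp
    have div: "(s * (?N - l) + (kappa P * ?N^2 - 2 * l * ?N + l^2) / 2
      + (2 + c_const) * sqrt (kappa P) * (s4 P)^2 * ?N / b
      + (2 + 3 * c_const) * s4 P ^ 4 / (2 * b^2) + b * (norm \<theta>)^2 / (2 * real n) + ?L / real n) / l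
      = s * u + (kappa P * l * u^2 + 2 * (l * (kappa P - 1)) * u + l * (kappa P - 1)) / 2 + e * (1 + u)
       + (2 + 3 * c_const) * s4 P ^ 4 / (2 * b^2) / l + b * (norm \<theta>)^2 / (2 * real n) / l + ?L / real n / l"
    proof -
      have "s * (?N - l) / l = s * u"
        using l by (simp add: u_def diff_divide_distrib right_diff_distrib)
      then show ?thesis unfolding q e using l by (simp add: add_divide_distrib)
    qed
    show ?thesis unfolding div xi_par_def mu_par_def gamma_par_def delta_par_def e_def[symmetric]
      by (simp add: algebra_simps add_divide_distrib diff_divide_distrib)
  qed
  finally show ?thesis by (simp add: algebra_simps diff_divide_distrib)
qed

text \<open>A union bound over the grid and over the two signs.\<close>

lemma r_linearized_event:
  "\<exists>A\<in>sets M. 1 - 2 * \<epsilon> \<le> measure M A \<and>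
     (\<forall>\<omega>\<in>A. \<forall>(l, b)\<in>Lambda_grid P n \<epsilon>. r_linearized P n \<epsilon> (\<lambda>i. X i \<omega>) l b)"
proof -
  define I where "I = {1, -1 :: real} \<times> Lambda_grid P n \<epsilon>"
  define p where "p = \<epsilon> / card (Lambda_grid P n \<epsilon>)"
  have p: "0 < p" using eps card_Lambda_grid_pos by (simp add: p_def)
  have fin: "finite I" by (simp add: I_def finite_Lambda_grid)
  have "\<exists>A. \<forall>slb\<in>I. A slb \<in> sets M \<and> 1 - p \<le> measure M (A slb) \<and> (\<forall>\<omega>\<in>A slb. \<forall>\<theta>.
    (\<Sum>i=1..n. psi (fst slb * ((\<theta> \<bullet> X i \<omega>)^2 - fst (snd slb))))
      \<le> real n * ((\<integral>x. arg_mean (fst slb) (fst (snd slb)) (snd (snd slb)) \<theta> x \<partial>P) - 1)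
        + snd (snd slb) * (norm \<theta>)^2 / 2 + ln (1 / p))"
  proof (rule bchoice, rule ballI)
    fix slb assume "slb \<in> I"
    then obtain s l b where [simp]: "slb = (s, l, b)" and s: "s = 1 \<or> s = -1" and lb: "(l, b) \<in> Lambda_grid P n \<epsilon>"
      by (auto simp: I_def)
    show "\<exists>A. A \<in> sets M \<and> 1 - p \<le> measure M A \<and> (\<forall>\<omega>\<in>A. \<forall>\<theta>.
      (\<Sum>i=1..n. psi (fst slb * ((\<theta> \<bullet> X i \<omega>)^2 - fst (snd slb))))
        \<le> real n * ((\<integral>x. arg_mean (fst slb) (fst (snd slb)) (snd (snd slb)) \<theta> x \<partial>P) - 1)
          + snd (snd slb) * (norm \<theta>)^2 / 2 + ln (1 / p))"
      using pac_bayes[OF s Lambda_grid_pos(2)[OF lb] p, of l] by auto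
  qed
  then obtain A where A: "\<And>slb. slb \<in> I \<Longrightarrow> A slb \<in> sets M"
    and prob: "\<And>slb. slb \<in> I \<Longrightarrow> 1 - p \<le> measure M (A slb)"
    and bound: "\<And>s l b \<omega> \<theta>. (s, l, b) \<in> I \<Longrightarrow> \<omega> \<in> A (s, l, b) \<Longrightarrow>
      (\<Sum>i=1..n. psi (s * ((\<theta> \<bullet> X i \<omega>)^2 - l)))
        \<le> real n * ((\<integral>x. arg_mean s l b \<theta> x \<partial>P) - 1) + b * (norm \<theta>)^2 / 2 + ln (1 / p)"
    by fastforce
  define B where "B = (\<Union>slb\<in>I. space M - A slb)"
  have B: "B \<in> sets M" unfolding B_def using A fin by (intro sets.finite_UN sets.compl_sets) auto
  have "measure M B \<le> (\<Sum>slb\<in>I. measure M (space M - A slb))"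
    unfolding B_def using A fin by (intro M.finite_measure_subadditive_finite) auto
  also have "\<dots> \<le> (\<Sum>slb\<in>I. p)"
    using A prob by (intro sum_mono) (auto simp: M.prob_compl diff_le_eq add.commute)
  also have "\<dots> = 2 * \<epsilon>" using card_Lambda_grid_pos by (simp add: I_def p_def card_cartesian_product)
  finally have "1 - 2 * \<epsilon> \<le> measure M (space M - B)" using B by (simp add: M.prob_compl)
  moreover have "r_linearized P n \<epsilon> (\<lambda>i. X i \<omega>) l b" if \<omega>: "\<omega> \<in> space M - B" and lb: "(l, b) \<in> Lambda_grid P n \<epsilon>" for \<omega> l b
    unfolding r_linearized_def Let_def
  proof
    fix \<theta>
    let ?u = "quad_form P \<theta> / l - 1"
    let ?R = "xi_par P l * ?u^2 + mu_par P l b * ?u + gamma_par P n \<epsilon> l b + delta_par n l b * (norm \<theta>)^2"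
    have signed: "s * (r_crit n (\<lambda>i. X i \<omega>) l \<theta> / l - ?u) \<le> ?R" if s: "s = 1 \<or> s = -1" for s
    proof (rule signed_r_crit_bound[OF Lambda_grid_pos[OF lb] s])
      have "(s, l, b) \<in> I" using s lb by (auto simp: I_def)
      moreover from this have "\<omega> \<in> A (s, l, b)" using \<omega> by (auto simp: B_def)
      ultimately show "(\<Sum>i=1..n. psi (s * ((\<theta> \<bullet> X i \<omega>)^2 - l)))
        \<le> real n * ((\<integral>x. arg_mean s l b \<theta> x \<partial>P) - 1) + b * (norm \<theta>)^2 / 2
         + ln (1 / (\<epsilon> / card (Lambda_grid P n \<epsilon>)))"
        using bound unfolding p_def by blast
    qed
    show "\<bar>r_crit n (\<lambda>i. X i \<omega>) l \<theta> / l - ?u\<bar> \<le> ?R"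
      using signed[of 1] signed[of "-1"] by (intro abs_leI) auto
  qed
  ultimately show ?thesis using B by (intro bexI[of _ "space M - B"]) auto
qed

end

section \<open>Inverting the criterion\<close>

text \<open>Along a ray the criterion is continuous and nondecreasing and starts at a negative value, so its sign at
  \<open>\<alpha>\<close> is determined by the position of \<open>\<alpha>\<close> with respect to \<open>alpha_hat\<close>, at which it vanishes if
  \<open>alpha_hat\<close> is finite.\<close>

lemma N_tilde_threshold:
  assumes n: "1 \<le> n" and l: "0 < l"
  shows "0 \<le> N_tilde n x l \<theta>"
    and "\<And>\<alpha>. 0 < \<alpha> \<Longrightarrow> \<alpha>^2 * N_tilde n x l \<theta> \<le> l \<Longrightarrow> r_crit n x l (\<alpha> *\<^sub>R \<theta>) \<le> 0"
    and "\<And>\<alpha>. 0 < \<alpha> \<Longrightarrow> l \<le> \<alpha>^2 * N_tilde n x l \<theta> \<Longrightarrow> 0 \<le> r_crit n x l (\<alpha> *\<^sub>R \<theta>)"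
proof -
  define f where "f \<alpha> = r_crit n x l (\<alpha> *\<^sub>R \<theta>)" for \<alpha>
  have f_eq: "f = (\<lambda>\<alpha>. (1 / real n) * (\<Sum>i=1..n. psi (\<alpha>^2 * (\<theta> \<bullet> x i)^2 - l)))"
    by (auto simp: f_def r_crit_def power_mult_distrib)
  have mono: "f \<alpha> \<le> f \<alpha>'" if "0 \<le> \<alpha>" "\<alpha> \<le> \<alpha>'" for \<alpha> \<alpha>'
    unfolding f_eq using that
    by (intro mult_left_mono sum_mono psi_mono diff_right_mono mult_right_mono power_mono) auto
  have cont: "continuous_on UNIV f"
    unfolding f_eq by (intro continuous_intros continuous_on_compose2[OF continuous_psi]) auto
  have lim: "(f \<longlongrightarrow> f \<alpha>) (at \<alpha> within S)" for \<alpha> S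
    using cont by (metis UNIV_I continuous_on_def tendsto_within_subset subset_UNIV)
  have f0: "f 0 < 0" unfolding f_eq using n psi_neg[of "- l"] l by simp
  let ?S = "{\<alpha>. 0 \<le> \<alpha> \<and> r_crit n x l (\<alpha> *\<^sub>R \<theta>) \<le> 0}"
  have hat: "alpha_hat n x l \<theta> = (SUP \<alpha>\<in>?S. ereal \<alpha>)" by (simp add: alpha_hat_def)
  have below: "f \<alpha> \<le> 0" if nonneg: "0 \<le> \<alpha>" and less: "ereal \<alpha> < alpha_hat n x l \<theta>" for \<alpha>
  proof -
    obtain \<alpha>' where "\<alpha>' \<in> ?S" "\<alpha> < \<alpha>'" using less unfolding hat by (auto simp: less_SUP_iff)
    then show ?thesis using mono[of \<alpha> \<alpha>'] nonneg by (auto simp: f_def)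
  qed
  have "0 \<le> N_tilde n x l \<theta> \<and> (\<forall>\<alpha>>0. \<alpha>^2 * N_tilde n x l \<theta> \<le> l \<longrightarrow> f \<alpha> \<le> 0)
      \<and> (\<forall>\<alpha>>0. l \<le> \<alpha>^2 * N_tilde n x l \<theta> \<longrightarrow> 0 \<le> f \<alpha>)"
  proof (cases "alpha_hat n x l \<theta> = \<infinity>")
    case True
    then have "N_tilde n x l \<theta> = 0" by (simp add: N_tilde_def)
    then show ?thesis using below True l by auto
  next
    case False
    have "eventually (\<lambda>\<alpha>. f \<alpha> < 0) (at_right 0)"
      using lim f0 by (rule order_tendstoD)
    then obtain d where d: "0 < d" "\<And>y. 0 < y \<Longrightarrow> y < d \<Longrightarrow> f y < 0"
      by (auto simp: eventually_at_right[OF zero_less_one])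
    have "d / 2 \<in> ?S" using d(1) d(2)[of "d/2"] by (simp add: f_def)
    then have "ereal (d / 2) \<le> alpha_hat n x l \<theta>" unfolding hat by (rule SUP_upper)
    then obtain A where A: "alpha_hat n x l \<theta> = ereal A" and A0: "0 < A"
      using False d(1) by (cases "alpha_hat n x l \<theta>") auto
    have N: "N_tilde n x l \<theta> = l / A^2" by (simp add: N_tilde_def A)
    have above: "0 \<le> f \<alpha>" if "A < \<alpha>" for \<alpha>
    proof (rule ccontr)
      assume "\<not> 0 \<le> f \<alpha>"
      then have "ereal \<alpha> \<le> alpha_hat n x l \<theta>"
        unfolding hat using that A0 by (intro SUP_upper) (auto simp: f_def)
      then show False using that by (simp add: A)
    qed
    have "f A \<le> 0"
    proof (rule tendsto_upperbound[OF lim])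
      show "eventually (\<lambda>\<alpha>. f \<alpha> \<le> 0) (at_left A)"
        unfolding eventually_at_left[OF A0] using below A0 by (intro exI[of _ 0]) (auto simp: A)
    qed simp
    moreover have "0 \<le> f A"
    proof (rule tendsto_lowerbound[OF lim])
      show "eventually (\<lambda>\<alpha>. 0 \<le> f \<alpha>) (at_right A)"
        using eventually_at_right_less[of A] by eventually_elim (rule above)
    qed simp
    moreover have "(\<alpha>^2 * (l / A^2) \<le> l) = (\<alpha> \<le> A)" "(l \<le> \<alpha>^2 * (l / A^2)) = (A \<le> \<alpha>)" if "0 < \<alpha>" for \<alpha>
    proof -
      have "(\<alpha>^2 * (l / A^2) \<le> l) = (\<alpha>^2 \<le> A^2)" "(l \<le> \<alpha>^2 * (l / A^2)) = (A^2 \<le> \<alpha>^2)"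
        using l A0 by (auto simp: field_simps)
      then show "(\<alpha>^2 * (l / A^2) \<le> l) = (\<alpha> \<le> A)" "(l \<le> \<alpha>^2 * (l / A^2)) = (A \<le> \<alpha>)"
        using that A0 by (auto simp: power_mono_iff)
    qed
    ultimately show ?thesis unfolding N using below above A0 l
      by (auto simp: A le_less)
  qed
  then show "0 \<le> N_tilde n x l \<theta>"
    and "\<And>\<alpha>. 0 < \<alpha> \<Longrightarrow> \<alpha>^2 * N_tilde n x l \<theta> \<le> l \<Longrightarrow> r_crit n x l (\<alpha> *\<^sub>R \<theta>) \<le> 0"
    and "\<And>\<alpha>. 0 < \<alpha> \<Longrightarrow> l \<le> \<alpha>^2 * N_tilde n x l \<theta> \<Longrightarrow> 0 \<le> r_crit n x l (\<alpha> *\<^sub>R \<theta>)"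
    unfolding f_def by blast+
qed

text \<open>All that is needed about a direction.  The variable \<open>a\<close> is the squared norm of the point of the ray,
  \<open>\<rho> a\<close> the criterion there divided by \<open>l\<close>, \<open>t\<close> and \<open>T\<close> are the true and the estimated value of the
  quadratic form at the unit vector.\<close>

locale criterion_inversion =
  fixes \<rho> :: "real \<Rightarrow> real" and t T l \<xi> \<mu> \<gamma> \<delta> \<sigma> :: real
  assumes nonneg: "0 \<le> t" "0 \<le> T" "0 \<le> \<sigma>" and pos: "0 < l" "0 < \<xi>" "0 < \<mu>" "0 < \<gamma>" "0 < \<delta>"
    and linearized: "\<And>a. 0 < a \<Longrightarrow> \<bar>\<rho> a - (a * t / l - 1)\<bar>
        \<le> \<xi> * (a * t / l - 1)^2 + \<mu> * (a * t / l - 1) + \<gamma> + \<delta> * a"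
    and below: "\<And>a. 0 < a \<Longrightarrow> a * T \<le> l \<Longrightarrow> \<rho> a \<le> 0"
    and above: "\<And>a. 0 < a \<Longrightarrow> l \<le> a * T \<Longrightarrow> 0 \<le> \<rho> a"
begin

text \<open>Let \<open>B\<close> be the right-hand side.  If \<open>t\<close> were too large, then the criterion would be positive at the point
  where \<open>u = B\<close>, which comes before \<open>a = l / m\<close> where it is still nonpositive.  If \<open>t\<close> were too small, the
  criterion would be negative at its own zero \<open>a = l / T\<close>: there \<open>u = - y\<close> with \<open>B < y \<le> 1\<close>, and the
  concave function \<open>(1 + \<mu>) y - \<xi> y\<^sup>2\<close> exceeds \<open>g\<close> at \<open>B\<close> and at \<open>1\<close>, hence in between.\<close>

lemma relative_error_le:
  assumes m: "0 < max T \<sigma>"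
    and small: "\<xi> + \<mu> + \<gamma> + 2 * \<delta> * l / max T \<sigma> < 1"
  shows "\<bar>max t \<sigma> / max T \<sigma> - 1\<bar>
    \<le> (\<gamma> + l * \<delta> / max T \<sigma>) / (1 - \<mu> - \<gamma> - 2 * l * \<delta> / max T \<sigma>)"
proof -
  define m where "m = max T \<sigma>"
  define d where "d = l * \<delta> / m"
  define g where "g = \<gamma> + d"
  define den where "den = 1 - \<mu> - \<gamma> - 2 * d"
  define B where "B = g / den"
  have m0: "0 < m" using m by (simp add: m_def)
  have d0: "0 < d" using pos m0 by (simp add: d_def)
  have g0: "0 < g" using pos d0 by (simp add: g_def)
  have "2 * \<delta> * l / max T \<sigma> = 2 * d" by (simp add: d_def m_def)
  then have small': "\<xi> + \<mu> + \<gamma> + 2 * d < 1" using small by simp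
  then have den: "\<xi> < den" by (simp add: den_def)
  have den0: "0 < den" using den pos by simp
  have B0: "0 < B" using g0 den0 by (simp add: B_def)
  have Bden: "B * den = g" using den0 by (simp add: B_def)
  have "\<xi> * B < den * B" using den B0 by (rule mult_strict_right_mono)
  then have \<xi>B: "\<xi> * B < g" using Bden by (simp add: mult.commute)
  have up: "max t \<sigma> \<le> m * (1 + B)"
  proof (rule ccontr)
    assume "\<not> ?thesis"
    moreover have "\<sigma> \<le> m" by (simp add: m_def)
    then have "\<sigma> \<le> m * (1 + B)" using m0 B0 by (simp add: algebra_simps add_increasing2)
    ultimately have t: "m * (1 + B) < t" by (simp add: max_def split: if_splits)
    have t0: "0 < t" using t m0 B0 by (meson add_pos_pos less_trans mult_pos_pos zero_less_one)
    define a where "a = l * (1 + B) / t"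
    have a0: "0 < a" using pos t0 B0 by (simp add: a_def)
    have "a * m \<le> l"
    proof -
      have "l * (m * (1 + B)) \<le> l * t" using t pos by (intro mult_left_mono) auto
      then show ?thesis using t0 by (simp add: a_def field_simps)
    qed
    then have am: "a \<le> l / m" using m0 by (simp add: field_simps)
    have "a * T \<le> a * m" using a0 by (intro mult_left_mono) (auto simp: m_def)
    with \<open>a * m \<le> l\<close> have "a * T \<le> l" by linarith
    with a0 have "\<rho> a \<le> 0" by (rule below)
    moreover have u: "a * t / l - 1 = B" using pos t0 by (simp add: a_def)
    ultimately have "B \<le> \<xi> * B^2 + \<mu> * B + \<gamma> + \<delta> * a" using linearized[OF a0] by (simp add: u)
    also have "\<delta> * a \<le> d" using am pos mult_left_mono[of a "l / m" \<delta>] by (simp add: d_def mult.commute)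
    finally have "B \<le> (\<xi> * B) * B + \<mu> * B + g" by (simp add: g_def power2_eq_square mult.assoc)
    moreover have "(\<xi> * B) * B < g * B" using \<xi>B B0 by (rule mult_strict_right_mono)
    ultimately have "B * (1 - \<mu> - g) < g" by (simp add: algebra_simps)
    moreover have "B * den \<le> B * (1 - \<mu> - g)" using B0 d0 by (intro mult_left_mono) (auto simp: den_def g_def)
    ultimately show False using Bden by simp
  qed
  have low: "m * (1 - B) \<le> max t \<sigma>"
  proof (rule ccontr)
    assume neg: "\<not> ?thesis"
    have "m * (1 - B) < m * 1" using m0 B0 by (intro mult_strict_left_mono) auto
    then have "\<sigma> < m" using neg by auto
    then have mT: "m = T" by (auto simp: m_def max_def split: if_splits)
    define y where "y = 1 - t / m"
    have y: "B < y" "y \<le> 1" using neg m0 nonneg by (auto simp: y_def field_simps)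
    define a where "a = l / m"
    have a0: "0 < a" using pos m0 by (simp add: a_def)
    have "0 \<le> \<rho> a" using a0 m0 by (intro above) (auto simp: a_def mT)
    moreover have u: "a * t / l - 1 = - y" using pos m0 by (simp add: a_def y_def)
    ultimately have "y \<le> \<xi> * y^2 - \<mu> * y + \<gamma> + \<delta> * a" using linearized[OF a0] by (simp add: u)
    then have 1: "y * (1 + \<mu>) - \<xi> * y^2 \<le> g" by (simp add: g_def d_def a_def algebra_simps)
    \<comment> \<open>Replacing \<open>y\<^sup>2\<close> by its chord over \<open>[B, 1]\<close> leaves an increasing affine function of \<open>y\<close>.\<close>
    have "0 \<le> (y - B) * (1 - y)" using y by simp
    then have "\<xi> * y^2 \<le> \<xi> * (y * (1 + B) - B)"
      using pos by (intro mult_left_mono) (auto simp: power2_eq_square algebra_simps)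
    with 1 have 2: "y * (1 + \<mu> - \<xi> - \<xi> * B) + \<xi> * B \<le> g" by (simp add: algebra_simps)
    have "0 \<le> 1 + \<mu> - \<xi> - \<xi> * B" using small' \<xi>B pos d0 by (simp add: g_def)
    then have "B * (1 + \<mu> - \<xi> - \<xi> * B) \<le> y * (1 + \<mu> - \<xi> - \<xi> * B)"
      using y by (intro mult_right_mono) auto
    with 2 have "B * (1 + \<mu> - \<xi> * B) \<le> g" by (simp add: algebra_simps)
    moreover have "B * den < B * (1 + \<mu> - \<xi> * B)"
      using B0 pos \<xi>B d0 by (intro mult_strict_left_mono) (auto simp: den_def g_def)
    ultimately show False using Bden by simp
  qed
  have "max t \<sigma> / m - 1 \<le> B" "- B \<le> max t \<sigma> / m - 1"
    using up low m0 by (auto simp: field_simps)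
  then have "\<bar>max t \<sigma> / m - 1\<bar> \<le> B" by (simp add: abs_le_iff)
  moreover have "l * \<delta> / max T \<sigma> = d" "2 * l * \<delta> / max T \<sigma> = 2 * d" by (simp_all add: d_def m_def)
  ultimately show ?thesis by (simp only: B_def g_def den_def m_def)
qed

text \<open>The hypothesis makes the criterion positive at the point where \<open>u = 2 z\<close>.\<close>

lemma threshold_lower_bound:
  fixes z :: real
  defines "d \<equiv> \<delta> * l / max t \<sigma>"
  assumes \<tau>: "0 < max t \<sigma>" and z: "0 < z"
    and gain: "\<gamma> + d < 2 * z * (1 - \<mu> - d) - 4 * \<xi> * z^2"
  shows "max t \<sigma> \<le> (1 + 2 * z) * max T \<sigma>"
proof (cases "t \<le> \<sigma>")
  case True
  have "1 * \<sigma> \<le> (1 + 2 * z) * max T \<sigma>" using z nonneg by (intro mult_mono) auto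
  then show ?thesis using True by simp
next
  case False
  then have t0: "0 < t" and mt: "max t \<sigma> = t" using nonneg by auto
  define a where "a = l * (1 + 2 * z) / t"
  have a0: "0 < a" using pos z t0 by (simp add: a_def)
  have u: "a * t / l - 1 = 2 * z" using pos t0 by (simp add: a_def)
  have \<delta>a: "\<delta> * a = d + 2 * z * d" using mt t0 by (simp add: a_def d_def field_simps)
  have "0 < \<rho> a"
    using linearized[OF a0] gain unfolding u \<delta>a by (simp add: abs_le_iff power2_eq_square algebra_simps)
  then have "l < a * T" using below[OF a0] by (meson not_le)
  then have "l * t < l * ((1 + 2 * z) * T)" using t0 by (simp add: a_def field_simps)
  then have "t \<le> (1 + 2 * z) * T" using pos by simp
  also have "\<dots> \<le> (1 + 2 * z) * max T \<sigma>" using z by (intro mult_left_mono) auto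
  finally show ?thesis by (simp add: mt)
qed

text \<open>The bound is evaluated at the estimate \<open>T\<close>, whereas its ingredients are controlled at the true value \<open>t\<close>.
  By the previous lemma, passing from one to the other multiplies \<open>d\<close> by at most \<open>1 + 2 z\<close>.  The constants
  \<open>9/8\<close>, \<open>5/8\<close> and \<open>9/16\<close> are rounded values of what a near-optimal grid parameter achieves.\<close>

lemma bound_at_threshold_le:
  fixes z :: real
  defines "d \<equiv> \<delta> * l / max t \<sigma>"
  assumes \<tau>: "0 < max t \<sigma>" and z: "0 < z" "6 * z \<le> 1"
    and gd: "\<gamma> + d \<le> z" and \<mu>d: "\<mu> + d \<le> 9/8 * z" and dz: "d \<le> 5/8 * z"
    and \<xi>z: "\<xi> \<le> 9/16 * (1 - 5 * z)"
  shows "0 < max T \<sigma>" "\<xi> + \<mu> + \<gamma> + 2 * \<delta> * l / max T \<sigma> < 1"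
    and "(\<gamma> + l * \<delta> / max T \<sigma>) / (1 - \<mu> - \<gamma> - 2 * l * \<delta> / max T \<sigma>) \<le> z / (1 - 4 * z)"
proof -
  have d0: "0 < d" using pos \<tau> by (simp add: d_def)
  have zz: "6 * (z * z) \<le> z" using z mult_right_mono[of "6 * z" 1 z] by simp
  have dzz: "8 * (d * z) \<le> 5 * (z * z)" using mult_right_mono[OF dz, of z] z by simp
  have low: "max t \<sigma> \<le> (1 + 2 * z) * max T \<sigma>"
  proof (rule threshold_lower_bound[OF \<tau> z(1)])
    have "2 * z * (\<mu> + d) \<le> 2 * z * (9/8 * z)" using \<mu>d z by (intro mult_left_mono) auto
    then have 1: "2 * z * (1 - \<mu> - d) \<ge> 2 * z - 9/4 * (z * z)" by (simp add: algebra_simps)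
    have "\<xi> \<le> 9/16" using \<xi>z z by simp
    then have "4 * \<xi> * z^2 \<le> 4 * (9/16) * z^2" by (intro mult_right_mono mult_left_mono) auto
    then have 2: "4 * \<xi> * z^2 \<le> 9/4 * (z * z)" by (simp add: power2_eq_square)
    show "\<gamma> + \<delta> * l / max t \<sigma> < 2 * z * (1 - \<mu> - \<delta> * l / max t \<sigma>) - 4 * \<xi> * z^2"
      using 1 2 gd zz z unfolding d_def by linarith
  qed
  show m0: "0 < max T \<sigma>"
  proof (rule ccontr)
    assume "\<not> ?thesis"
    then have "max T \<sigma> = 0" using nonneg by (simp add: max_def split: if_splits)
    then show False using low \<tau> by simp
  qed
  define D where "D = l * \<delta> / max T \<sigma>"
  have D: "D \<le> d * (1 + 2 * z)"
  proof -
    have "\<delta> * l * max t \<sigma> \<le> \<delta> * l * ((1 + 2 * z) * max T \<sigma>)"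
      using low pos by (intro mult_left_mono) auto
    then show ?thesis using m0 \<tau> by (simp add: D_def d_def field_simps)
  qed
  then have D': "D \<le> d + 2 * (d * z)" by (simp add: algebra_simps)
  have D0: "0 < D" using pos m0 by (simp add: D_def)
  have small: "\<xi> + \<mu> + \<gamma> + 2 * D < 1" 
  proof -
    have "\<xi> + \<mu> + \<gamma> + 2 * D \<le> 9/16 * (1 - 5 * z) + (9/8 * z - d) + (z - d) + 2 * (d + 2 * (d * z))"
      using \<xi>z \<mu>d gd D' by (intro add_mono mult_left_mono) auto
    also have "\<dots> = 9/16 - 11/16 * z + 4 * (d * z)" by (simp add: field_simps)
    also have "\<dots> < 1" using dzz zz z by linarith
    finally show ?thesis .
  qed
  moreover have "2 * \<delta> * l / max T \<sigma> = 2 * D" by (simp add: D_def)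
  ultimately show "\<xi> + \<mu> + \<gamma> + 2 * \<delta> * l / max T \<sigma> < 1" by simp
  have den: "0 < 1 - \<mu> - \<gamma> - 2 * D" using small pos by simp
  have cross: "(\<gamma> + D) * (1 - 4 * z) \<le> z * (1 - \<mu> - \<gamma> - 2 * D)"
  proof -
    have "(\<gamma> + D) * (1 - 4 * z) - z * (1 - \<mu> - \<gamma> - 2 * D) = \<gamma> * (1 - 3 * z) + D * (1 - 2 * z) - z + z * \<mu>"
      by (simp add: algebra_simps)
    also have "\<dots> \<le> (z - d) * (1 - 3 * z) + (d + 2 * (d * z)) * (1 - 2 * z) - z + z * (9/8 * z - d)"
      using gd D' \<mu>d z by (intro add_mono diff_right_mono mult_right_mono mult_left_mono) auto
    also have "\<dots> = - (15/8) * (z * z) + 2 * (d * z) - 4 * (d * z) * z"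
      by (simp add: algebra_simps)
    also have "\<dots> \<le> 0"
    proof -
      have "0 \<le> d * z * z" "0 \<le> z * z" using d0 z by auto
      then show ?thesis using dzz by linarith
    qed
    finally show ?thesis by simp
  qed
  have eqs: "l * \<delta> / max T \<sigma> = D" "2 * l * \<delta> / max T \<sigma> = 2 * D" by (simp_all add: D_def)
  show "(\<gamma> + l * \<delta> / max T \<sigma>) / (1 - \<mu> - \<gamma> - 2 * l * \<delta> / max T \<sigma>) \<le> z / (1 - 4 * z)"
    unfolding eqs using cross den z by (simp add: divide_le_eq le_divide_eq mult.commute)
qed

end

section \<open>A good parameter in the grid\<close>

lemma exp_half_bounds: "exp (1/2::real) + exp (- 1/2) \<le> 22553 / 10000" "exp (1/2::real) \<le> 5/3"
proof -
  have up: "exp (1/2::real) \<le> 164875 / 100000"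
    using exp_upper_taylor[of "1/2"] by (simp add: eval_nat_numeral)
  have lo: "164869 / 100000 \<le> exp (1/2::real)"
    using exp_lower_taylor[of "1/2"] by (simp add: eval_nat_numeral)
  have "exp (- 1/2::real) = inverse (exp (1/2))" by (simp add: exp_minus[symmetric])
  also have "\<dots> \<le> inverse (164869 / 100000)" using lo by (intro le_imp_inverse_le) auto
  finally show "exp (1/2::real) + exp (- 1/2) \<le> 22553 / 10000" using up by simp
  show "exp (1/2::real) \<le> 5/3" using up by simp
qed

lemma exp_quarter_bounds: "exp (1/4::real) + exp (- 1/4) \<le> 2064 / 1000" "exp (1/4::real) \<le> 9/7"
proof -
  have up: "exp (1/4::real) \<le> 12841 / 10000"
    using exp_upper_taylor[of "1/4"] by (simp add: eval_nat_numeral)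
  have lo: "1284 / 1000 \<le> exp (1/4::real)"
    using exp_lower_taylor[of "1/4"] by (simp add: eval_nat_numeral)
  have "exp (- 1/4::real) = inverse (exp (1/4))" by (simp add: exp_minus[symmetric])
  also have "\<dots> \<le> inverse (1284 / 1000)" using lo by (intro le_imp_inverse_le) auto
  finally show "exp (1/4::real) + exp (- 1/4) \<le> 2064 / 1000" using up by simp
  show "exp (1/4::real) \<le> 9/7" using up by simp
qed

lemma c_const_cosh_bound: "(2 + c_const) * (2 + exp (1/2) + exp (- 1/2)) \<le> 197"
proof -
  have "(2 + c_const) * (2 + exp (1/2) + exp (- 1/2)) \<le> (2 + 44293/1000) * (2 + 22553 / 10000)"
    using c_const_le c_const_ge exp_half_bounds by (intro mult_mono) auto
  also have "\<dots> \<le> 197" by simp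
  finally show ?thesis .
qed

text \<open>The price of using \<open>x\<close> instead of the minimizer \<open>y\<close> of \<open>x + y\<^sup>2 / x\<close>: for \<open>E = exp r\<close> the factor
  \<open>(E + 1/E) / 2\<close> is \<open>cosh r\<close>.\<close>

lemma ratio_plus_inverse_le:
  fixes x y E :: real
  assumes "0 < x" "0 < y" "1 \<le> E" "x \<le> E * y" "y \<le> E * x"
  shows "x + y^2 / x \<le> y * (E + 1 / E)"
proof -
  have "0 \<le> (E * y - x) * (E * x - y)" using assms by simp
  then have "E * (x^2 + y^2) \<le> x * y * (E^2 + 1)" by (simp add: power2_eq_square algebra_simps)
  then show ?thesis using assms by (simp add: field_simps power2_eq_square)
qed

context sample_setting
begin

text \<open>Here \<open>l0\<close> and \<open>b0\<close> are the optimal parameters for the level \<open>\<tau>\<close>.  The index is the integer closest to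
  \<open>2 ln (s4\<^sup>2 / \<tau>)\<close>, so that \<open>exp (- j/2)\<close> equals \<open>\<tau> / s4\<^sup>2\<close> up to a factor \<open>exp y\<close> with \<open>\<bar>y\<bar> \<le> 1/4\<close>.  The
  hypothesis on \<open>n\<close> places this index inside the grid.  The shift by \<open>1/2\<close> in \<open>beta_grid\<close> makes the error
  in \<open>b\<close> one-sided.\<close>

lemma grid_parameter_near_optimum:
  assumes \<tau>: "0 < \<tau>" "\<tau> \<le> (s4 P)^2"
    and large: "(72 * (2 + c_const) * sqrt (kappa P)) * ((s4 P)^2 / \<tau>) \<le> real n"
    and l0: "l0 = sqrt (2 / (real n * (kappa P - 1)) * ((2 + 3 * c_const) / (4 * (2 + c_const)) * ((s4 P)^2 / (sqrt (kappa P) * \<tau>))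
              + ln (real_of_int (K_grid P n) / \<epsilon>)))"
    and b0: "b0 = sqrt (2 * (2 + c_const) * sqrt (kappa P) * (s4 P)^2 * real n * \<tau>)"
  obtains l b where "(l, b) \<in> Lambda_grid P n \<epsilon>"
    and "l \<le> exp (1/8) * l0" "l0 \<le> exp (1/8) * l" "b0 \<le> b" "b \<le> exp (1/4) * b0"
proof -
  define x where "x = ln ((s4 P)^2 / \<tau>)"
  define j where "j = nat (round (2 * x))"
  have s4: "0 < (s4 P)^2" using s4_pos by simp
  have x0: "0 \<le> x" unfolding x_def using \<tau> by (intro ln_ge_zero) simp
  have "0 \<le> round (2 * x)" using x0 round_mono[of 0 "2 * x"] by simp
  then have "\<bar>real j - 2 * x\<bar> \<le> 1/2"
    using of_int_round_abs_le[of "2 * x"] by (simp add: j_def)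
  from abs_le_D1[OF this] abs_le_D2[OF this]
  have j: "real j \<le> 2 * x + 1/2" "2 * x \<le> real j + 1/2" by linarith+
  define y where "y = x - real j / 2"
  have y: "- 1/4 \<le> y" "y \<le> 1/4" using j by (auto simp: y_def)
  have ex: "exp x = (s4 P)^2 / \<tau>" unfolding x_def using s4 \<tau> by simp
  have ej: "exp (- (real j * a_const)) = exp y * (\<tau> / (s4 P)^2)"
  proof -
    have "exp (- (real j * a_const)) = exp y / exp x" by (simp add: y_def a_const_def exp_diff[symmetric])
    then show ?thesis by (simp add: ex)
  qed
  have in_grid: "int j < K_grid P n"
  proof -
    let ?q = "real n / (72 * (2 + c_const) * sqrt (kappa P))"
    have den: "0 < 72 * (2 + c_const) * sqrt (kappa P)" using c_const_ge kappa_gt_1 by simp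
    have "(s4 P)^2 / \<tau> \<le> ?q" using large den by (simp add: le_divide_eq mult.commute)
    then have "x \<le> ln ?q" unfolding x_def using s4 \<tau> by (subst ln_le_cancel_iff) (auto intro: less_le_trans[of _ "(s4 P)^2 / \<tau>"])
    then have "real j \<le> ln ?q / a_const + 1/2" using j by (simp add: a_const_def)
    then have "real j < real_of_int \<lceil>ln ?q / a_const\<rceil> + 1" by linarith
    then have "int j \<le> \<lceil>ln ?q / a_const\<rceil>" by linarith
    then show ?thesis by (simp add: K_grid_def)
  qed
  let ?L = "ln (real_of_int (K_grid P n) / \<epsilon>)"
  let ?R = "(2 + 3 * c_const) / (4 * (2 + c_const)) * ((s4 P)^2 / (sqrt (kappa P) * \<tau>))"
  let ?l = "lambda_grid P n \<epsilon> j" and ?b = "beta_grid P n j"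
  have L0: "0 \<le> ?L" using K_ge_1 eps by (intro ln_ge_zero) (simp add: field_simps)
  have R0: "0 \<le> ?R" using c_const_ge kappa_gt_1 \<tau> by simp
  have l_eq: "?l = sqrt (2 / (real n * (kappa P - 1)) * (?R * exp (- y) + ?L))"
    unfolding lambda_grid_def ej by (simp add: exp_minus field_simps)
  have scale: "sqrt (k * p) \<le> exp (1/8) * sqrt (k * q)" if "0 \<le> k" "0 \<le> q" "p \<le> exp (1/4) * q" for k p q :: real
  proof -
    have "k * p \<le> exp (1/8)^2 * (k * q)"
      using mult_left_mono[OF that(3,1)] by (simp add: power2_eq_square mult_ac flip: exp_add)
    then have "sqrt (k * p) \<le> sqrt (exp (1/8)^2 * (k * q))" by (rule real_sqrt_le_mono)
    then show ?thesis by (simp add: real_sqrt_mult)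
  qed
  have k0: "0 \<le> 2 / (real n * (kappa P - 1))" using kappa_gt_1 by simp
  have L_le: "?L \<le> exp (1/4) * ?L" using mult_right_mono[of 1 "exp (1/4)" ?L] L0 by simp
  have up: "?R * exp (- y) + ?L \<le> exp (1/4) * (?R + ?L)"
  proof -
    have "?R * exp (- y) \<le> ?R * exp (1/4)" using y R0 by (intro mult_left_mono) auto
    then show ?thesis using L_le by (simp add: algebra_simps)
  qed
  have lo: "?R + ?L \<le> exp (1/4) * (?R * exp (- y) + ?L)"
  proof -
    have "?R * 1 \<le> ?R * (exp (1/4) * exp (- y))"
      using y R0 by (intro mult_left_mono) (auto simp flip: exp_add)
    then show ?thesis using L_le by (simp add: algebra_simps)
  qed
  show ?thesis
  proof (rule that[of ?l ?b])
    show "(?l, ?b) \<in> Lambda_grid P n \<epsilon>" using in_grid by (auto simp: Lambda_grid_def)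
    have nn: "0 \<le> ?R * exp (- y) + ?L" "0 \<le> ?R + ?L"
      by (intro add_nonneg_nonneg mult_nonneg_nonneg[OF R0 exp_ge_zero] R0 L0)+
    show "?l \<le> exp (1/8) * l0" unfolding l0 l_eq by (rule scale[OF k0 nn(2) up])
    show "l0 \<le> exp (1/8) * ?l" unfolding l0 l_eq by (rule scale[OF k0 nn(1) lo])
    let ?B = "2 * (2 + c_const) * sqrt (kappa P) * (s4 P)^2 * real n * \<tau>"
    have B0: "0 \<le> ?B" using c_const_ge kappa_gt_1 \<tau> by simp
    have "exp (- ((real j - 1/2) * a_const)) = exp (1/4 + y) * (\<tau> / (s4 P)^2)"
    proof -
      have "exp (- ((real j - 1/2) * a_const)) = exp (1/4) * exp (- (real j * a_const))"
        by (simp add: a_const_def algebra_simps flip: exp_add)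
      then show ?thesis by (simp add: ej exp_add)
    qed
    then have b: "?b = sqrt (exp (1/4 + y) * ?B)"
      unfolding beta_grid_def using s4 by (simp add: power2_eq_square power4_eq_xxxx mult_ac)
    have "1 * ?B \<le> exp (1/4 + y) * ?B" using y B0 by (intro mult_right_mono) auto
    moreover have "exp (1/4 + y) * ?B \<le> exp (1/4)^2 * ?B"
      using y B0 by (intro mult_right_mono) (auto simp: power2_eq_square simp flip: exp_add)
    ultimately have "sqrt ?B \<le> ?b" "?b \<le> sqrt (exp (1/4)^2 * ?B)"
      unfolding b by (auto intro: real_sqrt_le_mono)
    then show "b0 \<le> ?b" "?b \<le> exp (1/4) * b0" by (simp_all add: b0 real_sqrt_mult)
  qed
qed

lemma trace_pos: "0 < trace (gram P)"
  using s4_sq_le_trace s4_pos kappa_gt_1 by (smt (verit) mult_nonneg_nonpos real_sqrt_ge_zero zero_less_power)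

text \<open>Up to the factor \<open>1 / sqrt n\<close>, the two summands of \<open>zeta_star\<close> are \<open>z1\<close> and \<open>z2\<close>.  The terms of \<open>\<gamma>\<close> that
  involve \<open>l\<close> alone or through \<open>1/l\<close> are at most \<open>z1\<close>, and the remaining term \<open>e\<close> of \<open>\<gamma>\<close> together with
  \<open>d\<close> is at most \<open>z2\<close>.\<close>

lemma grid_parameter_bounds:
  assumes \<tau>: "0 < \<tau>" "\<tau> \<le> (s4 P)^2"
  defines "z \<equiv> zeta_star P n \<epsilon> \<tau> / sqrt (real n)"
  assumes small: "(6 + inverse (kappa P - 1)) * zeta_star P n \<epsilon> \<tau> \<le> sqrt (real n)"
  shows "0 < z" "6 * z \<le> 1"
    and "\<exists>(l, b)\<in>Lambda_grid P n \<epsilon>. gamma_par P n \<epsilon> l b + delta_par n l b * l / \<tau> \<le> z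
      \<and> mu_par P l b + delta_par n l b * l / \<tau> \<le> 9/8 * z \<and> delta_par n l b * l / \<tau> \<le> 5/8 * z
      \<and> xi_par P l \<le> 9/16 * (1 - 5 * z)"
proof -
  define k where "k = kappa P"
  define Tr where "Tr = trace (gram P)"
  define L where "L = ln (real_of_int (K_grid P n) / \<epsilon>)"
  define C where "C = 2 + c_const"
  define S where "S = (s4 P)^2"
  define N where "N = real n"
  have k: "1 < k" and N: "0 < N" and C: "46 \<le> C" "C \<le> 47" and S: "0 < S" and Tr: "0 < Tr"
    using kappa_gt_1 n_pos c_const_ge c_const_le s4_pos trace_pos by (auto simp: k_def N_def C_def S_def Tr_def)
  have L0: "0 \<le> L" unfolding L_def using K_ge_1 eps by (intro ln_ge_zero) (simp add: field_simps)
  have STr: "S \<le> sqrt k * Tr" using s4_sq_le_trace by (simp add: S_def k_def Tr_def)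
  have kk: "sqrt k * sqrt k = k" using k by simp
  have skS: "sqrt k * S \<le> k * Tr"
    using mult_left_mono[OF STr, of "sqrt k"] k kk by (simp add: mult.assoc[symmetric])
  define z1 where "z1 = sqrt (2.032 * (k - 1) * (0.73 * Tr / \<tau> + L) / N)"
  define z2 where "z2 = sqrt (98.5 * k * Tr / \<tau> / N)"
  have z: "z = z1 + z2"
  proof -
    have "ln (real_of_int (K_grid P n)) + ln (inverse \<epsilon>) = L"
      using K_ge_1 eps by (simp add: L_def ln_div ln_inverse)
    then have "zeta_star P n \<epsilon> \<tau> = sqrt (2.032 * (k - 1) * (0.73 * Tr / \<tau> + L)) + sqrt (98.5 * k * Tr / \<tau>)"
      by (simp only: zeta_star_def k_def Tr_def add.assoc)
    then show ?thesis
      by (simp only: z_def z1_def z2_def N_def real_sqrt_divide) (simp only: add_divide_distrib)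
  qed
  have z10: "0 \<le> z1" unfolding z1_def using k Tr \<tau> L0 N by simp
  have z20: "0 < z2" unfolding z2_def using k Tr \<tau> N by simp
  show z0: "0 < z" using z z10 z20 by simp
  have small': "(6 + inverse (k - 1)) * z \<le> 1"
  proof -
    have "(6 + inverse (k - 1)) * zeta_star P n \<epsilon> \<tau> / sqrt N \<le> sqrt N / sqrt N"
      using small N by (intro divide_right_mono) (auto simp: k_def N_def)
    then show ?thesis using N by (simp add: z_def N_def)
  qed
  have "0 \<le> inverse (k - 1) * z" using k z0 by simp
  then show z6: "6 * z \<le> 1" using small' by (simp add: distrib_right)
  have "z2 \<le> 1/6" using z6 z z10 by simp
  then have "z2^2 \<le> (1/6)^2" using z20 by (intro power_mono) auto
  then have "98.5 * k * Tr / \<tau> / N \<le> 1/36" unfolding z2_def using k Tr \<tau> N by (simp add: power2_eq_square)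
  then have "98.5 * k * Tr / \<tau> \<le> 1/36 * N" using N by (simp only: pos_divide_le_eq)
  then have n_large: "3546 * (k * Tr / \<tau>) \<le> N" by (simp add: mult_ac)
  have "(72 * C * sqrt k) * (S / \<tau>) \<le> N"
  proof -
    have "(72 * C * sqrt k) * (S / \<tau>) = 72 * C * (sqrt k * S / \<tau>)" by simp
    also have "\<dots> \<le> 3546 * (sqrt k * S / \<tau>)"
      using C \<tau> k S by (intro mult_right_mono) auto
    also have "\<dots> \<le> 3546 * (k * Tr / \<tau>)"
      using divide_right_mono[OF skS] \<tau> by (intro mult_left_mono) auto
    finally show ?thesis using n_large by simp
  qed
  then have large: "(72 * (2 + c_const) * sqrt (kappa P)) * ((s4 P)^2 / \<tau>) \<le> real n"
    by (simp only: k_def C_def S_def N_def)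
  define R where "R = (2 + 3 * c_const) / (4 * C) * (S / (sqrt k * \<tau>))"
  define l0 where "l0 = sqrt (2 / (N * (k - 1)) * (R + L))"
  define b0 where "b0 = sqrt (2 * C * sqrt k * S * N * \<tau>)"
  obtain l b where lb: "(l, b) \<in> Lambda_grid P n \<epsilon>"
    and l: "l \<le> exp (1/8) * l0" "l0 \<le> exp (1/8) * l" and b: "b0 \<le> b" "b \<le> exp (1/4) * b0"
    by (rule grid_parameter_near_optimum[OF \<tau> large, of l0 b0])
      (simp_all only: l0_def b0_def R_def k_def C_def S_def N_def L_def)
  note pos = Lambda_grid_pos[OF lb]
  have R0: "0 < R" unfolding R_def using c_const_ge C S k \<tau> by (intro mult_pos_pos divide_pos_pos) auto
  have l0: "0 < l0" unfolding l0_def using N k R0 L0 by (intro real_sqrt_gt_zero mult_pos_pos) auto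
  have b0: "0 < b0" unfolding b0_def using C k S N \<tau> by (intro real_sqrt_gt_zero mult_pos_pos) auto
  have l0_sq: "l0^2 = 2 / (N * (k - 1)) * (R + L)" unfolding l0_def using N k R0 L0 by simp
  have b0_sq: "b0^2 = 2 * C * sqrt k * S * N * \<tau>" unfolding b0_def using C k S N \<tau> by simp
  define w where "w = b0 / (2 * N * \<tau>)"
  define e where "e = C * sqrt k * S / b"
  define d where "d = b / (2 * N * \<tau>)"
  have w0: "0 < w" unfolding w_def using b0 N \<tau> by simp
  have d_eq: "delta_par n l b * l / \<tau> = d" using pos N \<tau> by (simp add: delta_par_def d_def N_def)
  have d_up: "d \<le> exp (1/4) * w"
    unfolding d_def w_def using b N \<tau> by (simp add: divide_right_mono)
  have e_eq: "e = w^2 / d"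
  proof -
    have "w^2 / d = b0^2 / (2 * N * \<tau> * b)" using pos N \<tau>
      by (simp add: w_def d_def power2_eq_square field_simps)
    also have "\<dots> = e" unfolding b0_sq e_def using pos N \<tau> by (simp add: field_simps)
    finally show ?thesis by simp
  qed
  have d0: "0 < d" unfolding d_def using pos N \<tau> by simp
  have F: "1 / exp (1/4::real) = exp (- 1/4)" by (simp add: exp_minus inverse_eq_divide)
  have FF: "exp (1/4::real) * exp (1/4) = exp (1/2)" "exp (- 1/4::real) * exp (- 1/4) = exp (- 1/2)"
      "exp (1/4::real) * exp (- 1/4) = 1" by (simp_all flip: exp_add)
  have de: "d + e \<le> w * (exp (1/4) + exp (- 1/4))"
  proof -
    have "w \<le> d" unfolding w_def d_def using b N \<tau> by (intro divide_right_mono) auto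
    also have "\<dots> \<le> exp (1/4) * d" using mult_right_mono[of 1 "exp (1/4)" d] d0 by simp
    finally show ?thesis
      unfolding e_eq F[symmetric] using d0 w0 d_up by (intro ratio_plus_inverse_le) auto
  qed
  have wz2: "w * (exp (1/4) + exp (- 1/4)) \<le> z2"
  proof (rule power2_le_imp_le)
    have w_sq: "w^2 = C * (sqrt k * S) / (2 * N * \<tau>)"
      unfolding w_def power_divide b0_sq using N \<tau> by (simp add: power2_eq_square field_simps)
    have "(w * (exp (1/4) + exp (- 1/4)))^2 = w^2 * (2 + exp (1/2) + exp (- 1/2))"
      using FF by (simp add: power2_eq_square algebra_simps)
    also have "\<dots> = (C * (2 + exp (1/2) + exp (- 1/2))) * (sqrt k * S) / (2 * N * \<tau>)" by (simp add: w_sq)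
    also have "\<dots> \<le> 197 * (k * Tr) / (2 * N * \<tau>)"
      using c_const_cosh_bound C k S N \<tau> unfolding C_def[symmetric]
      by (intro divide_right_mono mult_mono[OF _ skS]) auto
    also have "\<dots> = z2^2"
    proof -
      have "z2^2 = 98.5 * k * Tr / \<tau> / N" unfolding z2_def using k Tr \<tau> N by simp
      then show ?thesis using \<tau> N by (simp add: field_simps)
    qed
    finally show "(w * (exp (1/4) + exp (- 1/4)))^2 \<le> z2^2" .
  qed (use z20 in simp)
  have d_z: "d \<le> 5/8 * z2"
  proof -
    have "exp (1/4::real) = exp (1/2) * exp (- 1/4)" by (simp flip: exp_add)
    also have "\<dots> \<le> 5/3 * exp (- 1/4)" using exp_half_bounds(2) by (rule mult_right_mono) simp
    finally have "exp (1/4) \<le> 5/8 * (exp (1/4) + exp (- 1/4::real))" by simp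
    then have "exp (1/4) * w \<le> 5/8 * (exp (1/4) + exp (- 1/4)) * w" using w0 by (intro mult_right_mono) auto
    also have "\<dots> = 5/8 * (w * (exp (1/4) + exp (- 1/4)))" by (simp only: mult_ac)
    finally show ?thesis using d_up wz2 by linarith
  qed
  have E: "exp (1/8::real) * exp (1/8) = exp (1/4)" "exp (- 1/8::real) * exp (- 1/8) = exp (- 1/4)"
      "exp (1/8::real) * exp (- 1/8) = 1" by (simp_all flip: exp_add)
  have lz1: "(k - 1) / 2 * (l0 * (exp (1/8) + exp (- 1/8))) \<le> z1"
  proof (rule power2_le_imp_le)
    have R_le: "R \<le> 0.73 * Tr / \<tau>"
    proof -
      have "S / (sqrt k * \<tau>) \<le> Tr / \<tau>" using STr k \<tau> by (simp add: field_simps)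
      moreover have "(2 + 3 * c_const) / (4 * C) \<le> 0.73" using C by (simp add: C_def field_simps)
      ultimately have "R \<le> 0.73 * (Tr / \<tau>)" unfolding R_def using C S k \<tau> by (intro mult_mono) auto
      then show ?thesis by simp
    qed
    have sq: "(x + y)^2 = x * x + 2 * (x * y) + y * y" for x y :: real
      by (simp add: power2_eq_square algebra_simps)
    have cosh_sq: "(exp (1/8) + exp (- 1/8))^2 = 2 + exp (1/4) + exp (- 1/4::real)"
      unfolding sq E by simp
    have "((k - 1) / 2 * (l0 * y))^2 = (k - 1)^2 / 4 * l0^2 * y^2" for y
      by (simp add: power_mult_distrib power_divide)
    then have "((k - 1) / 2 * (l0 * (exp (1/8) + exp (- 1/8))))^2
        = (k - 1)^2 / 4 * l0^2 * (2 + exp (1/4) + exp (- 1/4))"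
      unfolding cosh_sq[symmetric] .
    also have "\<dots> = (k - 1) * (R + L) / (2 * N) * (2 + exp (1/4) + exp (- 1/4))"
    proof -
      have cancel: "h^2 / 4 * (2 / (N * h) * y) = h * y / (2 * N)" if "h \<noteq> 0" for h y :: real
        using that by (simp add: power2_eq_square)
      have "(k - 1)^2 / 4 * l0^2 = (k - 1) * (R + L) / (2 * N)"
        unfolding l0_sq by (rule cancel) (use k in simp)
      then show ?thesis by simp
    qed
    also have "\<dots> \<le> (k - 1) * (0.73 * Tr / \<tau> + L) / (2 * N) * 4.064"
    proof (rule mult_mono)
      show "(k - 1) * (R + L) / (2 * N) \<le> (k - 1) * (0.73 * Tr / \<tau> + L) / (2 * N)"
        using R_le k N by (intro divide_right_mono mult_left_mono add_right_mono) auto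
      show "2 + exp (1/4) + exp (- 1/4) \<le> (4.064::real)" using exp_quarter_bounds by simp
      show "0 \<le> (k - 1) * (0.73 * Tr / \<tau> + L) / (2 * N)"
        using k Tr \<tau> N L0 by (intro divide_nonneg_nonneg mult_nonneg_nonneg add_nonneg_nonneg) auto
    qed simp
    also have "\<dots> = z1^2"
    proof -
      have "0 \<le> 2.032 * (k - 1) * (0.73 * Tr / \<tau> + L) / N"
        using k Tr \<tau> N L0 by (intro divide_nonneg_nonneg mult_nonneg_nonneg add_nonneg_nonneg) auto
      then have z1_sq: "z1^2 = 2.032 * (k - 1) * (0.73 * Tr / \<tau> + L) / N"
        unfolding z1_def by (rule real_sqrt_pow2)
      have "h * y / (2 * N) * 4.064 = 2.032 * h * y / N" for h y by simp
      then show ?thesis unfolding z1_sq .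
    qed
    finally show "((k - 1) / 2 * (l0 * (exp (1/8) + exp (- 1/8))))^2 \<le> z1^2" .
  qed (rule z10)
  have gamma: "gamma_par P n \<epsilon> l b \<le> z1 + e"
  proof -
    have cards: "ln (real (card (Lambda_grid P n \<epsilon>)) / \<epsilon>) \<le> L"
    proof -
      have "real (card (Lambda_grid P n \<epsilon>)) \<le> real_of_int (K_grid P n)"
        using card_Lambda_grid_le[of P n \<epsilon>] K_ge_1 by linarith
      then have "real (card (Lambda_grid P n \<epsilon>)) / \<epsilon> \<le> real_of_int (K_grid P n) / \<epsilon>"
        using eps by (intro divide_right_mono) auto
      moreover have "0 < real (card (Lambda_grid P n \<epsilon>)) / \<epsilon>" using card_Lambda_grid_pos eps by simp
      ultimately show ?thesis unfolding L_def by (subst ln_le_cancel_iff) auto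
    qed
    have "2 * b0^2 * l \<le> 2 * b^2 * l" using b b0 pos by (intro mult_right_mono mult_left_mono power_mono) auto
    moreover have "0 < 2 * b^2 * l" "0 < 2 * b0^2 * l" using pos b0 by simp_all
    moreover have "0 \<le> (2 + 3 * c_const) * s4 P ^ 4" using c_const_ge by simp
    ultimately have "(2 + 3 * c_const) * s4 P ^ 4 / (2 * b^2 * l) \<le> (2 + 3 * c_const) * s4 P ^ 4 / (2 * b0^2 * l)"
      by (intro divide_left_mono mult_pos_pos[of "2 * b^2 * l" "2 * b0^2 * l"])
    also have "\<dots> = R / (N * l)"
    proof -
      have pow4: "s4 P ^ 4 = S * S" by (simp add: S_def flip: power_add)
      have cancel: "h * (S * S) / (2 * (2 * C * q * S * N * \<tau>) * l) = h / (4 * C) * (S / (q * \<tau>)) / (N * l)"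
        if "q \<noteq> 0" for h q :: real
        using that C S N \<tau> pos by simp
      show ?thesis unfolding b0_sq R_def pow4 by (rule cancel) (use k in simp)
    qed
    finally have t1: "(2 + 3 * c_const) * s4 P ^ 4 / (2 * b^2 * l) \<le> R / (N * l)" .
    have t2: "ln (real (card (Lambda_grid P n \<epsilon>)) / \<epsilon>) / (N * l) \<le> L / (N * l)"
      using cards N pos by (intro divide_right_mono) auto
    have cancel: "h / 2 * (2 / (N * h) * y / l) = y / (N * l)" if "h \<noteq> 0" for h y
      using that by simp
    have "(k - 1) / 2 * (l0^2 / l) = (R + L) / (N * l)"
      unfolding l0_sq by (rule cancel) (use k in simp)
    then have t3: "(k - 1) / 2 * (l0^2 / l) = R / (N * l) + L / (N * l)"
      by (simp only: add_divide_distrib)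
    have t4: "l + l0^2 / l \<le> l0 * (exp (1/8) + 1 / exp (1/8))"
      using l l0 pos by (intro ratio_plus_inverse_le) auto
    have F8: "1 / exp (1/8::real) = exp (- 1/8)" by (simp add: exp_minus inverse_eq_divide)
    have "gamma_par P n \<epsilon> l b = (k - 1) / 2 * l + e + (2 + 3 * c_const) * s4 P ^ 4 / (2 * b^2 * l)
        + ln (real (card (Lambda_grid P n \<epsilon>)) / \<epsilon>) / (N * l)"
      by (simp add: gamma_par_def e_def C_def k_def S_def N_def)
    also have "\<dots> \<le> (k - 1) / 2 * l + (k - 1) / 2 * (l0^2 / l) + e" using t1 t2 t3 by linarith
    also have "\<dots> = (k - 1) / 2 * (l + l0^2 / l) + e" by (simp only: distrib_left)
    also have "\<dots> \<le> (k - 1) / 2 * (l0 * (exp (1/8) + 1 / exp (1/8))) + e"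
      using k t4 by (intro add_right_mono mult_left_mono) auto
    also have "\<dots> \<le> z1 + e" using lz1 unfolding F8 by linarith
    finally show ?thesis .
  qed
  have l_z: "l * (k - 1) \<le> 9/8 * z1"
  proof -
    have "exp (1/8::real) = exp (1/4) * exp (- 1/8)" by (simp flip: exp_add)
    also have "\<dots> \<le> 9/7 * exp (- 1/8)" using exp_quarter_bounds(2) by (rule mult_right_mono) simp
    finally have "exp (1/8) \<le> 9/16 * (exp (1/8) + exp (- 1/8::real))" by simp
    then have "exp (1/8) * l0 \<le> 9/16 * (exp (1/8) + exp (- 1/8)) * l0" using l0 by (intro mult_right_mono) auto
    also have "\<dots> = 9/16 * (l0 * (exp (1/8) + exp (- 1/8)))" by (simp only: mult_ac)
    finally have "l \<le> 9/16 * (l0 * (exp (1/8) + exp (- 1/8)))" using l(1) by linarith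
    then have "l * (k - 1) \<le> 9/16 * (l0 * (exp (1/8) + exp (- 1/8))) * (k - 1)"
      using k by (intro mult_right_mono) auto
    also have "\<dots> = 9/8 * ((k - 1) / 2 * (l0 * (exp (1/8) + exp (- 1/8))))"
    proof -
      have "9/16 * y * h = 9/8 * (h / 2 * y)" for y h :: real by simp
      then show ?thesis .
    qed
    also have "\<dots> \<le> 9/8 * z1" by (intro mult_left_mono lz1) simp
    finally show ?thesis .
  qed
  have "gamma_par P n \<epsilon> l b + d \<le> z" using gamma de wz2 z by linarith
  moreover have "mu_par P l b + d \<le> 9/8 * z"
  proof -
    have "mu_par P l b = l * (k - 1) + e" by (simp add: mu_par_def e_def C_def k_def S_def)
    then show ?thesis using l_z de wz2 z z20 by linarith
  qed
  moreover have "d \<le> 5/8 * z" using d_z z z10 by linarith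
  moreover have "xi_par P l \<le> 9/16 * (1 - 5 * z)"
  proof -
    have "xi_par P l = (l * (k - 1)) * ((1 + inverse (k - 1)) / 2)"
    proof -
      have "(h + 1) * l / 2 = l * h * ((1 + inverse h) / 2)" if "h \<noteq> 0" for h
        using that by (simp add: field_simps)
      from this[of "k - 1"] show ?thesis using k by (simp add: xi_par_def k_def)
    qed
    also have "\<dots> \<le> (9/8 * z) * ((1 + inverse (k - 1)) / 2)"
      using l_z z z20 k by (intro mult_right_mono) auto
    also have "\<dots> = 9/16 * ((6 + inverse (k - 1)) * z - 5 * z)" by (simp add: algebra_simps)
    also have "\<dots> \<le> 9/16 * (1 - 5 * z)" using small' by simp
    finally show ?thesis .
  qed
  ultimately show "\<exists>(l, b)\<in>Lambda_grid P n \<epsilon>. gamma_par P n \<epsilon> l b + delta_par n l b * l / \<tau> \<le> z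
      \<and> mu_par P l b + delta_par n l b * l / \<tau> \<le> 9/8 * z \<and> delta_par n l b * l / \<tau> \<le> 5/8 * z
      \<and> xi_par P l \<le> 9/16 * (1 - 5 * z)"
    using lb d_eq by auto
qed

section \<open>The selected estimate\<close>

lemma criterion_inversion_grid:
  assumes lb: "(l, b) \<in> Lambda_grid P n \<epsilon>" and lin: "r_linearized P n \<epsilon> x l b"
    and \<theta>: "\<theta> \<noteq> 0" and \<sigma>: "0 \<le> \<sigma>"
  shows "criterion_inversion (\<lambda>a. r_crit n x l ((sqrt a / norm \<theta>) *\<^sub>R \<theta>) / l)
    (quad_form P \<theta> / (norm \<theta>)^2) (N_tilde n x l \<theta> / (norm \<theta>)^2)
    l (xi_par P l) (mu_par P l b) (gamma_par P n \<epsilon> l b) (delta_par n l b) \<sigma>"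
proof
  note pos = Lambda_grid_pos[OF lb]
  have n: "0 < real n" using n_pos by simp
  show "0 \<le> quad_form P \<theta> / (norm \<theta>)^2" by (simp add: quad_form_nonneg)
  show "0 \<le> N_tilde n x l \<theta> / (norm \<theta>)^2" by (simp add: N_tilde_threshold(1)[OF n_pos pos(1)])
  show "0 \<le> \<sigma>" by (rule \<sigma>)
  show "0 < l" by (rule pos)
  show "0 < xi_par P l" using pos kappa_gt_1 by (simp add: xi_par_def)
  have e: "0 < (2 + c_const) * sqrt (kappa P) * (s4 P)^2 / b"
    using pos kappa_gt_1 c_const_ge s4_pos by (intro divide_pos_pos mult_pos_pos) auto
  then show "0 < mu_par P l b" using pos kappa_gt_1 by (simp add: mu_par_def add_pos_pos)
  show "0 < gamma_par P n \<epsilon> l b"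
  proof -
    have "1 \<le> real (card (Lambda_grid P n \<epsilon>))" using card_Lambda_grid_pos by simp
    then have "0 \<le> ln (real (card (Lambda_grid P n \<epsilon>)) / \<epsilon>)" using eps by (intro ln_ge_zero) (simp add: field_simps)
    then have "0 \<le> ln (real (card (Lambda_grid P n \<epsilon>)) / \<epsilon>) / (real n * l)" using pos n by simp
    moreover have "0 \<le> (2 + 3 * c_const) * s4 P ^ 4 / (2 * b^2 * l)" using pos c_const_ge by simp
    moreover have "0 \<le> l / 2 * (kappa P - 1)" using pos kappa_gt_1 by simp
    ultimately show ?thesis using e unfolding gamma_par_def by linarith
  qed
  show "0 < delta_par n l b" using pos n by (simp add: delta_par_def)
  fix a :: real assume a: "0 < a"
  have na: "norm ((sqrt a / norm \<theta>) *\<^sub>R \<theta>) ^ 2 = a" using a \<theta> by simp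
  have qa: "quad_form P ((sqrt a / norm \<theta>) *\<^sub>R \<theta>) = a * (quad_form P \<theta> / (norm \<theta>)^2)"
    using a by (simp add: quad_form_scaleR power_divide)
  show "\<bar>r_crit n x l ((sqrt a / norm \<theta>) *\<^sub>R \<theta>) / l - (a * (quad_form P \<theta> / (norm \<theta>)^2) / l - 1)\<bar>
    \<le> xi_par P l * (a * (quad_form P \<theta> / (norm \<theta>)^2) / l - 1)^2
      + mu_par P l b * (a * (quad_form P \<theta> / (norm \<theta>)^2) / l - 1) + gamma_par P n \<epsilon> l b + delta_par n l b * a"
    using lin[unfolded r_linearized_def Let_def, rule_format, of "(sqrt a / norm \<theta>) *\<^sub>R \<theta>"] unfolding qa na .
  have \<alpha>: "0 < sqrt a / norm \<theta>" "(sqrt a / norm \<theta>)^2 * N_tilde n x l \<theta> = a * (N_tilde n x l \<theta> / (norm \<theta>)^2)"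
    using a \<theta> by (auto simp: power_divide)
  {
    assume "a * (N_tilde n x l \<theta> / (norm \<theta>)^2) \<le> l"
    then have "r_crit n x l ((sqrt a / norm \<theta>) *\<^sub>R \<theta>) \<le> 0"
      unfolding \<alpha>(2)[symmetric] by (rule N_tilde_threshold(2)[OF n_pos pos(1) \<alpha>(1)])
    then show "r_crit n x l ((sqrt a / norm \<theta>) *\<^sub>R \<theta>) / l \<le> 0" using pos by (simp add: divide_nonpos_pos)
  }
  {
    assume "l \<le> a * (N_tilde n x l \<theta> / (norm \<theta>)^2)"
    then have "0 \<le> r_crit n x l ((sqrt a / norm \<theta>) *\<^sub>R \<theta>)"
      unfolding \<alpha>(2)[symmetric] by (rule N_tilde_threshold(3)[OF n_pos pos(1) \<alpha>(1)])
    then show "0 \<le> r_crit n x l ((sqrt a / norm \<theta>) *\<^sub>R \<theta>) / l" using pos by simp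
  }
qed

text \<open>If the right-hand side is finite, some grid parameter has a value of \<open>B_bound\<close> at most the right-hand
  side.  The selected parameter does at least as well, and its own value of \<open>B_bound\<close> controls its
  relative error.\<close>

lemma selected_estimate_bound:
  assumes lin: "\<And>l b. (l, b) \<in> Lambda_grid P n \<epsilon> \<Longrightarrow> r_linearized P n \<epsilon> x l b"
    and \<theta>: "\<theta> \<noteq> 0" and \<sigma>: "0 \<le> \<sigma>" "\<sigma> \<le> (s4 P)^2"
    and sel: "selectable P n \<epsilon> \<sigma> x \<theta> lb"
  shows "\<bar>ereal (max (quad_form P \<theta>) (\<sigma> * (norm \<theta>)^2)) /
          ereal (max (N_tilde n x (fst lb) \<theta>) (\<sigma> * (norm \<theta>)^2)) - 1\<bar>
       \<le> B_star P n \<epsilon> \<sigma> (quad_form P \<theta> / (norm \<theta>)^2)"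
proof -
  define t where "t = quad_form P \<theta> / (norm \<theta>)^2"
  define T where "T l = N_tilde n x l \<theta> / (norm \<theta>)^2" for l
  have n2: "0 < (norm \<theta>)^2" using \<theta> by simp
  let ?z = "zeta_star P n \<epsilon> (max t \<sigma>) / sqrt (real n)"
  show ?thesis
  proof (cases "0 < max t \<sigma> \<and> (6 + inverse (kappa P - 1)) * zeta_star P n \<epsilon> (max t \<sigma>) \<le> sqrt (real n)")
    case False
    then have "B_star P n \<epsilon> \<sigma> t = \<infinity>" by (simp add: B_star_def Let_def)
    then show ?thesis by (simp add: t_def)
  next
    case True
    have \<tau>: "0 < max t \<sigma>" "max t \<sigma> \<le> (s4 P)^2"
      using True \<sigma> quad_form_le[of \<theta>] n2 by (auto simp: t_def divide_le_eq)
    have Bs: "B_star P n \<epsilon> \<sigma> t = ereal (?z / (1 - 4 * ?z))" using True by (simp add: B_star_def Let_def)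
    note zb = grid_parameter_bounds[OF \<tau> conjunct2[OF True]]
    obtain l b where lb: "(l, b) \<in> Lambda_grid P n \<epsilon>"
      and near: "gamma_par P n \<epsilon> l b + delta_par n l b * l / max t \<sigma> \<le> ?z"
       "mu_par P l b + delta_par n l b * l / max t \<sigma> \<le> 9/8 * ?z" "delta_par n l b * l / max t \<sigma> \<le> 5/8 * ?z"
       "xi_par P l \<le> 9/16 * (1 - 5 * ?z)"
      using zb(3) by blast
    interpret g: criterion_inversion "\<lambda>a. r_crit n x l ((sqrt a / norm \<theta>) *\<^sub>R \<theta>) / l" t "T l"
        l "xi_par P l" "mu_par P l b" "gamma_par P n \<epsilon> l b" "delta_par n l b" \<sigma>
      unfolding t_def T_def by (rule criterion_inversion_grid[OF lb lin[OF lb] \<theta> \<sigma>(1)])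
    note gb = g.bound_at_threshold_le[OF \<tau>(1) zb(1,2) near]
    have "B_bound P n \<epsilon> \<sigma> (l, b) (T l) \<le> ereal (?z / (1 - 4 * ?z))"
      using gb by (simp add: B_bound_def Let_def)
    moreover obtain l' b' where lb': "lb = (l', b')" by (cases lb)
    moreover have in': "(l', b') \<in> Lambda_grid P n \<epsilon>"
      and min: "\<not> B_bound P n \<epsilon> \<sigma> (l, b) (T l) < B_bound P n \<epsilon> \<sigma> (l', b') (T l')"
      using sel lb unfolding selectable_def is_arg_min_def lb' T_def by auto
    ultimately have B': "B_bound P n \<epsilon> \<sigma> (l', b') (T l') \<le> ereal (?z / (1 - 4 * ?z))" by simp
    let ?m = "max (T l') \<sigma>"
    have fin: "0 < ?m" "xi_par P l' + mu_par P l' b' + gamma_par P n \<epsilon> l' b' + 2 * delta_par n l' b' * l' / ?m < 1"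
      using B' by (auto simp: B_bound_def Let_def split: if_splits)
    have B'_eq: "B_bound P n \<epsilon> \<sigma> (l', b') (T l') = ereal ((gamma_par P n \<epsilon> l' b' + l' * delta_par n l' b' / ?m)
        / (1 - mu_par P l' b' - gamma_par P n \<epsilon> l' b' - 2 * l' * delta_par n l' b' / ?m))"
      using fin by (simp add: B_bound_def Let_def)
    interpret h: criterion_inversion "\<lambda>a. r_crit n x l' ((sqrt a / norm \<theta>) *\<^sub>R \<theta>) / l'" t "T l'"
        l' "xi_par P l'" "mu_par P l' b'" "gamma_par P n \<epsilon> l' b'" "delta_par n l' b'" \<sigma>
      unfolding t_def T_def by (rule criterion_inversion_grid[OF in' lin[OF in'] \<theta> \<sigma>(1)])
    have err: "ereal \<bar>max t \<sigma> / ?m - 1\<bar> \<le> B_star P n \<epsilon> \<sigma> t"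
      using h.relative_error_le[OF fin] B' unfolding B'_eq Bs by simp
    have scale: "max (u * (norm \<theta>)^2) (\<sigma> * (norm \<theta>)^2) = max u \<sigma> * (norm \<theta>)^2" for u
      using n2 by (simp add: max_mult_distrib_right)
    have "max (quad_form P \<theta>) (\<sigma> * (norm \<theta>)^2) = max t \<sigma> * (norm \<theta>)^2"
      "max (N_tilde n x l' \<theta>) (\<sigma> * (norm \<theta>)^2) = ?m * (norm \<theta>)^2"
      using scale[of t] scale[of "T l'"] n2 by (simp_all add: t_def T_def)
    then have "\<bar>ereal (max (quad_form P \<theta>) (\<sigma> * (norm \<theta>)^2)) /
          ereal (max (N_tilde n x l' \<theta>) (\<sigma> * (norm \<theta>)^2)) - 1\<bar> = ereal \<bar>max t \<sigma> / ?m - 1\<bar>"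
      using n2 fin by (simp add: one_ereal_def)
    then show ?thesis using err by (simp add: lb' t_def)
  qed
qed

end

theorem proposition2p3:
  fixes P :: "(real^'d) measure"
    and M :: "'w measure"
    and X :: "nat \<Rightarrow> 'w \<Rightarrow> real^'d"
    and n :: nat
    and \<sigma> \<epsilon> :: real
    and sel :: "'w \<Rightarrow> real^'d \<Rightarrow> real \<times> real"
  assumes P_prob: "prob_space P" and P_borel: "sets P = sets borel"
    and M_prob: "prob_space M"
    and n_pos: "1 \<le> n"
    and indep: "prob_space.indep_vars M (\<lambda>_. borel) X {1..n}"
    and law: "\<And>i. i \<in> {1..n} \<Longrightarrow> distr M borel (X i) = P"
    and s4_finite: "integrable P (\<lambda>x. norm x ^ 4)"
    and kappa_finite: "kappa_ext P < \<infinity>"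
    and kappa_gt_1: "1 < kappa P"
    and K_ge_1: "1 \<le> K_grid P n"
    and sigma_nonneg: "0 \<le> \<sigma>" and sigma_le: "\<sigma> \<le> (s4 P)^2"
    and eps: "0 < \<epsilon>" "\<epsilon> < 1"
    and sel: "\<And>\<omega> \<theta>. \<omega> \<in> space M \<Longrightarrow> \<theta> \<noteq> 0 \<Longrightarrow> selectable P n \<epsilon> \<sigma> (\<lambda>i. X i \<omega>) \<theta> (sel \<omega> \<theta>)"
  defines "N_hat \<equiv> \<lambda>\<omega> \<theta>. N_tilde n (\<lambda>i. X i \<omega>) (fst (sel \<omega> \<theta>)) \<theta>"
  shows "\<exists>A\<in>sets M. 1 - 2 * \<epsilon> \<le> measure M A \<and>
    (\<forall>\<omega>\<in>A. \<forall>\<theta>. \<theta> \<noteq> 0 \<longrightarrow>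
       \<bar>ereal (max (quad_form P \<theta>) (\<sigma> * (norm \<theta>)^2)) /
          ereal (max (N_hat \<omega> \<theta>) (\<sigma> * (norm \<theta>)^2)) - 1\<bar>
       \<le> B_star P n \<epsilon> \<sigma> (quad_form P \<theta> / (norm \<theta>)^2))"
proof -
  interpret sample_setting P M X n \<epsilon>
    by (intro sample_setting.intro iid_sample.intro bounded_kurtosis_law.intro heavy_tailed_law.intro
        iid_sample_axioms.intro bounded_kurtosis_law_axioms.intro heavy_tailed_law_axioms.intro
        sample_setting_axioms.intro assms)
  obtain A where A: "A \<in> sets M" "1 - 2 * \<epsilon> \<le> measure M A"
    and lin: "\<And>\<omega> l b. \<omega> \<in> A \<Longrightarrow> (l, b) \<in> Lambda_grid P n \<epsilon> \<Longrightarrow> r_linearized P n \<epsilon> (\<lambda>i. X i \<omega>) l b"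
    using r_linearized_event by blast
  have "\<omega> \<in> space M" if "\<omega> \<in> A" for \<omega> using that A(1) sets.sets_into_space by blast
  then show ?thesis
    unfolding N_hat_def using A lin sel sigma_nonneg sigma_le
    by (intro bexI[of _ A] conjI ballI allI impI selected_estimate_bound) auto
qed

end
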